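(* Let $(Z_n)_{n\ge 0}$ be the $d$-type branching process with immigration in the stationary ergodic random environment $\omega$ described in the context, and assume: (A1) $E_P(\log^+\|I_0\|_1)<\infty$; (A2) $E_P(\log^+\|M_0\|_1)<\infty$; (A3) $\lim_{n\to\infty} n^{-1}E_P(\log\|M_{n-1}\cdots M_1M_0\|_1)<0$; and that $P\big(P_\omega(Z_1=\mathbf{0}\mid Z_0=\mathbf{1})>0\big)=1$. Then the Markov chain $(x_n)_{n\in\mathbb{N}}$ on $(\mathbb{X},\Xi)$ with initial distribution $\mathbb{Q}$ and transition kernel $K$ (all defined in the context) is stationary and ergodic.
   Context: Fix an integer $d\ge 1$. The environment $\omega=(\omega_n)_{n\in\mathbb{Z}}$ is a stationary ergodic sequence of random variables with values in a measurable space $(\mathcal{S},\mathcal{B})$; its law on $(\Omega,\mathcal{F})=(\mathcal{S}^{\mathbb{Z}},\mathcal{B}^{\otimes\mathbb{Z}})$ is $P$, with expectation $E_P$. Let $\mathcal{P}_d$ be the set of probability measures on $\mathbb{Z}_+^d$ ($\mathbb{Z}_+=\mathbb{N}\cup\{0\}$), and let $q,p_1,\dots,p_d:\mathcal{S}\to\mathcal{P}_d$ be measurable. Given $\omega$, under the quenched law $P_\omega$ (expectation $E_\omega$), all of the following random vectors in $\mathbb{Z}_+^d$ are independent: the immigration vectors $X_n=(X_n^{(1)},\dots,X_n^{(d)})$, $n\in\mathbb{Z}_+$, with $X_n$ of law $q_{\omega,n}=q(\omega_{n-1})$; and the offspring vectors $L_{n,m}^{(i)}=(L_{n,m}^{(i,1)},\dots,L_{n,m}^{(i,d)})$,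 $n\in\mathbb{Z}_+$, $m\in\mathbb{N}$, $1\le i\le d$, with $L_{n,m}^{(i)}$ of law $p^{(i)}_{\omega,n}=p_i(\omega_n)$. The process is defined by $Z_0=\mathbf{0}=(0,\dots,0)$ and $$Z_{n+1}=\sum_{i=1}^d\sum_{m=1}^{Z_n^{(i)}+X_n^{(i)}}L_{n,m}^{(i)},\qquad n\ge 0.$$ The joint (annealed) law is $\mathbb{P}=P\otimes P_\omega$. $P_\omega(Z_1=\mathbf{0}\mid Z_0=\mathbf{1})$ denotes the probability that the process given by the same recursion but started from $Z_0=\mathbf{1}=(1,\dots,1)$ is at $\mathbf{0}$ at time $1$. Write $I_n=I_n(\omega)=(E_\omega X_n^{(1)},\dots,E_\omega X_n^{(d)})$ and let $M_n=M_n(\omega)$ be the $d\times d$ matrix whose $i$th column is $(E_\omega L_{n,1}^{(i,1)},\dots,E_\omega L_{n,1}^{(i,d)})$. $\|v\|_1=\sum_i|v^{(i)}|$ for $v\in\mathbb{R}^d$, and $\|A\|_1$ is the corresponding operator norm for matrices; $\log^+x=\max\{0,\log x\}$, $\log 0=-\infty$. Stationary version: let $\theta$ be the shift $(\theta\omega)_n=\omega_{n+1}$. Let $U_{i,n}\in\mathbb{Z}_+^d$ ($n\ge i$) count by type the descendants in generation $n$ of the immigrants arriving at time $i$, with $U_{i,i}=X_i$, so that $Z_n=\sum_{i=0}^{n-1}U_{i,n}$. Enlarge the probability space to include $X_i$ and $\mathcal{U}_i=(U_{i,n})_{n\ge i}$ also for $i<0$, so that given $\omega$ the processes $(\mathcal{U}_i)_{i\in\mathbb{Z}}$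 are independent and $P_\omega(\mathcal{U}_i\in\cdot)=P_{\theta^i\omega}(\mathcal{U}_0\in\cdot)$ for $i<0$. Put $\widetilde{Z}_n=\sum_{i=-\infty}^{n-1}U_{i,n}$, $n\in\mathbb{Z}$. Let $\pi_\omega(v)=P_\omega(\widetilde{Z}_0=v)$ and $\pi(v)=E_P(\pi_\omega(v))$ for $v\in\mathbb{Z}_+^d$, and let $\widetilde{P}$ be the probability measure on $(\Omega,\mathcal{F})$ with density $\frac{d\widetilde{P}}{dP}(\omega)=\frac{\pi_\omega(\mathbf{0})}{\pi(\mathbf{0})}$ (under the hypotheses, $\pi(\mathbf{0})>0$). The chain: let $\Upsilon_d=\bigcup_{n\in\mathbb{Z}_+}(\mathbb{Z}_+^d\setminus\{\mathbf{0}\})^n\times\{\mathbf{0}\}$ (finite sequences in $\mathbb{Z}_+^d$ whose last entry, and only the last, is $\mathbf{0}$), with the discrete topology; $\mathbb{X}=\Omega\times\mathbb{N}\times\Upsilon_d$ with product $\sigma$-algebra $\Xi$. Write $Z_{[1,j]}=(Z_1,\dots,Z_j)$. For $\omega\in\Omega$, $i,j\in\mathbb{N}$, $\mathbf{x},\mathbf{y}\in\Upsilon_d$, $A\in\mathcal{F}$, $$K(\omega,i,\mathbf{x};A,j,\mathbf{y})=P_\omega(Z_{[1,j]}=\mathbf{y})\,\mathbf{I}_{\theta^{-j}A}(\omega),$$ $$\mathbb{Q}(A,i,\mathbf{x})=\int_\Omega P_\omega(Z_{[1,i]}=\mathbf{x})\,\mathbf{I}_{\theta^{-i}A}(\omega)\,\widetilde{P}(d\omega),$$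 where $\mathbf{I}_{\theta^{-j}A}(\omega)=1$ if $\theta^j\omega\in A$ and $0$ otherwise. (With $\nu_0=0$, $\nu_n=\inf\{i>\nu_{n-1}:Z_i=\mathbf{0}\}$, these are the transition kernel and initial law of $x_n=(\theta^{\nu_n}\omega,\nu_n-\nu_{n-1},(Z_{\nu_{n-1}+1},\dots,Z_{\nu_n}))$ when $(\omega,(Z_n)_{n\ge0})$ has the law of $(\omega,(\widetilde{Z}_n)_{n\ge0})$ under $\mathbb{P}(\cdot\mid\widetilde{Z}_0=\mathbf{0})$.) Ergodic means that every event of the path space $\mathbb{X}^{\mathbb{N}}$ invariant under the shift has probability $0$ or $1$. *)

theory Defs
  imports "HOL-Probability.Probability"
begin

section \<open>Stationary and ergodic transformations\<close>

definition stationary_under :: "'x measure \<Rightarrow> ('x \<Rightarrow> 'x) \<Rightarrow> bool" where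
  "stationary_under M T \<longleftrightarrow> T \<in> M \<rightarrow>\<^sub>M M \<and> distr M M T = M"

definition ergodic_under :: "'x measure \<Rightarrow> ('x \<Rightarrow> 'x) \<Rightarrow> bool" where
  "ergodic_under M T \<longleftrightarrow>
     (\<forall>A\<in>sets M. T -` A \<inter> space M = A \<longrightarrow> measure M A = 0 \<or> measure M A = 1)"

section \<open>Environment and quenched law\<close>

text \<open>Types of individuals are the elements of the finite type \<^typ>\<open>'d\<close>, so \<open>d = CARD('d)\<close>, and
  \<open>nat^'d\<close> is the set of vectors \<open>\<int>\<^sub>+\<^sup>d\<close>.  Only the measurable space underlying \<open>S\<close> is used.\<close>

abbreviation env_space :: "'s measure \<Rightarrow> (int \<Rightarrow> 's) measure" where
  "env_space S \<equiv> Pi\<^sub>M UNIV (\<lambda>_. S)"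

definition env_shift :: "int \<Rightarrow> (int \<Rightarrow> 's) \<Rightarrow> (int \<Rightarrow> 's)" where
  "env_shift k \<omega> = (\<lambda>n. \<omega> (n + k))"

text \<open>A sample point of the quenched space consists of all immigration vectors \<open>X\<^sub>n\<close> and all
  offspring vectors \<open>L\<^sub>n\<^sub>,\<^sub>m\<^sup>(\<^sup>i\<^sup>)\<close>, indexed by triples \<open>(n, m, i)\<close>.  Offspring labels \<open>m\<close> start
  at \<open>1\<close>; the coordinates with \<open>m = 0\<close> are never used.\<close>

type_synonym 'd sample = "(nat \<Rightarrow> nat^'d) \<times> (nat \<times> nat \<times> 'd \<Rightarrow> nat^'d)"

definition immigrants :: "'d sample \<Rightarrow> nat \<Rightarrow> nat^'d" where
  "immigrants \<xi> n = fst \<xi> n"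

definition offspring :: "'d sample \<Rightarrow> nat \<Rightarrow> nat \<Rightarrow> 'd \<Rightarrow> nat^'d" where
  "offspring \<xi> n m i = snd \<xi> (n, m, i)"

definition quenched ::
  "('s \<Rightarrow> (nat^'d::finite) pmf) \<Rightarrow> ('d \<Rightarrow> 's \<Rightarrow> (nat^'d) pmf) \<Rightarrow> (int \<Rightarrow> 's) \<Rightarrow> 'd sample measure" where
  "quenched q p \<omega> =
     Pi\<^sub>M UNIV (\<lambda>n. measure_pmf (q (\<omega> (int n - 1)))) \<Otimes>\<^sub>M
     Pi\<^sub>M UNIV (\<lambda>(n, m, i). measure_pmf (p i (\<omega> (int n))))"

section \<open>The branching process with immigration\<close>

text \<open>\<open>Z z\<^sub>0 \<xi> n\<close> is the process started from \<open>z\<^sub>0\<close>.\<close>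

primrec Z :: "nat^'d::finite \<Rightarrow> 'd sample \<Rightarrow> nat \<Rightarrow> nat^'d" where
  "Z z0 \<xi> 0 = z0"
| "Z z0 \<xi> (Suc n) =
     (\<Sum>i\<in>UNIV. \<Sum>m = 1..Z z0 \<xi> n $ i + immigrants \<xi> n $ i. offspring \<xi> n m i)"

definition Z_block :: "'d::finite sample \<Rightarrow> nat \<Rightarrow> (nat^'d) list" where
  "Z_block \<xi> j = map (Z 0 \<xi>) [1..<j + 1]"

section \<open>Means and norms\<close>

definition norm1 :: "real^'d::finite \<Rightarrow> real" where
  "norm1 v = (\<Sum>i\<in>UNIV. \<bar>v $ i\<bar>)"

text \<open>As in \<^const>\<open>onorm\<close>, the vector \<open>v = 0\<close> contributes \<open>0 / 0 = 0\<close>.\<close>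

definition opnorm1 :: "real^'d^'d::finite \<Rightarrow> real" where
  "opnorm1 A = (SUP v. norm1 (A *v v) / norm1 v)"

text \<open>On \<open>{0..}\<close> this is the usual \<open>log\<^sup>+\<close>, also at \<open>0\<close>, where \<^term>\<open>ln 0 = (0::real)\<close>.\<close>

definition log_plus :: "real \<Rightarrow> real" where
  "log_plus x = max 0 (ln x)"

definition ext_log :: "real \<Rightarrow> ereal" where
  "ext_log x = (if x = 0 then -\<infinity> else ereal (ln x))"

text \<open>Expectation of an extended real function whose positive part is integrable; the value
  \<open>-\<infinity>\<close> is possible.\<close>

definition ext_expectation :: "'x measure \<Rightarrow> ('x \<Rightarrow> ereal) \<Rightarrow> ereal" where
  "ext_expectation M f =
     enn2ereal (\<integral>\<^sup>+x. e2ennreal (f x) \<partial>M) - enn2ereal (\<integral>\<^sup>+x. e2ennreal (- f x) \<partial>M)"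

text \<open>Quenched means.  The Bochner integral returns \<open>0\<close> for an infinite mean, so finiteness of the
  means has to be required separately (\<open>finite_mean_immigration\<close>, \<open>finite_mean_matrix\<close>).  Then
  \<open>E\<^sub>P (log\<^sup>+ \<parallel>I\<^sub>0\<parallel>) < \<infinity>\<close> means that \<open>I\<^sub>0\<close> is almost surely finite and \<open>log\<^sup>+ \<parallel>I\<^sub>0\<parallel>\<close> is integrable.\<close>

definition mean_immigration ::
  "('s \<Rightarrow> (nat^'d::finite) pmf) \<Rightarrow> ('d \<Rightarrow> 's \<Rightarrow> (nat^'d) pmf) \<Rightarrow> (int \<Rightarrow> 's) \<Rightarrow> nat \<Rightarrow> real^'d" where
  "mean_immigration q p \<omega> n = (\<chi> i. \<integral>\<xi>. real (immigrants \<xi> n $ i) \<partial>quenched q p \<omega>)"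

definition mean_matrix ::
  "('s \<Rightarrow> (nat^'d::finite) pmf) \<Rightarrow> ('d \<Rightarrow> 's \<Rightarrow> (nat^'d) pmf) \<Rightarrow> (int \<Rightarrow> 's) \<Rightarrow> nat \<Rightarrow> real^'d^'d" where
  "mean_matrix q p \<omega> n = (\<chi> j i. \<integral>\<xi>. real (offspring \<xi> n 1 i $ j) \<partial>quenched q p \<omega>)"

definition finite_mean_immigration ::
  "('s \<Rightarrow> (nat^'d::finite) pmf) \<Rightarrow> ('d \<Rightarrow> 's \<Rightarrow> (nat^'d) pmf) \<Rightarrow> (int \<Rightarrow> 's) \<Rightarrow> nat \<Rightarrow> bool" where
  "finite_mean_immigration q p \<omega> n \<longleftrightarrow>
     (\<forall>i. integrable (quenched q p \<omega>) (\<lambda>\<xi>. real (immigrants \<xi> n $ i)))"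

definition finite_mean_matrix ::
  "('s \<Rightarrow> (nat^'d::finite) pmf) \<Rightarrow> ('d \<Rightarrow> 's \<Rightarrow> (nat^'d) pmf) \<Rightarrow> (int \<Rightarrow> 's) \<Rightarrow> nat \<Rightarrow> bool" where
  "finite_mean_matrix q p \<omega> n \<longleftrightarrow>
     (\<forall>i j. integrable (quenched q p \<omega>) (\<lambda>\<xi>. real (offspring \<xi> n 1 i $ j)))"

text \<open>\<open>mean_matrix_prod q p \<omega> n\<close> is \<open>M\<^sub>n\<^sub>-\<^sub>1 \<cdots> M\<^sub>1 M\<^sub>0\<close>.\<close>

primrec mean_matrix_prod ::
  "('s \<Rightarrow> (nat^'d::finite) pmf) \<Rightarrow> ('d \<Rightarrow> 's \<Rightarrow> (nat^'d) pmf) \<Rightarrow> (int \<Rightarrow> 's) \<Rightarrow> nat \<Rightarrow> real^'d^'d" where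
  "mean_matrix_prod q p \<omega> 0 = mat 1"
| "mean_matrix_prod q p \<omega> (Suc n) = mean_matrix q p \<omega> n ** mean_matrix_prod q p \<omega> n"

section \<open>Families of immigrants and the stationary version\<close>

text \<open>\<open>U \<xi> n i\<close> is the vector \<open>U\<^sub>i\<^sub>,\<^sub>n\<close> of descendants in generation \<open>n\<close> of the immigrants arriving at
  time \<open>i\<close> (zero for \<open>i > n\<close>).  In each generation and each type the individuals are numbered
  \<open>1, 2, \<dots>\<close>, families of earlier immigrants first; so the members of family \<open>i\<close> and type \<open>j\<close> have
  the numbers \<open>m\<close> with \<open>(\<Sum>k<i. U \<xi> n k $ j) < m \<le> (\<Sum>k\<le>i. U \<xi> n k $ j)\<close>.\<close>

primrec U :: "'d::finite sample \<Rightarrow> nat \<Rightarrow> nat \<Rightarrow> nat^'d" where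
  "U \<xi> 0 = (\<lambda>i. if i = 0 then immigrants \<xi> 0 else 0)"
| "U \<xi> (Suc n) = (\<lambda>i.
     if i \<le> n then
       (\<Sum>j\<in>UNIV. \<Sum>m\<in>{(\<Sum>k<i. U \<xi> n k $ j)<..(\<Sum>k\<le>i. U \<xi> n k $ j)}. offspring \<xi> n m j)
     else if i = Suc n then immigrants \<xi> (Suc n) else 0)"

text \<open>Law of the process \<open>\<U>\<^sub>0 = (U\<^sub>0\<^sub>,\<^sub>n)\<^sub>n\<close> under \<open>P\<^sub>\<omega>\<close>.\<close>

definition family_law ::
  "('s \<Rightarrow> (nat^'d::finite) pmf) \<Rightarrow> ('d \<Rightarrow> 's \<Rightarrow> (nat^'d) pmf) \<Rightarrow> (int \<Rightarrow> 's) \<Rightarrow> (nat \<Rightarrow> nat^'d) measure" where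
  "family_law q p \<omega> =
     distr (quenched q p \<omega>) (Pi\<^sub>M UNIV (\<lambda>_. count_space UNIV)) (\<lambda>\<xi> n. U \<xi> n 0)"

text \<open>The enlarged quenched space: independent of the original sample point, there are independent
  families \<open>\<U>\<^sub>i = (U\<^sub>i\<^sub>,\<^sub>i\<^sub>+\<^sub>k)\<^sub>k\<close> for \<open>i < 0\<close>, with the law of \<open>\<U>\<^sub>0\<close> in the environment \<open>\<theta>\<^sup>i\<omega>\<close>.\<close>

type_synonym 'd ext_sample = "'d sample \<times> (int \<Rightarrow> nat \<Rightarrow> nat^'d)"

definition quenched_ext ::
  "('s \<Rightarrow> (nat^'d::finite) pmf) \<Rightarrow> ('d \<Rightarrow> 's \<Rightarrow> (nat^'d) pmf) \<Rightarrow> (int \<Rightarrow> 's) \<Rightarrow> 'd ext_sample measure" where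
  "quenched_ext q p \<omega> =
     quenched q p \<omega> \<Otimes>\<^sub>M Pi\<^sub>M {..<0} (\<lambda>i. family_law q p (env_shift i \<omega>))"

text \<open>Meaningful for \<open>i \<le> n\<close> only.\<close>

definition U_ext :: "'d::finite ext_sample \<Rightarrow> int \<Rightarrow> int \<Rightarrow> nat^'d" where
  "U_ext \<zeta> i n =
     (if i < 0 then snd \<zeta> i (nat (n - i)) else U (fst \<zeta>) (nat n) (nat i))"

text \<open>The infinite sum is taken in \<^typ>\<open>enat\<close>, so that no convergence has to be presupposed.\<close>

definition Z_tilde :: "'d::finite ext_sample \<Rightarrow> int \<Rightarrow> enat^'d" where
  "Z_tilde \<zeta> n = (\<chi> j. \<Sum>\<^sub>\<infinity>i\<in>{..<n}. enat (U_ext \<zeta> i n $ j))"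

definition pi_quenched ::
  "('s \<Rightarrow> (nat^'d::finite) pmf) \<Rightarrow> ('d \<Rightarrow> 's \<Rightarrow> (nat^'d) pmf) \<Rightarrow> (int \<Rightarrow> 's) \<Rightarrow> nat^'d \<Rightarrow> real" where
  "pi_quenched q p \<omega> v =
     measure (quenched_ext q p \<omega>)
       {\<zeta> \<in> space (quenched_ext q p \<omega>). Z_tilde \<zeta> 0 = (\<chi> j. enat (v $ j))}"

definition pi_annealed ::
  "('s \<Rightarrow> (nat^'d::finite) pmf) \<Rightarrow> ('d \<Rightarrow> 's \<Rightarrow> (nat^'d) pmf) \<Rightarrow> (int \<Rightarrow> 's) measure \<Rightarrow> nat^'d \<Rightarrow> real" where
  "pi_annealed q p P v = (\<integral>\<omega>. pi_quenched q p \<omega> v \<partial>P)"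

definition P_tilde ::
  "('s \<Rightarrow> (nat^'d::finite) pmf) \<Rightarrow> ('d \<Rightarrow> 's \<Rightarrow> (nat^'d) pmf) \<Rightarrow> (int \<Rightarrow> 's) measure \<Rightarrow> (int \<Rightarrow> 's) measure" where
  "P_tilde q p P = density P (\<lambda>\<omega>. ennreal (pi_quenched q p \<omega> 0 / pi_annealed q p P 0))"

section \<open>The chain of environments and excursions\<close>

definition Upsilon :: "(nat^'d::finite) list set" where
  "Upsilon = {ys @ [0] | ys. 0 \<notin> set ys}"

type_synonym ('s, 'd) state = "(int \<Rightarrow> 's) \<times> nat \<times> (nat^'d) list"

definition state_space :: "'s measure \<Rightarrow> ('s, 'd::finite) state measure" where
  "state_space S = env_space S \<Otimes>\<^sub>M count_space {1..} \<Otimes>\<^sub>M count_space Upsilon"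

definition block_prob ::
  "('s \<Rightarrow> (nat^'d::finite) pmf) \<Rightarrow> ('d \<Rightarrow> 's \<Rightarrow> (nat^'d) pmf) \<Rightarrow> (int \<Rightarrow> 's) \<Rightarrow> nat \<Rightarrow> (nat^'d) list \<Rightarrow> real" where
  "block_prob q p \<omega> j y =
     measure (quenched q p \<omega>) {\<xi> \<in> space (quenched q p \<omega>). Z_block \<xi> j = y}"

text \<open>The kernel \<open>K(\<omega>, i, x; \<cdot>)\<close>, as the measure that puts mass \<open>P\<^sub>\<omega>(Z\<^sub>[\<^sub>1\<^sub>,\<^sub>j\<^sub>] = y)\<close> on
  \<open>(\<theta>\<^sup>j\<omega>, j, y)\<close>; it does not depend on \<open>i\<close> and \<open>x\<close>.  The defining formula on product sets is
  lemma \<open>emeasure_kernel\<close> below.  The total mass is \<open>P\<^sub>\<omega>(\<nu>\<^sub>1 < \<infinity>)\<close>, which may be smaller than \<open>1\<close> for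
  exceptional \<open>\<omega>\<close>.\<close>

definition chain_kernel ::
  "'s measure \<Rightarrow> ('s \<Rightarrow> (nat^'d::finite) pmf) \<Rightarrow> ('d \<Rightarrow> 's \<Rightarrow> (nat^'d) pmf) \<Rightarrow>
     ('s, 'd) state \<Rightarrow> ('s, 'd) state measure" where
  "chain_kernel S q p = (\<lambda>(\<omega>, i, x).
     distr (density (count_space ({1..} \<times> Upsilon)) (\<lambda>(j, y). ennreal (block_prob q p \<omega> j y)))
       (state_space S) (\<lambda>(j, y). (env_shift (int j) \<omega>, j, y)))"

text \<open>The initial law \<open>\<Q>\<close> is the law of the state reached by one step of \<open>K\<close> from a state whose
  environment has law \<open>P_tilde\<close> (the dummy components \<open>(1, [0])\<close> are irrelevant); the defining
  formula on product sets is lemma \<open>emeasure_init_law\<close> below.\<close>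

definition init_law ::
  "'s measure \<Rightarrow> ('s \<Rightarrow> (nat^'d::finite) pmf) \<Rightarrow> ('d \<Rightarrow> 's \<Rightarrow> (nat^'d) pmf) \<Rightarrow> (int \<Rightarrow> 's) measure \<Rightarrow>
     ('s, 'd) state measure" where
  "init_law S q p P = P_tilde q p P \<bind> (\<lambda>\<omega>. chain_kernel S q p (\<omega>, 1, [0]))"

section \<open>Markov chains\<close>

text \<open>\<open>\<mu>\<close> is the law on path space of a Markov chain with initial law \<open>Q\<close> and transition kernel
  \<open>K\<close>.  Paths are indexed by \<open>0, 1, 2, \<dots>\<close>, the initial state being \<open>x 0\<close>.\<close>

abbreviation path_space :: "'x measure \<Rightarrow> (nat \<Rightarrow> 'x) measure" where
  "path_space X \<equiv> Pi\<^sub>M UNIV (\<lambda>_. X)"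

definition path_shift :: "(nat \<Rightarrow> 'x) \<Rightarrow> (nat \<Rightarrow> 'x)" where
  "path_shift x = (\<lambda>n. x (Suc n))"

definition history :: "'x measure \<Rightarrow> nat \<Rightarrow> (nat \<Rightarrow> 'x) measure" where
  "history X n =
     vimage_algebra (space (path_space X)) (\<lambda>x. restrict x {..n}) (Pi\<^sub>M {..n} (\<lambda>_. X))"

definition markov_chain_law ::
  "'x measure \<Rightarrow> 'x measure \<Rightarrow> ('x \<Rightarrow> 'x measure) \<Rightarrow> (nat \<Rightarrow> 'x) measure \<Rightarrow> bool" where
  "markov_chain_law X Q K \<mu> \<longleftrightarrow>
     prob_space \<mu> \<and> sets \<mu> = sets (path_space X) \<and>
     distr \<mu> X (\<lambda>x. x 0) = Q \<and>
     (\<forall>n. \<forall>B\<in>sets X. AE x in \<mu>.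
        nn_cond_exp \<mu> (history X n) (\<lambda>x. indicator B (x (Suc n))) x = emeasure (K (x n)) B)"



section \<open>Measurability and consistency of the definitions\<close>

abbreviation vec_seq :: "(nat \<Rightarrow> nat^'d::finite) measure" where
  "vec_seq \<equiv> Pi\<^sub>M UNIV (\<lambda>_. count_space UNIV)"

abbreviation sample_space :: "'d::finite sample measure" where
  "sample_space \<equiv> vec_seq \<Otimes>\<^sub>M Pi\<^sub>M UNIV (\<lambda>_. count_space UNIV)"

lemma measurable_PiM_kernel:
  assumes \<kappa>: "\<And>i. i \<in> I \<Longrightarrow> \<kappa> i \<in> M \<rightarrow>\<^sub>M prob_algebra (N i)"
  shows "(\<lambda>\<omega>. Pi\<^sub>M I (\<lambda>i. \<kappa> i \<omega>)) \<in> M \<rightarrow>\<^sub>M prob_algebra (Pi\<^sub>M I N)"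
proof (rule measurable_prob_algebra_generated[OF sets_PiM Int_stable_prod_algebra prod_algebra_sets_into_space])
  fix \<omega> assume \<omega>: "\<omega> \<in> space M"
  have ps: "prob_space (\<kappa> i \<omega>)" and st: "sets (\<kappa> i \<omega>) = sets (N i)" if "i \<in> I" for i
    using measurable_space[OF \<kappa>[OF that] \<omega>] by (auto simp: space_prob_algebra)
  show "prob_space (Pi\<^sub>M I (\<lambda>i. \<kappa> i \<omega>))"
    by (rule prob_space_PiM) (rule ps)
  show "sets (Pi\<^sub>M I (\<lambda>i. \<kappa> i \<omega>)) = sets (Pi\<^sub>M I N)"
    by (rule sets_PiM_cong) (auto simp: st)
next
  fix A assume "A \<in> prod_algebra I N"
  then obtain J E where J: "A = prod_emb I N J (Pi\<^sub>E J E)" "finite J" "J \<subseteq> I"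
      "\<And>i. i \<in> J \<Longrightarrow> E i \<in> sets (N i)"
    by (rule prod_algebraE) blast
  have "emeasure (Pi\<^sub>M I (\<lambda>i. \<kappa> i \<omega>)) A = (\<Prod>i\<in>J. emeasure (\<kappa> i \<omega>) (E i))" if \<omega>: "\<omega> \<in> space M" for \<omega>
  proof -
    have ps: "prob_space (\<kappa> i \<omega>)" and st: "sets (\<kappa> i \<omega>) = sets (N i)" if "i \<in> I" for i
      using measurable_space[OF \<kappa>[OF that] \<omega>] by (auto simp: space_prob_algebra)
    have sp: "space (\<kappa> i \<omega>) = space (N i)" if "i \<in> I" for i
      using st[OF that] by (rule sets_eq_imp_space_eq)
    define \<kappa>' where "\<kappa>' = (\<lambda>i. if i \<in> I then \<kappa> i \<omega> else count_space {undefined})"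
    interpret product_prob_space \<kappa>' I
      unfolding product_prob_space_def product_prob_space_axioms_def product_sigma_finite_def
      by (auto simp: \<kappa>'_def ps intro!: prob_space_imp_sigma_finite
        prob_spaceI[of "count_space {undefined}"])
    have 1: "Pi\<^sub>M I (\<lambda>i. \<kappa> i \<omega>) = Pi\<^sub>M I \<kappa>'"
      by (rule PiM_cong) (auto simp: \<kappa>'_def)
    have 2: "A = prod_emb I \<kappa>' J (Pi\<^sub>E J E)"
    proof -
      have "Pi\<^sub>E I (\<lambda>i. space (\<kappa>' i)) = Pi\<^sub>E I (\<lambda>i. space (N i))"
        by (rule PiE_cong) (simp add: \<kappa>'_def sp)
      then show ?thesis by (simp add: J(1) prod_emb_def)
    qed
    have "emeasure (Pi\<^sub>M I \<kappa>') A = (\<Prod>i\<in>J. emeasure (\<kappa>' i) (E i))"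
      unfolding 2 using J st by (intro emeasure_PiM_emb) (auto simp: \<kappa>'_def)
    also have "\<dots> = (\<Prod>i\<in>J. emeasure (\<kappa> i \<omega>) (E i))"
      using J by (intro prod.cong) (auto simp: \<kappa>'_def)
    finally show ?thesis by (simp add: 1)
  qed
  moreover have "(\<lambda>\<omega>. \<Prod>i\<in>J. emeasure (\<kappa> i \<omega>) (E i)) \<in> borel_measurable M"
    using J \<kappa> by (intro borel_measurable_prod_ennreal)
      (auto intro!: measurable_emeasure_kernel[OF measurable_prob_algebraD] )
  ultimately show "(\<lambda>\<omega>. emeasure (Pi\<^sub>M I (\<lambda>i. \<kappa> i \<omega>)) A) \<in> borel_measurable M"
    by (simp cong: measurable_cong)
qed

lemma measurable_env_shift: "env_shift k \<in> env_space S \<rightarrow>\<^sub>M env_space S"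
  unfolding env_shift_def by (rule measurable_PiM_single') (auto simp: space_PiM)

lemma measurable_path_shift: "path_shift \<in> path_space X \<rightarrow>\<^sub>M path_space X"
  unfolding path_shift_def by (rule measurable_PiM_single') (auto simp: space_PiM)

lemma sets_quenched: "sets (quenched q p \<omega>) = sets sample_space"
  unfolding quenched_def
  by (intro sets_pair_measure_cong sets_PiM_cong) (auto split: prod.splits)

lemma space_quenched: "space (quenched q p \<omega>) = UNIV"
  using sets_eq_imp_space_eq[OF sets_quenched[of q p \<omega>]] by (simp add: space_pair_measure space_PiM)

lemma prob_space_quenched: "prob_space (quenched q p \<omega>)"
proof -
  interpret A: prob_space "Pi\<^sub>M UNIV (\<lambda>n. measure_pmf (q (\<omega> (int n - 1))))"
    by (rule prob_space_PiM) (rule prob_space_measure_pmf)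
  interpret B: prob_space "Pi\<^sub>M UNIV (\<lambda>(n, m, i). measure_pmf (p i (\<omega> (int n))))"
    by (rule prob_space_PiM) (auto split: prod.splits intro: prob_space_measure_pmf)
  interpret pair_prob_space "Pi\<^sub>M UNIV (\<lambda>n. measure_pmf (q (\<omega> (int n - 1))))"
      "Pi\<^sub>M UNIV (\<lambda>(n, m, i). measure_pmf (p i (\<omega> (int n))))" ..
  show ?thesis unfolding quenched_def by unfold_locales
qed

lemma measurable_immigrants [measurable]:
  "(\<lambda>\<xi>. immigrants \<xi> n) \<in> sample_space \<rightarrow>\<^sub>M count_space UNIV"
  unfolding immigrants_def by measurable

lemma measurable_offspring [measurable]:
  "(\<lambda>\<xi>. offspring \<xi> n m i) \<in> sample_space \<rightarrow>\<^sub>M count_space UNIV"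
  unfolding offspring_def by measurable

lemma measurable_countable_plus:
  fixes f g :: "'a \<Rightarrow> 'b :: {countable, plus}"
  assumes [measurable]: "f \<in> M \<rightarrow>\<^sub>M count_space UNIV" "g \<in> M \<rightarrow>\<^sub>M count_space UNIV"
  shows "(\<lambda>x. f x + g x) \<in> M \<rightarrow>\<^sub>M count_space UNIV"
  by measurable

lemma measurable_countable_sum:
  fixes f :: "'i \<Rightarrow> 'a \<Rightarrow> 'b :: {countable, comm_monoid_add}"
  assumes "\<And>i. i \<in> A \<Longrightarrow> f i \<in> M \<rightarrow>\<^sub>M count_space UNIV"
  shows "(\<lambda>x. \<Sum>i\<in>A. f i x) \<in> M \<rightarrow>\<^sub>M count_space UNIV"
  using assms
  by (induction A rule: infinite_finite_induct) (auto intro: measurable_countable_plus)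

lemma measurable_nth_count [measurable (raw)]:
  fixes f :: "'a \<Rightarrow> nat^'d::finite"
  assumes [measurable]: "f \<in> M \<rightarrow>\<^sub>M count_space UNIV"
  shows "(\<lambda>x. f x $ i) \<in> M \<rightarrow>\<^sub>M count_space UNIV"
  by measurable

lemma measurable_random_sum:
  fixes f :: "nat \<Rightarrow> 'a \<Rightarrow> nat^'d::finite"
  assumes [measurable]: "\<And>m. f m \<in> M \<rightarrow>\<^sub>M count_space UNIV"
    and a[measurable]: "a \<in> M \<rightarrow>\<^sub>M count_space (UNIV :: nat set)"
    and b[measurable]: "b \<in> M \<rightarrow>\<^sub>M count_space (UNIV :: nat set)"
  shows "(\<lambda>x. \<Sum>m\<in>{a x<..b x}. f m x) \<in> M \<rightarrow>\<^sub>M count_space UNIV"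
  by (rule measurable_compose_countable[OF _ a], rule measurable_compose_countable[OF _ b])
    (rule measurable_countable_sum, measurable)

lemma measurable_Z [measurable]: "(\<lambda>\<xi>. Z z0 \<xi> n) \<in> sample_space \<rightarrow>\<^sub>M count_space UNIV"
proof (induction n)
  case (Suc n)
  note Suc[measurable]
  have *: "{1..k} = {0<..k}" for k :: nat by auto
  show ?case
    unfolding Z.simps *
    by (intro measurable_countable_sum measurable_random_sum measurable_countable_plus
        measurable_nth_count Suc measurable_immigrants measurable_offspring) auto
qed simp

lemma measurable_U:
  "(\<lambda>\<xi>. U \<xi> n i) \<in> (sample_space :: 'd::finite sample measure) \<rightarrow>\<^sub>M count_space UNIV"
proof (induction n arbitrary: i)
  case 0
  show ?case by simp
next
  case (Suc n)
  have "(\<lambda>\<xi>. \<Sum>j\<in>UNIV. \<Sum>m\<in>{(\<Sum>k<i. U \<xi> n k $ j)<..(\<Sum>k\<le>i. U \<xi> n k $ j)}. offspring \<xi> n m j)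
      \<in> (sample_space :: 'd sample measure) \<rightarrow>\<^sub>M count_space UNIV"
    by (intro measurable_countable_sum measurable_random_sum measurable_nth_count Suc
        measurable_offspring)
  then show ?case by simp
qed

lemma Z_eq_sum_U: "Z 0 \<xi> n = (\<Sum>i<n. U \<xi> n i)"
proof (induction n)
  case (Suc n)
  have D: "U \<xi> n n = immigrants \<xi> n"
    by (cases n) auto
  have E: "(\<Sum>m = 1..(\<Sum>k<l. U \<xi> n k $ j). offspring \<xi> n m j) =
      (\<Sum>i<l. \<Sum>m\<in>{(\<Sum>k<i. U \<xi> n k $ j)<..(\<Sum>k\<le>i. U \<xi> n k $ j)}. offspring \<xi> n m j)" for l j
  proof (induction l)
    case (Suc l)
    have "{1..(\<Sum>k<Suc l. U \<xi> n k $ j)} =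
        {1..(\<Sum>k<l. U \<xi> n k $ j)} \<union> {(\<Sum>k<l. U \<xi> n k $ j)<..(\<Sum>k\<le>l. U \<xi> n k $ j)}"
      by (auto simp: lessThan_Suc_atMost[symmetric])
    moreover have "(\<Sum>m\<in>{1..a} \<union> {a<..b}. f m) = (\<Sum>m = 1..a. f m) + (\<Sum>m\<in>{a<..b}. f m)"
      for a b and f :: "nat \<Rightarrow> nat^'a"
      by (intro sum.union_disjoint) auto
    ultimately show ?case
      by (simp only: Suc sum.lessThan_Suc[of _ l])
  qed simp
  have "Z 0 \<xi> n $ j + immigrants \<xi> n $ j = (\<Sum>k<Suc n. U \<xi> n k $ j)" for j
    by (simp add: Suc D)
  then have "Z 0 \<xi> (Suc n) = (\<Sum>j\<in>UNIV. \<Sum>m = 1..(\<Sum>k<Suc n. U \<xi> n k $ j). offspring \<xi> n m j)"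
    by simp
  also have "\<dots> = (\<Sum>i<Suc n. U \<xi> (Suc n) i)"
    unfolding E by (subst sum.swap) (auto intro!: sum.cong)
  finally show ?case .
qed simp

lemma measurable_quenched:
  assumes q[measurable]: "(\<lambda>s. measure_pmf (q s)) \<in> S \<rightarrow>\<^sub>M prob_algebra (count_space UNIV)"
    and p[measurable]: "\<And>i. (\<lambda>s. measure_pmf (p i s)) \<in> S \<rightarrow>\<^sub>M prob_algebra (count_space UNIV)"
  shows "quenched q p \<in> env_space S \<rightarrow>\<^sub>M prob_algebra sample_space"
proof -
  have "(\<lambda>\<omega>. Pi\<^sub>M UNIV (\<lambda>n. measure_pmf (q (\<omega> (int n - 1)))) \<Otimes>\<^sub>M
     Pi\<^sub>M UNIV (\<lambda>k. case k of (n, m, i) \<Rightarrow> measure_pmf (p i (\<omega> (int n)))))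
     \<in> env_space S \<rightarrow>\<^sub>M prob_algebra sample_space"
  proof (intro measurable_pair_prob measurable_PiM_kernel)
    show "(\<lambda>\<omega>. measure_pmf (q (\<omega> (int n - 1)))) \<in> env_space S \<rightarrow>\<^sub>M prob_algebra (count_space UNIV)" for n
      by measurable
    fix k :: "nat \<times> nat \<times> 'b"
    show "(\<lambda>\<omega>. case k of (n, m, i) \<Rightarrow> measure_pmf (p i (\<omega> (int n))))
        \<in> env_space S \<rightarrow>\<^sub>M prob_algebra (count_space UNIV)"
      by (cases k) simp
  qed
  then show ?thesis by (simp add: quenched_def[abs_def])
qed

lemma measurable_Z_block: "{\<xi>. Z_block \<xi> j = y} \<in> sets sample_space"
proof -
  have "{\<xi>. Z_block \<xi> j = y} =
      {\<xi> \<in> space sample_space. length y = j \<and> (\<forall>k<j. Z 0 \<xi> (Suc k) = y ! k)}"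
    by (auto simp: Z_block_def list_eq_iff_nth_eq space_pair_measure space_PiM
        simp del: upt_Suc Z.simps)
  also have "\<dots> \<in> sets sample_space"
    by measurable
  finally show ?thesis .
qed

lemma emeasure_Z_block: "emeasure (quenched q p \<omega>) {\<xi>. Z_block \<xi> j = y} = ennreal (block_prob q p \<omega> j y)"
proof -
  interpret prob_space "quenched q p \<omega>" by (rule prob_space_quenched)
  show ?thesis by (simp add: block_prob_def space_quenched emeasure_eq_measure)
qed

lemma Z_block_inj:
  assumes "Z_block \<xi> j \<in> Upsilon" "Z_block \<xi> j' \<in> Upsilon"
  shows "j = j'"
proof -
  have *: False if h: "Z_block \<xi> j \<in> Upsilon" "Z_block \<xi> j' \<in> Upsilon" "j < j'" for j j'
  proof -
    obtain ys where ys: "Z_block \<xi> j = ys @ [0]" using h(1) by (auto simp: Upsilon_def)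
    obtain zs where zs: "Z_block \<xi> j' = zs @ [0]" "0 \<notin> set zs" using h(2) by (auto simp: Upsilon_def)
    have l: "length (Z_block \<xi> k) = k" for k by (simp add: Z_block_def)
    have len: "j = Suc (length ys)" "j' = Suc (length zs)"
      using l[of j] l[of j'] ys zs by auto
    have "Z 0 \<xi> j = Z_block \<xi> j ! length ys"
      using len by (simp add: Z_block_def del: upt_Suc Z.simps)
    then have "Z 0 \<xi> j = 0" by (simp add: ys)
    moreover have "Z 0 \<xi> j = Z_block \<xi> j' ! length ys"
      using len h(3) by (simp add: Z_block_def del: upt_Suc Z.simps)
    then have "Z 0 \<xi> j = zs ! length ys"
      using len h(3) unfolding zs(1) by (simp add: nth_append del: Z.simps)
    ultimately show False
      using len h(3) zs(2) by (metis Suc_less_eq nth_mem)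
  qed
  show ?thesis using *[of j j'] *[of j' j] assms by (meson linorder_neqE_nat)
qed

lemma nn_integral_block_prob_le_1:
  "(\<integral>\<^sup>+(j, y). ennreal (block_prob q p \<omega> j y) \<partial>count_space ({1..} \<times> Upsilon)) \<le> 1"
proof -
  interpret prob_space "quenched q p \<omega>" by (rule prob_space_quenched)
  let ?E = "\<lambda>(j, y). {\<xi>. Z_block \<xi> j = y}"
  have "(\<integral>\<^sup>+(j, y). ennreal (block_prob q p \<omega> j y) \<partial>count_space ({1..} \<times> Upsilon)) =
      (\<integral>\<^sup>+z. emeasure (quenched q p \<omega>) (?E z) \<partial>count_space ({1..} \<times> Upsilon))"
    by (intro nn_integral_cong) (auto simp: emeasure_Z_block)
  also have "\<dots> = emeasure (quenched q p \<omega>) (\<Union>z\<in>{1..} \<times> Upsilon. ?E z)"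
  proof (rule emeasure_UN_countable[symmetric])
    show "disjoint_family_on ?E ({1..} \<times> Upsilon)"
      by (auto simp: disjoint_family_on_def dest: Z_block_inj)
  qed (auto simp: sets_quenched measurable_Z_block)
  also have "\<dots> \<le> 1" by (rule emeasure_le_1)
  finally show ?thesis .
qed

lemma sets_kernel: "sets (chain_kernel S q p z) = sets (state_space S)"
  by (simp add: chain_kernel_def split: prod.split)

lemma space_kernel: "space (chain_kernel S q p z) = space (state_space S)"
  by (simp add: chain_kernel_def split: prod.split)

lemma measurable_kernel_map:
  assumes "\<omega> \<in> space (env_space S)"
  shows "(\<lambda>(j, y). (env_shift (int j) \<omega>, j, y)) \<in> count_space ({1..} \<times> Upsilon) \<rightarrow>\<^sub>M state_space S"
  using assms by (auto simp: state_space_def space_pair_measure space_PiM env_shift_def)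

lemma emeasure_kernel':
  assumes "\<omega> \<in> space (env_space S)" "B \<in> sets (state_space S)"
  shows "emeasure (chain_kernel S q p (\<omega>, i, x)) B =
    (\<integral>\<^sup>+z. ennreal (block_prob q p \<omega> (fst z) (snd z)) * indicator B (env_shift (int (fst z)) \<omega>, z)
       \<partial>count_space ({1..} \<times> Upsilon))"
proof -
  let ?f = "\<lambda>(j, y). ennreal (block_prob q p \<omega> j y)" and ?g = "\<lambda>(j, y). (env_shift (int j) \<omega>, j, y)"
  let ?C = "count_space ({1..} \<times> Upsilon)"
  have g: "?g \<in> density ?C ?f \<rightarrow>\<^sub>M state_space S"
    using measurable_kernel_map[OF assms(1)] by simp
  have "emeasure (chain_kernel S q p (\<omega>, i, x)) B = emeasure (density ?C ?f) (?g -` B \<inter> space ?C)"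
    using emeasure_distr[OF g assms(2)] by (simp add: chain_kernel_def)
  also have "\<dots> = (\<integral>\<^sup>+z. ?f z * indicator (?g -` B \<inter> space ?C) z \<partial>?C)"
    by (rule emeasure_density) auto
  also have "\<dots> = (\<integral>\<^sup>+z. ennreal (block_prob q p \<omega> (fst z) (snd z)) *
      indicator B (env_shift (int (fst z)) \<omega>, z) \<partial>?C)"
    by (intro nn_integral_cong) (auto split: split_indicator)
  finally show ?thesis .
qed

lemma subprob_space_kernel:
  assumes "\<omega> \<in> space (env_space S)"
  shows "subprob_space (chain_kernel S q p (\<omega>, i, x))"
proof (rule subprob_spaceI)
  have "emeasure (chain_kernel S q p (\<omega>, i, x)) (space (state_space S)) \<le>
      (\<integral>\<^sup>+z. ennreal (block_prob q p \<omega> (fst z) (snd z)) \<partial>count_space ({1..} \<times> Upsilon))"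
    by (subst emeasure_kernel') (auto intro!: nn_integral_mono assms split: split_indicator)
  also have "\<dots> \<le> 1"
    using nn_integral_block_prob_le_1[of q p \<omega>] by (simp add: case_prod_unfold)
  finally show "emeasure (chain_kernel S q p (\<omega>, i, x)) (space (chain_kernel S q p (\<omega>, i, x))) \<le> 1"
    by (simp add: space_kernel)
  show "space (chain_kernel S q p (\<omega>, i, x)) \<noteq> {}"
  proof -
    have "(\<omega>, 1, [0]) \<in> space (state_space S)"
      using assms by (auto simp: state_space_def space_pair_measure Upsilon_def)
    then show ?thesis by (auto simp: space_kernel)
  qed
qed

lemma emeasure_kernel:
  assumes \<omega>: "\<omega> \<in> space (env_space S)" and A: "A \<in> sets (env_space S)" and j: "1 \<le> j" and y: "y \<in> Upsilon"
  shows "emeasure (chain_kernel S q p (\<omega>, i, x)) (A \<times> {j} \<times> {y}) =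
    ennreal (block_prob q p \<omega> j y) * indicator A (env_shift (int j) \<omega>)"
proof -
  have B: "A \<times> {j} \<times> {y} \<in> sets (state_space S)"
    unfolding state_space_def using A j y by (intro pair_measureI) auto
  have "emeasure (chain_kernel S q p (\<omega>, i, x)) (A \<times> {j} \<times> {y}) =
    (\<integral>\<^sup>+z. (ennreal (block_prob q p \<omega> j y) * indicator A (env_shift (int j) \<omega>)) * indicator {(j, y)} z
       \<partial>count_space ({1..} \<times> Upsilon))"
    unfolding emeasure_kernel'[OF \<omega> B]
    by (intro nn_integral_cong) (auto split: split_indicator)
  also have "\<dots> = ennreal (block_prob q p \<omega> j y) * indicator A (env_shift (int j) \<omega>)"
    using j y by (simp add: nn_integral_cmult_indicator emeasure_count_space_finite)
  finally show ?thesis .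
qed

lemma measurable_block_prob:
  assumes q: "(\<lambda>s. measure_pmf (q s)) \<in> S \<rightarrow>\<^sub>M prob_algebra (count_space UNIV)"
    and p: "\<And>i. (\<lambda>s. measure_pmf (p i s)) \<in> S \<rightarrow>\<^sub>M prob_algebra (count_space UNIV)"
  shows "(\<lambda>\<omega>. block_prob q p \<omega> j y) \<in> borel_measurable (env_space S)"
  unfolding block_prob_def space_quenched
  using measurable_compose[OF measurable_prob_algebraD[OF measurable_quenched[OF q p]]
      measurable_measure_subprob_algebra[OF measurable_Z_block[of j y]]]
  by simp

lemma measurable_kernel:
  fixes S :: "'s measure" and q :: "'s \<Rightarrow> (nat^'d::finite) pmf"
  assumes q: "(\<lambda>s. measure_pmf (q s)) \<in> S \<rightarrow>\<^sub>M prob_algebra (count_space UNIV)"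
    and p: "\<And>i. (\<lambda>s. measure_pmf (p i s)) \<in> S \<rightarrow>\<^sub>M prob_algebra (count_space UNIV)"
  shows "chain_kernel S q p \<in> state_space S \<rightarrow>\<^sub>M subprob_algebra (state_space S)"
proof (rule measurable_subprob_algebra)
  fix z :: "('s, 'd) state" assume "z \<in> space (state_space S)"
  then show "subprob_space (chain_kernel S q p z)"
    by (cases z) (auto simp: state_space_def space_pair_measure intro!: subprob_space_kernel)
next
  fix B :: "('s, 'd) state set" assume B[measurable]: "B \<in> sets (state_space S)"
  note measurable_block_prob[OF q p, measurable]
  have "emeasure (chain_kernel S q p z) B =
    (\<integral>\<^sup>+w. ennreal (block_prob q p (fst z) (fst w) (snd w)) * indicator B (env_shift (int (fst w)) (fst z), w)
       \<partial>count_space ({1..} \<times> Upsilon))" if "z \<in> space (state_space S)" for z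
    using that B by (cases z) (auto simp: state_space_def space_pair_measure emeasure_kernel')
  moreover have "(\<lambda>z. \<integral>\<^sup>+w. ennreal (block_prob q p (fst z) (fst w) (snd w)) *
        indicator B (env_shift (int (fst w)) (fst z), w) \<partial>count_space ({1..} \<times> Upsilon))
      \<in> borel_measurable (state_space S)" (is "(\<lambda>z. \<integral>\<^sup>+w. ?F z w \<partial>?C) \<in> _")
  proof -
    have F: "(\<lambda>z. ?F z w) \<in> borel_measurable (state_space S)" if w: "w \<in> {1..} \<times> Upsilon" for w
    proof -
      have w': "w \<in> space (count_space {1..} \<Otimes>\<^sub>M count_space Upsilon)"
        using w by (auto simp: space_pair_measure)
      have f[measurable]: "fst \<in> state_space S \<rightarrow>\<^sub>M env_space S"
        by (simp add: state_space_def)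
      have "(\<lambda>z. (env_shift (int (fst w)) (fst z), w)) \<in> state_space S \<rightarrow>\<^sub>M
          env_space S \<Otimes>\<^sub>M count_space {1..} \<Otimes>\<^sub>M count_space Upsilon"
        by (intro measurable_Pair measurable_const w' measurable_compose[OF f measurable_env_shift])
      then have [measurable]:
          "(\<lambda>z. (env_shift (int (fst w)) (fst z), w)) \<in> state_space S \<rightarrow>\<^sub>M state_space S"
        by (simp add: state_space_def)
      show ?thesis by measurable
    qed
    have "(\<lambda>(z, w). ?F z w) \<in> borel_measurable (state_space S \<Otimes>\<^sub>M ?C)"
      unfolding case_prod_beta
      by (rule measurable_compose_countable'[where f = "\<lambda>w x. ?F (fst x) w" and g = snd,
            OF measurable_compose[OF measurable_fst F] measurable_snd]) auto
    then show ?thesis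
      by (intro sigma_finite_measure.borel_measurable_nn_integral
          sigma_finite_measure_count_space_countable) auto
  qed
  ultimately show "(\<lambda>z. emeasure (chain_kernel S q p z) B) \<in> borel_measurable (state_space S)"
    by (simp cong: measurable_cong)
qed (simp add: sets_kernel)

lemma emeasure_init_law:
  assumes P: "prob_space P" "sets P = sets (env_space S)"
    and q: "(\<lambda>s. measure_pmf (q s)) \<in> S \<rightarrow>\<^sub>M prob_algebra (count_space UNIV)"
    and p: "\<And>i. (\<lambda>s. measure_pmf (p i s)) \<in> S \<rightarrow>\<^sub>M prob_algebra (count_space UNIV)"
    and A: "A \<in> sets (env_space S)" and i: "1 \<le> i" and x: "x \<in> Upsilon"
  shows "emeasure (init_law S q p P) (A \<times> {i} \<times> {x}) =
    (\<integral>\<^sup>+\<omega>. ennreal (block_prob q p \<omega> i x) * indicator A (env_shift (int i) \<omega>) \<partial>P_tilde q p P)"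
proof -
  have st: "sets (P_tilde q p P) = sets (env_space S)"
    by (simp add: P_tilde_def P(2))
  have sp: "space (P_tilde q p P) = space (env_space S)"
    by (rule sets_eq_imp_space_eq[OF st])
  have "space P \<noteq> {}" using P(1) by (rule prob_space.not_empty)
  then have ne: "space (P_tilde q p P) \<noteq> {}"
    by (simp add: P_tilde_def)
  have "(1 :: nat, [0]) \<in> space (count_space {1..} \<Otimes>\<^sub>M count_space Upsilon)"
    by (auto simp: space_pair_measure Upsilon_def)
  then have "(\<lambda>\<omega>. (\<omega>, 1, [0])) \<in> env_space S \<rightarrow>\<^sub>M state_space S"
    unfolding state_space_def by (intro measurable_Pair measurable_const) auto
  from measurable_compose[OF this measurable_kernel[OF q p]]
  have k: "(\<lambda>\<omega>. chain_kernel S q p (\<omega>, 1, [0])) \<in> P_tilde q p P \<rightarrow>\<^sub>M subprob_algebra (state_space S)"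
    by (simp cong: measurable_cong_sets add: st)
  have B: "A \<times> {i} \<times> {x} \<in> sets (state_space S)"
    unfolding state_space_def using A i x by (intro pair_measureI) auto
  show ?thesis
    unfolding init_law_def emeasure_bind[OF ne k B]
    by (intro nn_integral_cong emeasure_kernel A i x) (simp add: sp)
qed

lemma measurable_family_law:
  assumes q: "(\<lambda>s. measure_pmf (q s)) \<in> S \<rightarrow>\<^sub>M prob_algebra (count_space UNIV)"
    and p: "\<And>i. (\<lambda>s. measure_pmf (p i s)) \<in> S \<rightarrow>\<^sub>M prob_algebra (count_space UNIV)"
  shows "family_law q p \<in> env_space S \<rightarrow>\<^sub>M prob_algebra vec_seq"
proof -
  have "(\<lambda>\<xi> n. U \<xi> n 0) \<in> sample_space \<rightarrow>\<^sub>M vec_seq"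
    by (rule measurable_PiM_single') (auto intro: measurable_U)
  from measurable_compose[OF measurable_quenched[OF q p] measurable_distr_prob_space[OF this]]
  show ?thesis by (simp add: family_law_def[abs_def])
qed

lemma measurable_quenched_ext:
  assumes q: "(\<lambda>s. measure_pmf (q s)) \<in> S \<rightarrow>\<^sub>M prob_algebra (count_space UNIV)"
    and p: "\<And>i. (\<lambda>s. measure_pmf (p i s)) \<in> S \<rightarrow>\<^sub>M prob_algebra (count_space UNIV)"
  shows "quenched_ext q p \<in> env_space S \<rightarrow>\<^sub>M prob_algebra (sample_space \<Otimes>\<^sub>M Pi\<^sub>M {..<0} (\<lambda>_. vec_seq))"
  unfolding quenched_ext_def[abs_def]
  by (intro measurable_pair_prob measurable_PiM_kernel measurable_quenched q p
      measurable_compose[OF measurable_env_shift measurable_family_law[OF q p]])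

lemma infsum_enat_eq_iff:
  fixes f :: "'i \<Rightarrow> enat"
  shows "infsum f A = a \<longleftrightarrow> (\<forall>F\<in>{F. finite F \<and> F \<subseteq> A}. sum f F \<le> a) \<and>
    (\<forall>b\<in>{..<a}. \<exists>F\<in>{F. finite F \<and> F \<subseteq> A}. b < sum f F)"
proof -
  have *: "infsum f A = (SUP F\<in>{F. finite F \<and> F \<subseteq> A}. sum f F)"
    by (rule nonneg_infsum_complete) simp
  have "infsum f A = a \<longleftrightarrow> infsum f A \<le> a \<and> (\<forall>b\<in>{..<a}. b < infsum f A)"
    by (metis antisym_conv1 lessThan_iff less_irrefl order_refl)
  then show ?thesis
    by (simp only: * SUP_le_iff less_SUP_iff)
qed

lemma measurable_Z_tilde_0:
  "{\<zeta> \<in> space (sample_space \<Otimes>\<^sub>M Pi\<^sub>M {..<0} (\<lambda>_. vec_seq)). Z_tilde \<zeta> 0 = (\<chi> j. enat (v $ j))}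
    \<in> sets (sample_space \<Otimes>\<^sub>M Pi\<^sub>M {..<0} (\<lambda>_. vec_seq))" (is "_ \<in> sets ?M")
proof -
  let ?FF = "{F. finite F \<and> F \<subseteq> {..<0::int}}"
  have cFF: "countable ?FF"
    by (rule countable_Collect_finite_subset) simp
  have m: "(\<lambda>\<zeta>. \<Sum>i\<in>F. enat (U_ext \<zeta> i 0 $ j)) \<in> ?M \<rightarrow>\<^sub>M count_space UNIV" if F: "F \<in> ?FF" for F j
  proof (rule measurable_countable_sum)
    fix i assume "i \<in> F"
    with F have i: "i \<in> {..<0}" by auto
    have "(\<lambda>\<zeta>. snd \<zeta> i (nat (- i))) \<in> ?M \<rightarrow>\<^sub>M count_space UNIV"
      using i by (intro measurable_compose[OF measurable_snd]
        measurable_compose[OF measurable_component_singleton[OF i]]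
        measurable_component_singleton) auto
    from measurable_compose[OF this, of "\<lambda>u. enat (u $ j)"]
    show "(\<lambda>\<zeta>. enat (U_ext \<zeta> i 0 $ j)) \<in> ?M \<rightarrow>\<^sub>M count_space UNIV"
      using i by (simp add: U_ext_def)
  qed
  have s: "{\<zeta> \<in> space ?M. P (\<Sum>i\<in>F. enat (U_ext \<zeta> i 0 $ j))} \<in> sets ?M" if "F \<in> ?FF" for F j P
  proof -
    have [measurable]: "(\<lambda>\<zeta>. \<Sum>i\<in>F. enat (U_ext \<zeta> i 0 $ j)) \<in> ?M \<rightarrow>\<^sub>M count_space UNIV"
      by (rule m[OF that])
    show ?thesis by measurable
  qed
  have 1: "{\<zeta> \<in> space ?M. \<forall>F\<in>?FF. (\<Sum>i\<in>F. enat (U_ext \<zeta> i 0 $ j)) \<le> a} \<in> sets ?M" for j a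
    by (rule sets.sets_Collect_countable_All'[OF s cFF])
  have 2: "{\<zeta> \<in> space ?M. \<exists>F\<in>?FF. b < (\<Sum>i\<in>F. enat (U_ext \<zeta> i 0 $ j))} \<in> sets ?M" for j b
    by (rule sets.sets_Collect_countable_Ex'[OF s cFF])
  have "{\<zeta> \<in> space ?M. \<forall>j. (\<forall>F\<in>?FF. (\<Sum>i\<in>F. enat (U_ext \<zeta> i 0 $ j)) \<le> enat (v $ j)) \<and>
      (\<forall>b\<in>{..<enat (v $ j)}. \<exists>F\<in>?FF. b < (\<Sum>i\<in>F. enat (U_ext \<zeta> i 0 $ j)))} \<in> sets ?M"
    by (intro sets.sets_Collect_countable_All sets.sets_Collect_conj
        sets.sets_Collect_countable_Ball 1 2)
  then show ?thesis
    by (simp add: Z_tilde_def vec_eq_iff infsum_enat_eq_iff)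
qed

lemma sets_quenched_ext:
  "sets (quenched_ext q p \<omega>) = sets (sample_space \<Otimes>\<^sub>M Pi\<^sub>M {..<0} (\<lambda>_. vec_seq))"
  unfolding quenched_ext_def
  by (intro sets_pair_measure_cong sets_PiM_cong sets_quenched) (auto simp: family_law_def)

lemma measurable_pi_quenched:
  assumes q: "(\<lambda>s. measure_pmf (q s)) \<in> S \<rightarrow>\<^sub>M prob_algebra (count_space UNIV)"
    and p: "\<And>i. (\<lambda>s. measure_pmf (p i s)) \<in> S \<rightarrow>\<^sub>M prob_algebra (count_space UNIV)"
  shows "(\<lambda>\<omega>. pi_quenched q p \<omega> v) \<in> borel_measurable (env_space S)"
  unfolding pi_quenched_def sets_eq_imp_space_eq[OF sets_quenched_ext]
  using measurable_compose[OF measurable_prob_algebraD[OF measurable_quenched_ext[OF q p]]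
      measurable_measure_subprob_algebra[OF measurable_Z_tilde_0[of v]]]
  by simp

end

(*
  Started at Z_0 = 0, the process regenerates at its zeros. Let g(w) = pi_w(0). The quenched law is a
  splice of the law up to time j and the law in the environment shifted by j; hence decompositions of
  P_w(Z_n = 0) according to the first and to the last earlier zero, and g(theta^n w) <= P_w(Z_n = 0).

  The last-zero decomposition gives g(w) >= sum_j g(theta^-j w) P_{theta^-j w}(nu_1 = j). Poincare
  recurrence shows that nu_1 is finite where g > 0, so both sides have the same integral and are equal
  almost surely. This says that P_tilde is invariant under w -> theta^nu_1 w, which is stationarity of
  the chain.

  For an invariant event A of path space, the density of P(A, w) with respect to P_tilde is harmonic
  for the environment kernel, so each of its level sets B is preserved by the jump from one zero to the
  next. If g(w) > 0 and g(theta^n w) > 0, then P_w(Z_n = 0) > 0, so that w and theta^n w are joined by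
  zeros and lie both in B or both outside B; ergodicity of P makes P_tilde(B) trivial. Hence the density
  is constant, A is independent of every cylinder set, and P(A) is 0 or 1.

  Positivity of pi(0) uses g(w) = prod_{k >= 1} a_k(theta^-k w), where a_k is the probability that the
  family of the first immigrants is extinct after k generations, together with
  1 - a_k <= |M_{k-1} ... M_0| |I_0|. The maximal ergodic lemma for theta^-m yields an event of positive
  probability on which the matrix norms decay geometrically.
*)
theory Submission
  imports Defs
begin

section \<open>Markov chains driven by an environment\<close>

text \<open>The kernel sees a state only through its environment, so the environment of a state
  separates past from future. An invariant event belongs to the far future; its relation to past
  events is therefore expressed by densities on environments alone, and stationarity and ergodicity
  of the path become statements about the chain of environments. Among the level sets of the density
  only the one at its mean \<alpha> is examined: a function of mean \<alpha> that stays on one side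
  of \<alpha> is constant.

  A1 to A3 and the extinction condition enter through a single fact, \<pi>(0) > 0. An event of
  positive probability suffices for it, so a one-sided maximal inequality can take the place of a
  limit theorem for matrix products. That inequality holds for every measure preserving map, which
  matters because a power of an ergodic shift may fail to be ergodic. The expected logarithm of the
  norm may be -infinity, and the product itself may vanish; this is why a truncated logarithm
  appears.\<close>

lemma sets_history: "sets (history X n) =
    {(\<lambda>x. restrict x {..n}) -` A \<inter> space (path_space X) | A. A \<in> sets (Pi\<^sub>M {..n} (\<lambda>_. X))}"
  unfolding history_def
  by (rule sets_vimage_algebra2) (auto simp: space_PiM split: if_splits)

lemma space_history[simp]: "space (history X n) = space (path_space X)"
  by (simp add: history_def)

lemma measurable_history_component:
  assumes "i \<le> n" shows "(\<lambda>x. x i) \<in> history X n \<rightarrow>\<^sub>M X"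
proof -
  have "(\<lambda>x. restrict x {..n}) \<in> history X n \<rightarrow>\<^sub>M Pi\<^sub>M {..n} (\<lambda>_. X)"
    unfolding history_def by (rule measurable_vimage_algebra1) (auto simp: space_PiM split: if_splits)
  from measurable_compose[OF this measurable_component_singleton[of i]] assms
  show ?thesis by simp
qed

lemma sets_history_le: 
  assumes "m \<le> n" shows "sets (history X m) \<subseteq> sets (history X n)"
proof -
  have "(\<lambda>x. restrict x {..m}) \<in> history X n \<rightarrow>\<^sub>M Pi\<^sub>M {..m} (\<lambda>_. X)"
    using assms by (intro measurable_restrict measurable_history_component) auto
  then show ?thesis
    unfolding history_def[of X m]
    by (intro sets_image_in_sets) auto
qed

lemma subalgebra_history: "subalgebra (path_space X) (history X n)"
proof -
  have "(\<lambda>x. restrict x {..n}) \<in> path_space X \<rightarrow>\<^sub>M Pi\<^sub>M {..n} (\<lambda>_. X)"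
    by (rule measurable_restrict_subset) auto
  then show ?thesis
    unfolding subalgebra_def by (auto simp: sets_history measurable_sets)
qed

lemma sigma_finite_subalgebra_history:
  assumes "prob_space \<mu>" and st: "sets \<mu> = sets (path_space X)"
  shows "sigma_finite_subalgebra \<mu> (history X n)"
proof (rule finite_measure_subalgebra_is_sigma_finite)
  have "subalgebra \<mu> (history X n)"
    using subalgebra_history[of X n] sets_eq_imp_space_eq[OF st] by (simp add: subalgebra_def st)
  then show "finite_measure_subalgebra \<mu> (history X n)"
    using assms(1) by (simp add: finite_measure_subalgebra_def finite_measure_subalgebra_axioms_def prob_space.finite_measure)
qed

text \<open>The Markov property integrated against a weight that depends on the past. It lets later
  arguments work with integrals instead of conditional expectations.\<close>

lemma markov_chain_law_step:
  assumes law: "markov_chain_law X Q K \<mu>" and B[measurable]: "B \<in> sets X" and f: "f \<in> borel_measurable (history X n)"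
  shows "(\<integral>\<^sup>+x. f x * indicator B (x (Suc n)) \<partial>\<mu>) = (\<integral>\<^sup>+x. f x * emeasure (K (x n)) B \<partial>\<mu>)"
proof -
  have pr: "prob_space \<mu>" and st[measurable_cong]: "sets \<mu> = sets (path_space X)"
    and ae: "AE x in \<mu>. nn_cond_exp \<mu> (history X n) (\<lambda>x. indicator B (x (Suc n))) x = emeasure (K (x n)) B"
    using law B by (auto simp: markov_chain_law_def)
  interpret sigma_finite_subalgebra \<mu> "history X n"
    by (rule sigma_finite_subalgebra_history[OF pr st])
  have "(\<integral>\<^sup>+x. f x * indicator B (x (Suc n)) \<partial>\<mu>) =
      (\<integral>\<^sup>+x. f x * nn_cond_exp \<mu> (history X n) (\<lambda>x. indicator B (x (Suc n))) x \<partial>\<mu>)"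
    by (rule nn_cond_exp_intg[symmetric, OF f]) measurable
  then show ?thesis using nn_integral_cong_AE[of _ _ \<mu>] ae by (auto intro!: nn_integral_cong_AE)
qed

text \<open>The integral identity over past events characterizes the conditional expectation, since
  \<open>emeasure (K (x n)) B\<close> is itself measurable with respect to the past.\<close>

lemma markov_chain_lawI:
  assumes K: "K \<in> X \<rightarrow>\<^sub>M subprob_algebra X"
    and pr: "prob_space \<mu>" and st[measurable_cong]: "sets \<mu> = sets (path_space X)"
    and Q: "distr \<mu> X (\<lambda>x. x 0) = Q"
    and step: "\<And>n B C. B \<in> sets X \<Longrightarrow> C \<in> sets (history X n) \<Longrightarrow>
      (\<integral>\<^sup>+x. indicator C x * indicator B (x (Suc n)) \<partial>\<mu>) = (\<integral>\<^sup>+x. indicator C x * emeasure (K (x n)) B \<partial>\<mu>)"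
  shows "markov_chain_law X Q K \<mu>"
  unfolding markov_chain_law_def
proof (intro conjI allI ballI pr st Q)
  fix n B assume B[measurable]: "B \<in> sets X"
  interpret sigma_finite_subalgebra \<mu> "history X n"
    by (rule sigma_finite_subalgebra_history[OF pr st])
  have "(\<lambda>x. emeasure (K (x n)) B) \<in> borel_measurable (history X n)"
    by (intro measurable_emeasure_kernel[OF measurable_compose[OF measurable_history_component K]]) auto
  then have "AE x in \<mu>. emeasure (K (x n)) B = nn_cond_exp \<mu> (history X n) (\<lambda>x. indicator B (x (Suc n))) x"
    using step[OF B] by (intro nn_cond_exp_charact) (auto simp: mult.commute)
  then show "AE x in \<mu>. nn_cond_exp \<mu> (history X n) (\<lambda>x. indicator B (x (Suc n))) x = emeasure (K (x n)) B"
    by auto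
qed

section \<open>Cylinder sets of path space\<close>

abbreviation cylinder :: "'x measure \<Rightarrow> nat \<Rightarrow> 'x set list \<Rightarrow> (nat \<Rightarrow> 'x) set" where
  "cylinder X n Bs \<equiv> {x \<in> space (path_space X). \<forall>i<length Bs. x (n + i) \<in> Bs ! i}"

lemma sets_cylinder:
  assumes "set Bs \<subseteq> sets X" shows "cylinder X n Bs \<in> sets (path_space X)"
proof -
  have [measurable]: "i < length Bs \<Longrightarrow> Bs ! i \<in> sets X" for i using assms by auto
  show ?thesis by measurable
qed

lemma path_measure_eqI:
  assumes st: "sets M = sets (path_space X)" "sets N = sets (path_space X)" and fin: "finite_measure M"
    and eq: "\<And>Bs. set Bs \<subseteq> sets X \<Longrightarrow>
emeasure M (cylinder X 0 Bs) = emeasure N (cylinder X 0 Bs)"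
  shows "M = N"
proof (rule measure_eqI_PiM_infinite[OF st _ fin])
  fix A and J :: "nat set" assume J: "finite J" and A: "\<And>i. i \<in> J \<Longrightarrow> A i \<in> sets X"
  \<comment> \<open>Times outside \<open>J\<close> are padded with the whole space, which turns a
    finite product set into a run of consecutive constraints from time 0; \<open>insert 0\<close>
    keeps \<open>Max\<close> meaningful for empty \<open>J\<close>.\<close>
  define Bs where "Bs = map (\<lambda>i. if i \<in> J then A i else space X) [0..<Suc (Max (insert 0 J))]"
  have le: "i < Suc (Max (insert 0 J))" if "i \<in> J" for i
    using J that by (simp add: less_Suc_eq_le)
  have "prod_emb UNIV (\<lambda>_. X) J (Pi\<^sub>E J A) = cylinder X 0 Bs"
    using le by (auto simp: prod_emb_def Bs_def space_PiM PiE_iff simp del: upt_Suc)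
  moreover have "set Bs \<subseteq> sets X"
    using A by (auto simp: Bs_def)
  ultimately show "emeasure M (prod_emb UNIV (\<lambda>_. X) J (Pi\<^sub>E J A)) = emeasure N (prod_emb UNIV (\<lambda>_. X) J (Pi\<^sub>E J A))"
    using eq by simp
qed

text \<open>The next state is drawn from \<open>\<kappa> (e x)\<close>, so the environments
  \<open>e (x n)\<close> form a Markov chain of their own, and \<open>invariant\<close> says that
  \<nu> is stationary for it. The kernel has mass 1 only almost everywhere, because in exceptional
  environments the return to zero may fail.\<close>

locale env_chain = nu: prob_space \<nu>
  for \<nu> :: "'e measure" +
  fixes X :: "'x measure" and \<kappa> :: "'e \<Rightarrow> 'x measure" and e :: "'x \<Rightarrow> 'e"
  assumes \<kappa>: "\<kappa> \<in> \<nu> \<rightarrow>\<^sub>M subprob_algebra X"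
    and e[measurable]: "e \<in> X \<rightarrow>\<^sub>M \<nu>"
    and total: "AE w in \<nu>. emeasure (\<kappa> w) (space X) = 1"
    and invariant: "B \<in> sets \<nu> \<Longrightarrow> (\<integral>\<^sup>+w. emeasure (\<kappa> w) (e -` B \<inter> space X) \<partial>\<nu>) = emeasure \<nu> B"
begin

abbreviation Q where "Q \<equiv> \<nu> \<bind> \<kappa>"

abbreviation is_law where "is_law \<equiv> markov_chain_law X Q (\<lambda>x. \<kappa> (e x))"

lemma \<kappa>e: "(\<lambda>x. \<kappa> (e x)) \<in> X \<rightarrow>\<^sub>M subprob_algebra X"
  by (rule measurable_compose[OF e \<kappa>])

lemma sets_\<kappa>: "w \<in> space \<nu> \<Longrightarrow> sets (\<kappa> w) = sets X"
  using subprob_measurableD(2)[OF \<kappa>] by simp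

lemma space_\<kappa>: "w \<in> space \<nu> \<Longrightarrow> space (\<kappa> w) = space X"
  using subprob_measurableD(1)[OF \<kappa>] by simp

lemma sets_Q[measurable_cong]: "sets Q = sets X"
  by (rule sets_bind[OF sets_\<kappa>]) (auto simp: nu.not_empty)

lemma nn_integral_\<kappa>_measurable[measurable]:
  "f \<in> borel_measurable X \<Longrightarrow> (\<lambda>w. \<integral>\<^sup>+y. f y \<partial>\<kappa> w) \<in> borel_measurable \<nu>"
  by (rule measurable_compose[OF \<kappa> nn_integral_measurable_subprob_algebra])

lemma nn_integral_Q: "f \<in> borel_measurable X \<Longrightarrow> (\<integral>\<^sup>+x. f x \<partial>Q) = (\<integral>\<^sup>+w. \<integral>\<^sup>+y. f y \<partial>\<kappa> w \<partial>\<nu>)"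
  by (rule nn_integral_bind[OF _ \<kappa>]) auto

lemma distr_Q: "distr Q \<nu> e = \<nu>"
proof (rule measure_eqI)
  fix B assume "B \<in> sets (distr Q \<nu> e)"
  then have B[measurable]: "B \<in> sets \<nu>" by simp
  have "space Q = space X" by (rule sets_eq_imp_space_eq[OF sets_Q])
  then have "emeasure (distr Q \<nu> e) B = emeasure Q (e -` B \<inter> space X)"
    by (subst emeasure_distr) auto
  also have "\<dots> = emeasure \<nu> B"
    by (subst emeasure_bind[OF _ \<kappa>]) (auto simp: nu.not_empty invariant)
  finally show "emeasure (distr Q \<nu> e) B = emeasure \<nu> B" .
qed simp

lemma nn_integral_Q_e: "f \<in> borel_measurable \<nu> \<Longrightarrow> (\<integral>\<^sup>+x. f (e x) \<partial>Q) = (\<integral>\<^sup>+w. f w \<partial>\<nu>)"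
  by (subst (2) distr_Q[symmetric], subst nn_integral_distr) auto

lemma nn_integral_\<kappa>_e: "f \<in> borel_measurable \<nu> \<Longrightarrow> (\<integral>\<^sup>+w. \<integral>\<^sup>+y. f (e y) \<partial>\<kappa> w \<partial>\<nu>) = (\<integral>\<^sup>+w. f w \<partial>\<nu>)"
  by (subst nn_integral_Q_e[symmetric], simp) (rule nn_integral_Q[symmetric], simp)

text \<open>The probability, given the current environment \<open>w\<close>, that the successive
  next states lie in the members of the list.\<close>

primrec cyl :: "'x set list \<Rightarrow> 'e \<Rightarrow> ennreal" where
  "cyl [] w = 1"
| "cyl (B # Bs) w = (\<integral>\<^sup>+y. indicator B y * cyl Bs (e y) \<partial>\<kappa> w)"

lemma cyl_measurable[measurable]: "set Bs \<subseteq> sets X \<Longrightarrow> cyl Bs \<in> borel_measurable \<nu>"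
proof (induction Bs)
  case (Cons B Bs)
  then have [measurable]: "B \<in> sets X" "cyl Bs \<in> borel_measurable \<nu>" by auto
  have "(\<lambda>w. \<integral>\<^sup>+y. indicator B y * cyl Bs (e y) \<partial>\<kappa> w) \<in> borel_measurable \<nu>" by measurable
  then show ?case by simp
qed (simp add: fun_eq_iff cong: measurable_cong)

end

section \<open>Cylinder probabilities and stationarity\<close>

locale env_chain_law = env_chain \<nu> X \<kappa> e + mu: prob_space \<mu>
  for \<nu> :: "'e measure" and X :: "'x measure" and \<kappa> e and \<mu> :: "(nat \<Rightarrow> 'x) measure" +
  assumes law: "markov_chain_law X Q (\<lambda>x. \<kappa> (e x)) \<mu>"
begin

lemma sets_mu[measurable_cong]: "sets \<mu> = sets (path_space X)"
  using law by (simp add: markov_chain_law_def)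

lemma space_mu: "space \<mu> = space (path_space X)"
  by (rule sets_eq_imp_space_eq[OF sets_mu])

lemma history_sets: "C \<in> sets (history X n) \<Longrightarrow> C \<in> sets (path_space X)"
  using subalgebra_history[of X n] by (auto simp: subalgebra_def)

lemma history_measurable: "f \<in> borel_measurable (history X n) \<Longrightarrow> f \<in> borel_measurable (path_space X)"
  using measurable_from_subalg[OF subalgebra_history] .

lemma distr_mu_0: "distr \<mu> X (\<lambda>x. x 0) = Q"
  using law by (simp add: markov_chain_law_def)

text \<open>Let \<open>N\<close> be the image under \<open>e (x n)\<close> of \<mu> weighted by
  \<open>f\<close>. The identity for sets says that under this weight \<open>x (Suc n)\<close> has
  law \<open>N \<bind> \<kappa>\<close>; integrating \<open>g\<close> against both descriptions
  gives the claim for functions.\<close>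

lemma step:
  assumes g[measurable]: "g \<in> borel_measurable X" and f: "f \<in> borel_measurable (history X n)"
  shows "(\<integral>\<^sup>+x. f x * g (x (Suc n)) \<partial>\<mu>) = (\<integral>\<^sup>+x. f x * (\<integral>\<^sup>+y. g y \<partial>\<kappa> (e (x n))) \<partial>\<mu>)"
proof -
  have f'[measurable]: "f \<in> borel_measurable \<mu>" using history_measurable[OF f] by simp
  define N where "N = distr (density \<mu> f) \<nu> (\<lambda>x. e (x n))"
  have N: "(\<integral>\<^sup>+w. h w \<partial>N) = (\<integral>\<^sup>+x. f x * h (e (x n)) \<partial>\<mu>)" if [measurable]: "h \<in> borel_measurable \<nu>" for h
    unfolding N_def by (subst nn_integral_distr, simp_all, subst nn_integral_density) auto
  have N'[measurable_cong]: "sets N = sets \<nu>" by (simp add: N_def)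
  have \<kappa>N: "\<kappa> \<in> N \<rightarrow>\<^sub>M subprob_algebra X" using \<kappa> by (simp cong: measurable_cong_sets add: N')
  have ne: "space N \<noteq> {}" using nu.not_empty by (simp add: N_def)
  have "distr (density \<mu> f) X (\<lambda>x. x (Suc n)) = N \<bind> \<kappa>"
  proof (rule measure_eqI)
    fix B assume "B \<in> sets (distr (density \<mu> f) X (\<lambda>x. x (Suc n)))"
    then have B[measurable]: "B \<in> sets X" by simp
    have "emeasure (distr (density \<mu> f) X (\<lambda>x. x (Suc n))) B = (\<integral>\<^sup>+y. indicator B y \<partial>distr (density \<mu> f) X (\<lambda>x. x (Suc n)))"
      by simp
    also have "\<dots> = (\<integral>\<^sup>+x. f x * indicator B (x (Suc n)) \<partial>\<mu>)"
      by (subst nn_integral_distr, simp_all, subst nn_integral_density) auto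
    also have "\<dots> = (\<integral>\<^sup>+x. f x * emeasure (\<kappa> (e (x n))) B \<partial>\<mu>)" by (rule markov_chain_law_step[OF law B f])
    also have "\<dots> = (\<integral>\<^sup>+w. emeasure (\<kappa> w) B \<partial>N)" by (rule N[symmetric, OF measurable_emeasure_kernel[OF \<kappa> B]])
    also have "\<dots> = emeasure (N \<bind> \<kappa>) B" by (rule emeasure_bind[symmetric, OF ne \<kappa>N B])
    finally show "emeasure (distr (density \<mu> f) X (\<lambda>x. x (Suc n))) B = emeasure (N \<bind> \<kappa>) B" .
  qed (use sets_bind[OF subprob_measurableD(2)[OF \<kappa>N] ne] in simp)
  then have "(\<integral>\<^sup>+y. g y \<partial>distr (density \<mu> f) X (\<lambda>x. x (Suc n))) = (\<integral>\<^sup>+w. \<integral>\<^sup>+y. g y \<partial>\<kappa> w \<partial>N)"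
    by (simp add: nn_integral_bind[OF g \<kappa>N])
  also have "\<dots> = (\<integral>\<^sup>+x. f x * (\<integral>\<^sup>+y. g y \<partial>\<kappa> (e (x n))) \<partial>\<mu>)" by (rule N) measurable
  also have "(\<integral>\<^sup>+y. g y \<partial>distr (density \<mu> f) X (\<lambda>x. x (Suc n))) = (\<integral>\<^sup>+x. f x * g (x (Suc n)) \<partial>\<mu>)"
    by (subst nn_integral_distr, simp_all, subst nn_integral_density) auto
  finally show ?thesis .
qed

text \<open>One step of the kernel from \<nu> produces \<open>Q\<close>, and \<open>e\<close> maps
  \<open>Q\<close> back to \<nu>, so the one-dimensional marginals never change.\<close>

lemma distr_mu: "distr \<mu> X (\<lambda>x. x n) = Q"
proof (induction n)
  case (Suc n)
  show ?case
  proof (rule measure_eqI)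
    fix B assume "B \<in> sets (distr \<mu> X (\<lambda>x. x (Suc n)))"
    then have B[measurable]: "B \<in> sets X" by simp
    have "emeasure (distr \<mu> X (\<lambda>x. x (Suc n))) B = (\<integral>\<^sup>+x. indicator B x \<partial>distr \<mu> X (\<lambda>x. x (Suc n)))"
      by simp
    also have "\<dots> = (\<integral>\<^sup>+x. 1 * indicator B (x (Suc n)) \<partial>\<mu>)"
      by (subst nn_integral_distr) auto
    also have "\<dots> = (\<integral>\<^sup>+x. 1 * emeasure (\<kappa> (e (x n))) B \<partial>\<mu>)"
      by (rule markov_chain_law_step[OF law B]) simp
    also have "\<dots> = (\<integral>\<^sup>+x. emeasure (\<kappa> (e x)) B \<partial>distr \<mu> X (\<lambda>x. x n))"
      by (subst nn_integral_distr) (auto intro!: measurable_emeasure_kernel[OF \<kappa>e])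
    also have "\<dots> = (\<integral>\<^sup>+w. emeasure (\<kappa> w) B \<partial>\<nu>)"
      unfolding Suc by (rule nn_integral_Q_e) (rule measurable_emeasure_kernel[OF \<kappa> B])
    also have "\<dots> = emeasure Q B"
      by (rule emeasure_bind[symmetric, OF _ \<kappa>]) (auto simp: nu.not_empty)
    finally show "emeasure (distr \<mu> X (\<lambda>x. x (Suc n))) B = emeasure Q B" .
  qed (simp add: sets_Q)
qed (rule distr_mu_0)

lemma nn_integral_mu_e: "f \<in> borel_measurable \<nu> \<Longrightarrow> (\<integral>\<^sup>+x. f (e (x n)) \<partial>\<mu>) = (\<integral>\<^sup>+w. f w \<partial>\<nu>)"
  by (subst nn_integral_Q_e[symmetric], simp, subst distr_mu[of n, symmetric], subst nn_integral_distr) auto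

text \<open>The constraint at time \<open>Suc n\<close> is absorbed into the weight, which then
  belongs to the past of \<open>Suc n\<close>; this is why the induction over the list generalizes
  \<open>n\<close> and \<open>f\<close>.\<close>

lemma cylinder_after:
  assumes "set Bs \<subseteq> sets X" "f \<in> borel_measurable (history X n)"
  shows "(\<integral>\<^sup>+x. f x * indicator (cylinder X (Suc n) Bs) x \<partial>\<mu>) = (\<integral>\<^sup>+x. f x * cyl Bs (e (x n)) \<partial>\<mu>)"
  using assms
proof (induction Bs arbitrary: n f)
  case Nil
  show ?case by (intro nn_integral_cong) (simp add: space_mu)
next
  case (Cons B Bs)
  have B[measurable]: "B \<in> sets X" "set Bs \<subseteq> sets X" using Cons.prems by auto
  have "subalgebra (history X (Suc n)) (history X n)"
    using sets_history_le[of n "Suc n" X] by (simp add: subalgebra_def)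
  then have "(\<lambda>x. f x * indicator B (x (Suc n))) \<in> borel_measurable (history X (Suc n))"
    by (intro borel_measurable_times_ennreal measurable_from_subalg[OF _ Cons.prems(2)]
      measurable_compose[OF measurable_history_component borel_measurable_indicator[OF B(1)]]) auto
  note IH = Cons.IH[OF B(2) this]
  have "(\<integral>\<^sup>+x. f x * indicator (cylinder X (Suc n) (B # Bs)) x \<partial>\<mu>) =
      (\<integral>\<^sup>+x. f x * indicator B (x (Suc n)) * indicator (cylinder X (Suc (Suc n)) Bs) x \<partial>\<mu>)"
    by (intro nn_integral_cong) (auto simp: space_mu less_Suc_eq_0_disj indicator_def)
  also have "\<dots> = (\<integral>\<^sup>+x. f x * (indicator B (x (Suc n)) * cyl Bs (e (x (Suc n)))) \<partial>\<mu>)"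
    unfolding IH by (simp only: mult.assoc)
  also have "\<dots> = (\<integral>\<^sup>+x. f x * (\<integral>\<^sup>+y. indicator B y * cyl Bs (e y) \<partial>\<kappa> (e (x n))) \<partial>\<mu>)"
    by (rule step) (use Cons.prems in auto)
  finally show ?case by simp
qed

lemma cylinder_0:
  assumes Bs: "set Bs \<subseteq> sets X"
  shows "emeasure \<mu> (cylinder X 0 Bs) = (\<integral>\<^sup>+w. cyl Bs w \<partial>\<nu>)"
proof (cases Bs)
  case Nil
  then show ?thesis using mu.emeasure_space_1 by (simp add: space_mu nu.emeasure_space_1)
next
  case (Cons B Bs')
  have [measurable]: "B \<in> sets X" "set Bs' \<subseteq> sets X" using Bs Cons by auto
  have "emeasure \<mu> (cylinder X 0 Bs) = (\<integral>\<^sup>+x. indicator (cylinder X 0 Bs) x \<partial>\<mu>)"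
    by (rule nn_integral_indicator[symmetric]) (simp only: sets_mu sets_cylinder[OF Bs])
  also have "\<dots> = (\<integral>\<^sup>+x. indicator B (x 0) * indicator (cylinder X (Suc 0) Bs') x \<partial>\<mu>)"
    by (intro nn_integral_cong) (auto simp: space_mu Cons less_Suc_eq_0_disj indicator_def)
  also have "\<dots> = (\<integral>\<^sup>+x. indicator B (x 0) * cyl Bs' (e (x 0)) \<partial>\<mu>)"
    by (rule cylinder_after[OF _ measurable_compose[OF measurable_history_component borel_measurable_indicator]])
      (use Bs Cons in simp_all)
  also have "\<dots> = (\<integral>\<^sup>+x. indicator B x * cyl Bs' (e x) \<partial>Q)"
    by (subst distr_mu[of 0, symmetric], subst nn_integral_distr) auto
  also have "\<dots> = (\<integral>\<^sup>+w. cyl Bs w \<partial>\<nu>)"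
    unfolding Cons cyl.simps by (rule nn_integral_Q) simp
  finally show ?thesis .
qed

text \<open>A cylinder from time 1 on and the same cylinder from time 0 on both have as probability
  the \<nu>-integral of \<open>cyl Bs\<close>, since \<open>e (x 0)\<close> has law \<nu>.\<close>

lemma stationary: "stationary_under \<mu> path_shift"
proof -
  have m: "path_shift \<in> \<mu> \<rightarrow>\<^sub>M \<mu>"
    using measurable_path_shift by (simp cong: measurable_cong_sets add: sets_mu)
  moreover have "distr \<mu> \<mu> path_shift = \<mu>"
  proof (rule path_measure_eqI)
    show "finite_measure (distr \<mu> \<mu> path_shift)"
      by (intro prob_space.finite_measure mu.prob_space_distr m)
    fix Bs assume Bs: "set Bs \<subseteq> sets X"
    have "emeasure (distr \<mu> \<mu> path_shift) (cylinder X 0 Bs) = emeasure \<mu> (path_shift -` cylinder X 0 Bs \<inter> space (path_space X))"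
      by (subst emeasure_distr[OF m]) (simp_all only: sets_mu space_mu sets_cylinder[OF Bs])
    also have "path_shift -` cylinder X 0 Bs \<inter> space (path_space X) = cylinder X (Suc 0) Bs"
      by (auto simp: path_shift_def space_PiM)
    also have "emeasure \<mu> \<dots> = (\<integral>\<^sup>+x. 1 * indicator (cylinder X (Suc 0) Bs) x \<partial>\<mu>)"
      using sets_cylinder[OF Bs, of "Suc 0"] by (simp only: mult_1 nn_integral_indicator sets_mu)
    also have "\<dots> = (\<integral>\<^sup>+x. 1 * cyl Bs (e (x 0)) \<partial>\<mu>)"
      by (rule cylinder_after[OF Bs]) simp
    also have "\<dots> = (\<integral>\<^sup>+w. cyl Bs w \<partial>\<nu>)"
      using Bs nn_integral_mu_e[of "cyl Bs" 0] by simp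
    finally show "emeasure (distr \<mu> \<mu> path_shift) (cylinder X 0 Bs) = emeasure \<mu> (cylinder X 0 Bs)"
      by (simp only: cylinder_0[OF Bs])
  qed (simp_all add: sets_mu)
  ultimately show ?thesis by (simp add: stationary_under_def)
qed

end

context env_chain
begin

lemma env_chain_lawI: "is_law \<mu> \<Longrightarrow> env_chain_law \<nu> X \<kappa> e \<mu>"
  unfolding env_chain_law_def env_chain_law_axioms_def
  by (intro conjI env_chain_axioms) (blast intro: markov_chain_law_def[THEN iffD1, THEN conjunct1])

lemma law_unique:
  assumes "is_law \<mu>" "is_law \<mu>'" shows "\<mu> = \<mu>'"
proof -
  interpret A: env_chain_law \<nu> X \<kappa> e \<mu> by (rule env_chain_lawI) fact
  interpret B: env_chain_law \<nu> X \<kappa> e \<mu>' by (rule env_chain_lawI) fact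
  show ?thesis
    by (rule path_measure_eqI[OF A.sets_mu B.sets_mu A.mu.finite_measure_axioms])
      (simp only: A.cylinder_0 B.cylinder_0)
qed

end

text \<open>A one-sided pointwise bound becomes an equality once invariance shows that the integrals
  agree; this serves superharmonic functions as well as the renewal equation.\<close>

lemma AE_eq_of_nn_integral_ge:
  assumes [measurable]: "f \<in> borel_measurable M" "g \<in> borel_measurable M"
    and le: "AE x in M. f x \<le> g x" and int: "(\<integral>\<^sup>+x. g x \<partial>M) \<le> (\<integral>\<^sup>+x. f x \<partial>M)"
    and fin: "(\<integral>\<^sup>+x. f x \<partial>M) \<noteq> \<infinity>"
  shows "AE x in M. f x = (g x :: ennreal)"
proof -
  have "(\<integral>\<^sup>+x. g x - f x \<partial>M) = (\<integral>\<^sup>+x. g x \<partial>M) - (\<integral>\<^sup>+x. f x \<partial>M)"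
    by (rule nn_integral_diff) (use fin le in auto)
  also have "\<dots> = 0"
    using int fin by (auto simp: diff_eq_0_iff_ennreal less_top[symmetric] top_unique)
  finally have "AE x in M. g x - f x = 0"
    by (subst (asm) nn_integral_0_iff_AE) auto
  moreover have "AE x in M. f x \<noteq> \<infinity>"
    using fin by (intro nn_integral_PInf_AE) auto
  ultimately show ?thesis
    using le by eventually_elim (auto simp: diff_eq_0_iff_ennreal less_top top_unique intro: antisym)
qed

section \<open>Ergodicity of the path shift\<close>

context env_chain_law
begin

text \<open>\<open>c\<close> is the conditional probability of \<open>D\<close> given the
  environment at time \<open>n\<close>. The Radon-Nikodym theorem applies because the law of
  \<open>e (x n)\<close> restricted to \<open>D\<close> is dominated by \<nu>.\<close>

lemma density_past:
  assumes D[measurable]: "D \<in> sets (path_space X)"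
  obtains c where "c \<in> borel_measurable \<nu>"
    "\<And>f. f \<in> borel_measurable \<nu> \<Longrightarrow> (\<integral>\<^sup>+x. indicator D x * f (e (x n)) \<partial>\<mu>) = (\<integral>\<^sup>+w. c w * f w \<partial>\<nu>)"
proof -
  define N where "N = distr (density \<mu> (indicator D)) \<nu> (\<lambda>x. e (x n))"
  have N: "(\<integral>\<^sup>+w. f w \<partial>N) = (\<integral>\<^sup>+x. indicator D x * f (e (x n)) \<partial>\<mu>)" if [measurable]: "f \<in> borel_measurable \<nu>" for f
    unfolding N_def by (subst nn_integral_distr, simp_all, subst nn_integral_density) auto
  have le: "emeasure N B \<le> emeasure \<nu> B" if [measurable]: "B \<in> sets \<nu>" for B
  proof -
    have "emeasure N B = (\<integral>\<^sup>+w. indicator B w \<partial>N)" by (simp add: N_def)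
    also have "\<dots> = (\<integral>\<^sup>+x. indicator D x * indicator B (e (x n)) \<partial>\<mu>)" by (rule N) simp
    also have "\<dots> \<le> (\<integral>\<^sup>+x. indicator B (e (x n)) \<partial>\<mu>)"
      by (intro nn_integral_mono) (auto split: split_indicator)
    also have "\<dots> = emeasure \<nu> B" by (subst nn_integral_mu_e) auto
    finally show ?thesis .
  qed
  have d: "density \<nu> (RN_deriv \<nu> N) = N"
  proof (rule nu.density_RN_deriv)
    show "absolutely_continuous \<nu> N"
      unfolding absolutely_continuous_def using le by (auto simp: null_sets_def N_def) (metis le_zero_eq)
  qed (simp add: N_def)
  show ?thesis
  proof
    fix f :: "_ \<Rightarrow> ennreal" assume f[measurable]: "f \<in> borel_measurable \<nu>"
    show "(\<integral>\<^sup>+x. indicator D x * f (e (x n)) \<partial>\<mu>) = (\<integral>\<^sup>+w. RN_deriv \<nu> N w * f w \<partial>\<nu>)"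
      unfolding N[OF f, symmetric] by (subst d[symmetric], subst nn_integral_density) auto
  qed simp
qed

lemma after_measurable: "(\<lambda>x i. x (k + i)) \<in> path_space X \<rightarrow>\<^sub>M path_space X"
  by (rule measurable_PiM_single') (auto simp: space_PiM PiE_iff)

lemma e_history:
  assumes "B \<in> sets \<nu>" "i \<le> n"
  shows "{x \<in> space (path_space X). e (x i) \<in> B} \<in> sets (history X n)"
proof -
  have "{x \<in> space (path_space X). e (x i) \<in> B} = (\<lambda>x. e (x i)) -` B \<inter> space (history X n)"
    by auto
  then show ?thesis
    using measurable_sets[OF measurable_compose[OF measurable_history_component[OF assms(2)] e] assms(1)]
    by simp
qed

text \<open>Conditional independence of the past \<open>C\<close> and the future after
  \<open>n\<close>, given \<open>e (x n)\<close>: the past may be replaced by its density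
  \<open>c\<close>. Both sides are measures in \<open>G\<close>, and they agree on cylinders since
  the probability of a cylinder after \<open>n\<close> depends only on
  \<open>e (x n)\<close>.\<close>

lemma past_future:
  assumes C: "C \<in> sets (history X n)" and c[measurable]: "c \<in> borel_measurable \<nu>"
    and Cc: "\<And>f. f \<in> borel_measurable \<nu> \<Longrightarrow> (\<integral>\<^sup>+x. indicator C x * f (e (x n)) \<partial>\<mu>) = (\<integral>\<^sup>+w. c w * f w \<partial>\<nu>)"
    and G: "G \<in> sets (path_space X)"
  shows "(\<integral>\<^sup>+x. indicator C x * indicator G (\<lambda>i. x (Suc n + i)) \<partial>\<mu>) =
    (\<integral>\<^sup>+x. c (e (x n)) * indicator G (\<lambda>i. x (Suc n + i)) \<partial>\<mu>)"
proof -
  define s where "s = (\<lambda>(x :: nat \<Rightarrow> 'x) i. x (Suc n + i))"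
  have [measurable]: "s \<in> path_space X \<rightarrow>\<^sub>M path_space X"
    unfolding s_def by (rule after_measurable)
  have [measurable]: "C \<in> sets (path_space X)" using C by (rule history_sets)
  let ?M = "distr (density \<mu> (indicator C)) (path_space X) s"
  let ?N = "distr (density \<mu> (\<lambda>x. c (e (x n)))) (path_space X) s"
  have M: "emeasure ?M G = (\<integral>\<^sup>+x. indicator C x * indicator G (s x) \<partial>\<mu>)" if [measurable]: "G \<in> sets (path_space X)" for G
  proof -
    have "emeasure ?M G = (\<integral>\<^sup>+y. indicator G y \<partial>?M)" by simp
    also have "\<dots> = (\<integral>\<^sup>+x. indicator C x * indicator G (s x) \<partial>\<mu>)"
      by (subst nn_integral_distr, simp_all, subst nn_integral_density) auto
    finally show ?thesis .
  qed
  have N: "emeasure ?N G = (\<integral>\<^sup>+x. c (e (x n)) * indicator G (s x) \<partial>\<mu>)" if [measurable]: "G \<in> sets (path_space X)" for G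
  proof -
    have "emeasure ?N G = (\<integral>\<^sup>+y. indicator G y \<partial>?N)" by simp
    also have "\<dots> = (\<integral>\<^sup>+x. c (e (x n)) * indicator G (s x) \<partial>\<mu>)"
      by (subst nn_integral_distr, simp_all, subst nn_integral_density) auto
    finally show ?thesis .
  qed
  have "?M = ?N"
  proof (rule path_measure_eqI)
    have "emeasure ?M (space ?M) = (\<integral>\<^sup>+x. indicator C x * indicator (space (path_space X)) (s x) \<partial>\<mu>)"
      using M[OF sets.top] by simp
    also have "\<dots> \<le> (\<integral>\<^sup>+x. 1 \<partial>\<mu>)"
      by (intro nn_integral_mono) (auto split: split_indicator)
    finally have "emeasure ?M (space ?M) \<le> (\<integral>\<^sup>+x. 1 \<partial>\<mu>)" .
    then show "finite_measure ?M"
      using mu.emeasure_space_1 by (intro finite_measureI) (auto simp: top_unique)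
    fix Bs assume Bs[measurable]: "set Bs \<subseteq> sets X"
    have s: "indicator (cylinder X 0 Bs) (s x) = (indicator (cylinder X (Suc n) Bs) x :: ennreal)" if "x \<in> space \<mu>" for x
      using that by (auto simp: space_mu space_PiM PiE_iff s_def split: split_indicator)
    have "emeasure ?M (cylinder X 0 Bs) = (\<integral>\<^sup>+x. indicator C x * indicator (cylinder X (Suc n) Bs) x \<partial>\<mu>)"
      unfolding M[OF sets_cylinder[OF Bs]] by (intro nn_integral_cong) (simp only: s)
    also have "\<dots> = (\<integral>\<^sup>+w. c w * cyl Bs w \<partial>\<nu>)"
      unfolding cylinder_after[OF Bs borel_measurable_indicator[OF C]] by (rule Cc) simp
    also have "\<dots> = (\<integral>\<^sup>+x. c (e (x n)) * cyl Bs (e (x n)) \<partial>\<mu>)"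
      by (rule nn_integral_mu_e[symmetric]) simp
    also have "\<dots> = (\<integral>\<^sup>+x. c (e (x n)) * indicator (cylinder X (Suc n) Bs) x \<partial>\<mu>)"
      by (rule cylinder_after[symmetric, OF Bs])
        (rule measurable_compose[OF measurable_compose[OF measurable_history_component e] c], simp)
    also have "\<dots> = emeasure ?N (cylinder X 0 Bs)"
      unfolding N[OF sets_cylinder[OF Bs]] by (intro nn_integral_cong) (simp only: s)
    finally show "emeasure ?M (cylinder X 0 Bs) = emeasure ?N (cylinder X 0 Bs)" .
  qed simp_all
  then show ?thesis using M[OF G] N[OF G] by (simp add: s_def)
qed

text \<open>\<open>E\<close> is the zero-one law for sets of environments that a step of \<kappa>
  almost surely neither enters nor leaves. It is applied to the set where the conditional
  probability \<open>a\<close> of the invariant event is at least its mean \<alpha>.\<close>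

theorem ergodic:
  assumes E: "\<And>B. B \<in> sets \<nu> \<Longrightarrow> AE w in \<nu>. AE y in \<kappa> w. e y \<in> B \<longleftrightarrow> w \<in> B \<Longrightarrow> emeasure \<nu> B = 0 \<or> emeasure \<nu> B = 1"
  shows "ergodic_under \<mu> path_shift"
  unfolding ergodic_under_def
proof (intro ballI impI)
  fix A assume "A \<in> sets \<mu>" and inv: "path_shift -` A \<inter> space \<mu> = A"
  then have A[measurable]: "A \<in> sets (path_space X)" by (simp add: sets_mu)
  note sh = measurable_path_shift[of X, measurable]
  have inv1: "path_shift x \<in> A \<longleftrightarrow> x \<in> A" if "x \<in> space \<mu>" for x using inv that by auto
  have inv_k: "(\<lambda>i. x (k + i)) \<in> A \<longleftrightarrow> x \<in> A" if "x \<in> space \<mu>" for x k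
    using that
  proof (induction k arbitrary: x)
    case (Suc k)
    have "path_shift x \<in> space \<mu>" using Suc.prems measurable_space[OF sh] by (simp add: space_mu)
    from Suc.IH[OF this] show ?case using inv1[OF Suc.prems] by (simp add: path_shift_def)
  qed simp
  obtain a where a[measurable]: "a \<in> borel_measurable \<nu>" and
    a0: "\<And>f. f \<in> borel_measurable \<nu> \<Longrightarrow> (\<integral>\<^sup>+x. indicator A x * f (e (x 0)) \<partial>\<mu>) = (\<integral>\<^sup>+w. a w * f w \<partial>\<nu>)"
    by (rule density_past[OF A, of 0]) blast
  \<comment> \<open>Shifting the path changes neither \<mu> nor \<open>A\<close>, so the density of
    \<open>A\<close> seen at time \<open>n\<close> is the same function \<open>a\<close> for every
    \<open>n\<close>.\<close>
  have an: "(\<integral>\<^sup>+x. indicator A x * f (e (x n)) \<partial>\<mu>) = (\<integral>\<^sup>+w. a w * f w \<partial>\<nu>)" if f[measurable]: "f \<in> borel_measurable \<nu>" for f n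
  proof (induction n)
    case 0 show ?case by (rule a0[OF f])
  next
    case (Suc n)
    have "(\<integral>\<^sup>+x. indicator A x * f (e (x (Suc n))) \<partial>\<mu>) =
      (\<integral>\<^sup>+x. indicator A (path_shift x) * f (e (path_shift x n)) \<partial>\<mu>)"
      using inv1 by (intro nn_integral_cong) (auto simp: path_shift_def indicator_def)
    also have "\<dots> = (\<integral>\<^sup>+x. indicator A x * f (e (x n)) \<partial>distr \<mu> \<mu> path_shift)"
      by (subst nn_integral_distr) auto
    also have "\<dots> = (\<integral>\<^sup>+x. indicator A x * f (e (x n)) \<partial>\<mu>)"
      using stationary by (simp add: stationary_under_def)
    finally show ?case using Suc by simp
  qed
  \<comment> \<open>By invariance \<open>A\<close> is an event of the future after \<open>n\<close>.
    Replacing \<open>C\<close> by its density and then \<open>A\<close> by its own gives a formula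
    symmetric in \<open>a\<close> and \<open>c\<close>, which is read back as an integral over
    \<open>C\<close>.\<close>
  have CA: "emeasure \<mu> (C \<inter> A) = (\<integral>\<^sup>+x. indicator C x * a (e (x n)) \<partial>\<mu>)" if C: "C \<in> sets (history X n)" for C n
  proof -
    have [measurable]: "C \<in> sets (path_space X)" using C by (rule history_sets)
    obtain c where c[measurable]: "c \<in> borel_measurable \<nu>" and
      cC: "\<And>f. f \<in> borel_measurable \<nu> \<Longrightarrow> (\<integral>\<^sup>+x. indicator C x * f (e (x n)) \<partial>\<mu>) = (\<integral>\<^sup>+w. c w * f w \<partial>\<nu>)"
      by (rule density_past[of C n]) auto
    have "emeasure \<mu> (C \<inter> A) = (\<integral>\<^sup>+x. indicator (C \<inter> A) x \<partial>\<mu>)" by simp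
    also have "\<dots> = (\<integral>\<^sup>+x. indicator C x * indicator A (\<lambda>i. x (Suc n + i)) \<partial>\<mu>)"
      by (intro nn_integral_cong) (auto simp: inv_k[of _ "Suc n"] simp del: add_Suc split: split_indicator)
    also have "\<dots> = (\<integral>\<^sup>+x. c (e (x n)) * indicator A (\<lambda>i. x (Suc n + i)) \<partial>\<mu>)"
      by (rule past_future[OF C c cC A])
    also have "\<dots> = (\<integral>\<^sup>+x. indicator A x * c (e (x n)) \<partial>\<mu>)"
      by (intro nn_integral_cong) (auto simp: inv_k[of _ "Suc n"] simp del: add_Suc split: split_indicator)
    also have "\<dots> = (\<integral>\<^sup>+w. a w * c w \<partial>\<nu>)" by (rule an) simp
    also have "\<dots> = (\<integral>\<^sup>+x. indicator C x * a (e (x n)) \<partial>\<mu>)"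
      unfolding cC[OF a] by (simp add: mult.commute)
    finally show ?thesis .
  qed
  \<comment> \<open>The event \<open>e (x 0) \<in> B\<close> belongs to the past of time 0 and of
    time 1. Its intersection with \<open>A\<close>, computed at both times, has the density
    \<open>a\<close> and the one-step average of \<open>a\<close>.\<close>
  have harm: "AE w in \<nu>. a w = (\<integral>\<^sup>+y. a (e y) \<partial>\<kappa> w)"
  proof (rule nu.density_unique2)
    fix B assume B[measurable]: "B \<in> sets \<nu>"
    define C where "C = {x \<in> space (path_space X). e (x 0) \<in> B}"
    have C0: "C \<in> sets (history X 0)" and C1: "C \<in> sets (history X 1)"
      unfolding C_def by (auto intro: e_history)
    have [measurable]: "C \<in> sets (path_space X)" unfolding C_def by measurable
    have "(\<integral>\<^sup>+w\<in>B. a w \<partial>\<nu>) = (\<integral>\<^sup>+x. indicator A x * indicator B (e (x 0)) \<partial>\<mu>)"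
      by (rule a0[symmetric]) simp
    also have "\<dots> = (\<integral>\<^sup>+x. indicator (C \<inter> A) x \<partial>\<mu>)"
      by (intro nn_integral_cong) (auto simp: space_mu C_def split: split_indicator)
    also have "\<dots> = (\<integral>\<^sup>+x. indicator C x * a (e (x 1)) \<partial>\<mu>)"
      using CA[OF C1] by simp
    also have "\<dots> = (\<integral>\<^sup>+x. indicator C x * (\<integral>\<^sup>+y. a (e y) \<partial>\<kappa> (e (x 0))) \<partial>\<mu>)"
      using step[OF _ borel_measurable_indicator[OF C0], of "\<lambda>y. a (e y)"] by simp
    also have "\<dots> = (\<integral>\<^sup>+x. indicator B (e (x 0)) * (\<integral>\<^sup>+y. a (e y) \<partial>\<kappa> (e (x 0))) \<partial>\<mu>)"
      by (intro nn_integral_cong) (auto simp: space_mu C_def split: split_indicator)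
    also have "\<dots> = (\<integral>\<^sup>+w. indicator B w * (\<integral>\<^sup>+y. a (e y) \<partial>\<kappa> w) \<partial>\<nu>)"
      by (rule nn_integral_mu_e) simp
    finally show "(\<integral>\<^sup>+w\<in>B. a w \<partial>\<nu>) = (\<integral>\<^sup>+w\<in>B. (\<integral>\<^sup>+y. a (e y) \<partial>\<kappa> w) \<partial>\<nu>)"
      by (simp add: mult.commute)
  qed simp_all
  define \<alpha> where "\<alpha> = emeasure \<mu> A"
  have \<alpha>: "\<alpha> = (\<integral>\<^sup>+w. a w \<partial>\<nu>)"
    using a0[of "\<lambda>_. 1"] by (simp add: \<alpha>_def)
  have \<alpha>1: "\<alpha> \<le> 1" by (simp add: \<alpha>_def mu.emeasure_le_1)
  then have \<alpha>fin: "\<alpha> \<noteq> \<infinity>" by (auto simp: top_unique)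
  define B where "B = {w \<in> space \<nu>. \<alpha> \<le> a w}"
  have B[measurable]: "B \<in> sets \<nu>" by (simp add: B_def)
  have int\<alpha>: "(\<integral>\<^sup>+w. \<alpha> \<partial>\<nu>) = \<alpha>" by (simp add: nu.emeasure_space_1)
  \<comment> \<open>Truncating a harmonic function at \<alpha> makes it superharmonic; invariance of
    \<nu> gives both sides the same integral, so the truncation is harmonic too.\<close>
  have m_eq: "AE w in \<nu>. (\<integral>\<^sup>+y. min (a (e y)) \<alpha> \<partial>\<kappa> w) = min (a w) \<alpha>"
  proof (rule AE_eq_of_nn_integral_ge)
    show "AE w in \<nu>. (\<integral>\<^sup>+y. min (a (e y)) \<alpha> \<partial>\<kappa> w) \<le> min (a w) \<alpha>"
      using harm total AE_space
    proof eventually_elim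
      case (elim w)
      have "(\<integral>\<^sup>+y. min (a (e y)) \<alpha> \<partial>\<kappa> w) \<le> (\<integral>\<^sup>+y. a (e y) \<partial>\<kappa> w)"
        by (intro nn_integral_mono) auto
      moreover have "(\<integral>\<^sup>+y. min (a (e y)) \<alpha> \<partial>\<kappa> w) \<le> (\<integral>\<^sup>+y. \<alpha> \<partial>\<kappa> w)"
        by (intro nn_integral_mono) auto
      ultimately show ?case using elim by (simp add: space_\<kappa>)
    qed
    show "(\<integral>\<^sup>+w. min (a w) \<alpha> \<partial>\<nu>) \<le> (\<integral>\<^sup>+w. (\<integral>\<^sup>+y. min (a (e y)) \<alpha> \<partial>\<kappa> w) \<partial>\<nu>)"
      by (subst nn_integral_\<kappa>_e) auto
    have "(\<integral>\<^sup>+w. (\<integral>\<^sup>+y. min (a (e y)) \<alpha> \<partial>\<kappa> w) \<partial>\<nu>) = (\<integral>\<^sup>+w. min (a w) \<alpha> \<partial>\<nu>)"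
      by (subst nn_integral_\<kappa>_e) auto
    also have "\<dots> \<le> (\<integral>\<^sup>+w. \<alpha> \<partial>\<nu>)" by (intro nn_integral_mono) auto
    also have "\<dots> = \<alpha>" by (rule int\<alpha>)
    finally show "(\<integral>\<^sup>+w. (\<integral>\<^sup>+y. min (a (e y)) \<alpha> \<partial>\<kappa> w) \<partial>\<nu>) \<noteq> \<infinity>"
      using \<alpha>fin by (auto simp: top_unique)
  qed simp_all
  \<comment> \<open>On \<open>B\<close> the truncation has its maximal value \<alpha>, and an
    average of values at most \<alpha> equals \<alpha> only if almost all of them do.\<close>
  have stay: "AE w in \<nu>. w \<in> B \<longrightarrow> (AE y in \<kappa> w. e y \<in> B)"
    using m_eq total AE_space
  proof eventually_elim
    case (elim w)
    note sets_\<kappa>[OF elim(3), measurable_cong]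
    show ?case
    proof
      assume "w \<in> B"
      then have "(\<integral>\<^sup>+y. min (a (e y)) \<alpha> \<partial>\<kappa> w) = \<alpha>" using elim by (simp add: B_def min_def)
      then have "AE y in \<kappa> w. min (a (e y)) \<alpha> = \<alpha>"
        using elim \<alpha>fin by (intro AE_eq_of_nn_integral_ge) (auto simp: space_\<kappa>)
      moreover have "AE y in \<kappa> w. e y \<in> space \<nu>"
        using elim by (intro AE_I2) (auto simp: space_\<kappa> intro: measurable_space[OF e])
      ultimately show "AE y in \<kappa> w. e y \<in> B"
        by eventually_elim (auto simp: B_def min_def split: if_splits)
    qed
  qed
  have eB[measurable]: "e -` B \<inter> space X \<in> sets X" by measurable
  have km[measurable]: "(\<lambda>w. emeasure (\<kappa> w) (e -` B \<inter> space X)) \<in> borel_measurable \<nu>"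
    by (rule measurable_emeasure_kernel[OF \<kappa> eB])
  \<comment> \<open>\<open>B\<close> is not left, so its indicator is at most the probability of
    moving into \<open>B\<close>. Equal integrals exclude entering \<open>B\<close> from
    outside.\<close>
  have "AE w in \<nu>. indicator B w = emeasure (\<kappa> w) (e -` B \<inter> space X)"
  proof (rule AE_eq_of_nn_integral_ge)
    show "AE w in \<nu>. indicator B w \<le> emeasure (\<kappa> w) (e -` B \<inter> space X)"
      using stay total AE_space
    proof eventually_elim
      case (elim w)
      show ?case
      proof (cases "w \<in> B")
        case True
        with elim have "AE y in \<kappa> w. e y \<in> B" by simp
        then have "emeasure (\<kappa> w) (e -` B \<inter> space X) = emeasure (\<kappa> w) (space X)"
          using elim by (intro emeasure_eq_AE) (auto simp: sets_\<kappa> space_\<kappa>)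
        then show ?thesis using elim True by simp
      qed simp
    qed
    show "(\<integral>\<^sup>+w. emeasure (\<kappa> w) (e -` B \<inter> space X) \<partial>\<nu>) \<le> (\<integral>\<^sup>+w. indicator B w \<partial>\<nu>)"
      using invariant[OF B] by simp
  qed (use nu.emeasure_le_1[of B] in \<open>auto simp: top_unique\<close>)
  then have "AE w in \<nu>. AE y in \<kappa> w. e y \<in> B \<longleftrightarrow> w \<in> B"
    using stay AE_space
  proof eventually_elim
    case (elim w)
    show ?case
    proof (cases "w \<in> B")
      case True with elim show ?thesis by auto
    next
      case False
      with elim have "emeasure (\<kappa> w) (e -` B \<inter> space X) = 0" by simp
      then have "e -` B \<inter> space X \<in> null_sets (\<kappa> w)" using elim by (auto simp: null_sets_def sets_\<kappa>)
      then have "AE y in \<kappa> w. y \<notin> e -` B \<inter> space X" by (rule AE_not_in)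
      then show ?thesis using AE_space[of "\<kappa> w"]
        by eventually_elim (use False elim in \<open>auto simp: space_\<kappa>\<close>)
    qed
  qed
  \<comment> \<open>Triviality of \<open>B\<close> means that \<open>a\<close> lies on one side of
    its mean \<alpha> almost everywhere, which forces equality.\<close>
  from E[OF B this] have "AE w in \<nu>. a w = \<alpha>"
  proof
    assume "emeasure \<nu> B = 1"
    then have "AE w in \<nu>. w \<in> B" by (subst nu.AE_in_set_eq_1) (auto simp: nu.emeasure_eq_measure)
    then have "AE w in \<nu>. \<alpha> = a w"
      using \<alpha>fin by (intro AE_eq_of_nn_integral_ge) (auto simp: \<alpha>[symmetric] nu.emeasure_space_1 B_def)
    then show ?thesis by auto
  next
    assume "emeasure \<nu> B = 0"
    then have "AE w in \<nu>. w \<notin> B" by (intro AE_not_in) (auto simp: null_sets_def)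
    then show ?thesis using AE_space
      by (intro AE_eq_of_nn_integral_ge) (use \<alpha>fin in \<open>auto simp: \<alpha>[symmetric] nu.emeasure_space_1 B_def\<close>)
  qed
  note const = this
  have CA': "emeasure \<mu> (C \<inter> A) = \<alpha> * emeasure \<mu> C" if C: "C \<in> sets (history X n)" for C n
  proof -
    have [measurable]: "C \<in> sets (path_space X)" using C by (rule history_sets)
    have "AE w in distr \<mu> \<nu> (\<lambda>x. e (x n)). a w = \<alpha>"
    proof -
      have "distr \<mu> \<nu> (\<lambda>x. e (x n)) = distr (distr \<mu> X (\<lambda>x. x n)) \<nu> e"
        by (subst distr_distr) (auto simp: comp_def)
      then have "distr \<mu> \<nu> (\<lambda>x. e (x n)) = \<nu>" by (simp only: distr_mu distr_Q)
      then show ?thesis using const by (rule ssubst)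
    qed
    then have "AE x in \<mu>. a (e (x n)) = \<alpha>"
      by (subst (asm) AE_distr_iff) auto
    then have "emeasure \<mu> (C \<inter> A) = (\<integral>\<^sup>+x. \<alpha> * indicator C x \<partial>\<mu>)"
      unfolding CA[OF C] by (intro nn_integral_cong_AE) (auto simp: mult.commute)
    then show ?thesis by (simp add: nn_integral_cmult_indicator)
  qed
  \<comment> \<open>Independence of \<open>A\<close> from cylinders is an identity of two measures,
    which may then be evaluated at \<open>A\<close> itself: \<alpha> equals its square.\<close>
  have "density \<mu> (indicator A) = density \<mu> (\<lambda>_. \<alpha>)"
  proof (rule path_measure_eqI)
    have "emeasure (density \<mu> (indicator A)) (space \<mu>) = (\<integral>\<^sup>+x. indicator A x * indicator (space \<mu>) x \<partial>\<mu>)"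
      by (rule emeasure_density) auto
    also have "\<dots> \<le> (\<integral>\<^sup>+x. 1 \<partial>\<mu>)"
      by (intro nn_integral_mono) (auto split: split_indicator)
    finally show "finite_measure (density \<mu> (indicator A))"
      by (intro finite_measureI) (auto simp: mu.emeasure_space_1 top_unique)
    fix Bs assume Bs[measurable]: "set Bs \<subseteq> sets X"
    define D where "D = cylinder X 0 Bs"
    have "D = (\<Inter>i<length Bs. (\<lambda>x. x i) -` (Bs ! i) \<inter> space (history X (length Bs))) \<inter> space (history X (length Bs))"
      by (auto simp: D_def)
    also have "\<dots> \<in> sets (history X (length Bs))"
    proof (cases "Bs = []")
      case False
      have "(\<lambda>x. x i) -` (Bs ! i) \<inter> space (history X (length Bs)) \<in> sets (history X (length Bs))" if "i < length Bs" for i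
        by (rule measurable_sets[OF measurable_history_component]) (use that Bs in auto)
      then have "(\<Inter>i<length Bs. (\<lambda>x. x i) -` (Bs ! i) \<inter> space (history X (length Bs))) \<in> sets (history X (length Bs))"
        by (rule sets.finite_INT[rotated 2]) (use False in auto)
      then show ?thesis by (rule sets.Int[OF _ sets.top])
    qed (auto simp del: space_history)
    finally have D: "D \<in> sets (history X (length Bs))" .
    then have [measurable]: "D \<in> sets (path_space X)" by (rule history_sets)
    have "emeasure (density \<mu> (indicator A)) D = (\<integral>\<^sup>+x. indicator A x * indicator D x \<partial>\<mu>)"
      by (rule emeasure_density) auto
    also have "\<dots> = (\<integral>\<^sup>+x. indicator (D \<inter> A) x \<partial>\<mu>)"
      by (intro nn_integral_cong) (auto split: split_indicator)
    also have "\<dots> = emeasure \<mu> (D \<inter> A)" by (rule nn_integral_indicator) auto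
    also have "\<dots> = \<alpha> * emeasure \<mu> D" by (rule CA'[OF D])
    also have "\<dots> = emeasure (density \<mu> (\<lambda>_. \<alpha>)) D"
      by (subst emeasure_density) (auto simp: nn_integral_cmult_indicator)
    finally show "emeasure (density \<mu> (indicator A)) (cylinder X 0 Bs) = emeasure (density \<mu> (\<lambda>_. \<alpha>)) (cylinder X 0 Bs)"
      unfolding D_def .
  qed (simp_all add: sets_mu)
  then have "emeasure (density \<mu> (indicator A)) A = emeasure (density \<mu> (\<lambda>_. \<alpha>)) A" by simp
  then have "\<alpha> = \<alpha> * \<alpha>"
    by (subst (asm) (1 2) emeasure_density) (auto simp: nn_integral_cmult_indicator \<alpha>_def indicator_inter_arith[symmetric])
  moreover have "\<alpha> = ennreal (measure \<mu> A)" by (simp add: \<alpha>_def mu.emeasure_eq_measure)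
  ultimately have "measure \<mu> A = measure \<mu> A * measure \<mu> A"
    by (metis ennreal_mult' ennreal_inj measure_nonneg mult_nonneg_nonneg)
  then show "measure \<mu> A = 0 \<or> measure \<mu> A = 1" by auto
qed

end

section \<open>Existence of the chain\<close>

context env_chain
begin

lemma prob_space_Q: "prob_space Q"
proof
  have "space Q = space X" by (rule sets_eq_imp_space_eq[OF sets_Q])
  then have "emeasure Q (space Q) = (\<integral>\<^sup>+w. emeasure (\<kappa> w) (space X) \<partial>\<nu>)"
    by (subst emeasure_bind[OF _ \<kappa>]) (auto simp: nu.not_empty)
  also have "\<dots> = (\<integral>\<^sup>+w. 1 \<partial>\<nu>)"
    by (rule nn_integral_cong_AE[OF total])
  finally show "emeasure Q (space Q) = 1" by (simp add: nu.emeasure_space_1)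
qed

text \<open>The kernel may have mass below 1 on a null set, but the Ionescu-Tulcea construction needs
  probability kernels.\<close>

definition \<kappa>1 :: "'x \<Rightarrow> 'e \<Rightarrow> 'x measure" where
  "\<kappa>1 x0 w = (if emeasure (\<kappa> w) (space X) = 1 then \<kappa> w else return X x0)"

lemma \<kappa>1_measurable:
  assumes "x0 \<in> space X" shows "\<kappa>1 x0 \<in> \<nu> \<rightarrow>\<^sub>M subprob_algebra X"
proof -
  have [measurable]: "(\<lambda>w. emeasure (\<kappa> w) (space X)) \<in> borel_measurable \<nu>"
    by (rule measurable_emeasure_kernel[OF \<kappa>]) simp
  have [measurable]: "return X x0 \<in> space (subprob_algebra X)"
    using assms by (metis measurable_space return_measurable)
  show ?thesis unfolding \<kappa>1_def[abs_def]
    by (rule measurable_If[OF \<kappa>]) auto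
qed

lemma \<kappa>1_prob:
  assumes "x0 \<in> space X" "w \<in> space \<nu>" shows "prob_space (\<kappa>1 x0 w)"
  using assms by (auto simp: \<kappa>1_def space_\<kappa> intro: prob_spaceI prob_space_return)

text \<open>The construction uses \<open>\<kappa>1\<close>. Inductively \<open>e (x n)\<close> has
  law \<nu> for this chain too, so it almost surely avoids the environments where
  \<open>\<kappa>1\<close> and \<kappa> differ, and the Markov property holds with \<kappa>.\<close>

lemma law_exists: "\<exists>\<mu>. is_law \<mu>"
proof -
  interpret Qp: prob_space Q by (rule prob_space_Q)
  have spQ: "space Q = space X" by (rule sets_eq_imp_space_eq[OF sets_Q])
  then obtain x0 where x0: "x0 \<in> space X" using Qp.not_empty by auto
  note k1 = \<kappa>1_measurable[OF x0]
  define P where "P n x = (case n of 0 \<Rightarrow> Q | Suc m \<Rightarrow> \<kappa>1 x0 (e (x m)))" for n and x :: "nat \<Rightarrow> 'x"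
  have P_Suc: "P (Suc m) x = \<kappa>1 x0 (e (x m))" for m x by (simp add: P_def)
  have P_0: "P 0 x = Q" for x by (simp add: P_def)
  have xm: "x m \<in> space X" if "x \<in> space (Pi\<^sub>M {0..<Suc m} (\<lambda>_. X))" for x m
    using that by (auto simp: space_PiM PiE_iff)
  interpret IT: Ionescu_Tulcea P "\<lambda>_. X"
  proof (rule Ionescu_Tulcea.intro)
    fix i :: nat show "P i \<in> Pi\<^sub>M {0..<i} (\<lambda>_. X) \<rightarrow>\<^sub>M subprob_algebra X"
    proof (cases i)
      case 0
      have "Q \<in> space (subprob_algebra X)"
        by (simp add: space_subprob_algebra sets_Q Qp.subprob_space_axioms)
      then show ?thesis unfolding 0 P_0[abs_def] by (intro measurable_const)
    next
      case (Suc m)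
      have "(\<lambda>x. x m) \<in> Pi\<^sub>M {0..<i} (\<lambda>_. X) \<rightarrow>\<^sub>M X"
        by (rule measurable_component_singleton) (simp add: Suc)
      from measurable_compose[OF measurable_compose[OF this e] k1]
      show ?thesis unfolding Suc P_Suc[abs_def] .
    qed
  next
    fix i :: nat and x assume x: "x \<in> space (Pi\<^sub>M {0..<i} (\<lambda>_. X))"
    show "prob_space (P i x)"
    proof (cases i)
      case (Suc m)
      then show ?thesis using measurable_space[OF e xm[of x m]] x by (simp add: P_Suc \<kappa>1_prob x0)
    qed (simp add: P_0 prob_space_Q)
  qed
  define \<mu> where "\<mu> = IT.PF.lim"
  interpret mu: prob_space \<mu>
  proof (rule prob_spaceI)
    interpret CI: prob_space "IT.CI {}" by (rule IT.PF.prob_space_P) simp_all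
    have "space \<mu> = prod_emb UNIV (\<lambda>_. X) {} (space (Pi\<^sub>M {} (\<lambda>_. X)))"
      by (auto simp: \<mu>_def prod_emb_def space_PiM)
    then have "emeasure \<mu> (space \<mu>) = emeasure (IT.CI {}) (space (Pi\<^sub>M {} (\<lambda>_. X)))"
      unfolding \<mu>_def using IT.lim[of "{}" "space (Pi\<^sub>M {} (\<lambda>_. X))"] by simp
    also have "space (Pi\<^sub>M {} (\<lambda>_. X)) = space (IT.CI {})" by (simp add: IT.CI_def)
    finally show "emeasure \<mu> (space \<mu>) = 1" by (simp add: CI.emeasure_space_1)
  qed
  have sets_mu: "sets \<mu> = sets (path_space X)" by (simp add: \<mu>_def)
  have space_mu: "space \<mu> = space (path_space X)" by (rule sets_eq_imp_space_eq[OF sets_mu])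
  note sets_mu[measurable_cong]
  let ?u = "\<lambda>_::nat. undefined :: 'x"
  let ?R = "\<lambda>n (x :: nat \<Rightarrow> 'x). restrict x {0..<n}"
  let ?PM = "\<lambda>n. Pi\<^sub>M {0..<n::nat} (\<lambda>_. X)"
  have u[simp]: "?u \<in> space (?PM 0)" by (simp add: space_PiM)
  have R[measurable]: "?R n \<in> \<mu> \<rightarrow>\<^sub>M ?PM n" for n
    using measurable_restrict_subset[of "{0..<n}" UNIV "\<lambda>_. X"] by (simp cong: measurable_cong_sets add: sets_mu)
  have sC: "sets (IT.C 0 n ?u) = sets (?PM n)" for n using IT.sets_C[OF u, of n] by simp
  have C: "distr \<mu> (?PM n) (?R n) = IT.C 0 n ?u" for n
  proof (rule measure_eqI)
    fix A assume "A \<in> sets (distr \<mu> (?PM n) (?R n))"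
    then have A: "A \<in> sets (?PM n)" by simp
    have "emeasure (distr \<mu> (?PM n) (?R n)) A = emeasure (IT.CI {0..<n}) A"
      unfolding \<mu>_def by (simp add: IT.distr_lim)
    also have "\<dots> = emeasure (IT.C 0 n ?u) (prod_emb {0..<n} (\<lambda>_. X) {0..<n} A)"
      by (rule IT.emeasure_CI[OF _ A]) simp
    also have "prod_emb {0..<n} (\<lambda>_. X) {0..<n} A = A"
      by (rule prod_emb_id) (rule sets.sets_into_space[OF A, unfolded space_PiM])
    finally show "emeasure (distr \<mu> (?PM n) (?R n)) A = emeasure (IT.C 0 n ?u) A" .
  qed (simp add: sC)
  have main: "(\<integral>\<^sup>+x. indicator A (?R n x) * indicator B (x n) \<partial>\<mu>) = (\<integral>\<^sup>+x. indicator A (?R n x) * emeasure (P n (?R n x)) B \<partial>\<mu>)"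
    if A[measurable]: "A \<in> sets (?PM n)" and B[measurable]: "B \<in> sets X" for A B n
  proof -
    define f :: "(nat \<Rightarrow> 'x) \<Rightarrow> ennreal" where "f x = indicator A (?R n x) * indicator B (x n)" for x
    have [measurable]: "?R n \<in> ?PM (Suc n) \<rightarrow>\<^sub>M ?PM n" by (rule measurable_restrict_subset) auto
    have [measurable]: "(\<lambda>x. x n) \<in> ?PM (Suc n) \<rightarrow>\<^sub>M X" by (rule measurable_component_singleton) simp
    have f[measurable]: "f \<in> borel_measurable (?PM (Suc n))"
      unfolding f_def[abs_def] by measurable
    have [measurable]: "(\<lambda>x. emeasure (P n x) B) \<in> borel_measurable (?PM n)"
      by (rule measurable_emeasure_kernel[OF IT.P B])
    have "(\<integral>\<^sup>+x. indicator A (?R n x) * indicator B (x n) \<partial>\<mu>) = (\<integral>\<^sup>+x. f (?R (Suc n) x) \<partial>\<mu>)"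
      by (intro nn_integral_cong) (auto simp: f_def Int_absorb1)
    also have "\<dots> = (\<integral>\<^sup>+x. f x \<partial>IT.C 0 (Suc n) ?u)"
      unfolding C[symmetric] by (rule nn_integral_distr[OF R, symmetric]) simp
    also have "\<dots> = (\<integral>\<^sup>+x. \<integral>\<^sup>+y. f y \<partial>IT.eP n x \<partial>IT.C 0 n ?u)"
      using nn_integral_bind[OF f, of "IT.eP n" "IT.C 0 n ?u"] IT.measurable_eP[of n]
      by (simp cong: measurable_cong_sets add: sC)
    also have "\<dots> = (\<integral>\<^sup>+x. indicator A x * emeasure (P n x) B \<partial>IT.C 0 n ?u)"
    proof (rule nn_integral_cong)
      fix x assume "x \<in> space (IT.C 0 n ?u)"
      then have x: "x \<in> space (?PM n)" using sets_eq_imp_space_eq[OF sC] by simp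
      have Rx: "?R n (x(n := y)) = x" for y using x by (auto simp: space_PiM PiE_iff extensional_def fun_eq_iff)
      have "(\<integral>\<^sup>+y. f y \<partial>IT.eP n x) = (\<integral>\<^sup>+y. f (x(n := y)) \<partial>P n x)"
        by (rule IT.nn_integral_eP[OF x f])
      also have "\<dots> = (\<integral>\<^sup>+y. indicator A x * indicator B y \<partial>P n x)"
        unfolding f_def Rx by simp
      also have "\<dots> = indicator A x * emeasure (P n x) B"
        using IT.sets_P[OF x] B by (subst nn_integral_cmult_indicator) auto
      finally show "(\<integral>\<^sup>+y. f y \<partial>IT.eP n x) = indicator A x * emeasure (P n x) B" .
    qed
    also have "\<dots> = (\<integral>\<^sup>+x. indicator A (?R n x) * emeasure (P n (?R n x)) B \<partial>\<mu>)"
      unfolding C[symmetric] by (rule nn_integral_distr[OF R]) simp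
    finally show ?thesis .
  qed
  have law1: "(\<integral>\<^sup>+x. indicator C x * indicator B (x (Suc n)) \<partial>\<mu>) = (\<integral>\<^sup>+x. indicator C x * emeasure (\<kappa>1 x0 (e (x n))) B \<partial>\<mu>)"
    if C: "C \<in> sets (history X n)" and B: "B \<in> sets X" for B C n
  proof -
    have "{..n} = {0..<Suc n}" by auto
    then obtain A where A: "A \<in> sets (?PM (Suc n))" "C = ?R (Suc n) -` A \<inter> space (path_space X)"
      using C by (auto simp: sets_history)
    have iC: "indicator C x = indicator A (?R (Suc n) x)" if "x \<in> space \<mu>" for x
      using that by (auto simp: A(2) space_mu split: split_indicator)
    have "(\<integral>\<^sup>+x. indicator C x * indicator B (x (Suc n)) \<partial>\<mu>) = (\<integral>\<^sup>+x. indicator A (?R (Suc n) x) * indicator B (x (Suc n)) \<partial>\<mu>)"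
      by (intro nn_integral_cong) (simp only: iC)
    also have "\<dots> = (\<integral>\<^sup>+x. indicator A (?R (Suc n) x) * emeasure (P (Suc n) (?R (Suc n) x)) B \<partial>\<mu>)"
      by (rule main[OF A(1) B])
    also have "\<dots> = (\<integral>\<^sup>+x. indicator C x * emeasure (\<kappa>1 x0 (e (x n))) B \<partial>\<mu>)"
      by (intro nn_integral_cong) (simp add: iC P_Suc)
    finally show ?thesis .
  qed
  have \<kappa>1_AE: "AE w in \<nu>. \<kappa>1 x0 w = \<kappa> w"
    using total by eventually_elim (simp add: \<kappa>1_def)
  have distr: "distr \<mu> X (\<lambda>x. x n) = Q" for n
  proof (induction n)
    case 0
    show ?case
    proof (rule measure_eqI)
      fix B assume "B \<in> sets (distr \<mu> X (\<lambda>x. x 0))"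
      then have B[measurable]: "B \<in> sets X" by simp
      have "emeasure (distr \<mu> X (\<lambda>x. x 0)) B = (\<integral>\<^sup>+x. indicator B x \<partial>distr \<mu> X (\<lambda>x. x 0))" by simp
      also have "\<dots> = (\<integral>\<^sup>+x. indicator (space (?PM 0)) (?R 0 x) * indicator B (x 0) \<partial>\<mu>)"
        by (subst nn_integral_distr) (auto simp: space_PiM restrict_def)
      also have "\<dots> = (\<integral>\<^sup>+x. emeasure Q B \<partial>\<mu>)"
        unfolding main[OF sets.top B] P_0 by (simp add: space_PiM restrict_def)
      finally show "emeasure (distr \<mu> X (\<lambda>x. x 0)) B = emeasure Q B" by (simp add: mu.emeasure_space_1)
    qed (simp add: sets_Q)
  next
    case (Suc n)
    show ?case
    proof (rule measure_eqI)
      fix B assume "B \<in> sets (distr \<mu> X (\<lambda>x. x (Suc n)))"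
      then have B[measurable]: "B \<in> sets X" by simp
      have [measurable]: "(\<lambda>w. emeasure (\<kappa>1 x0 w) B) \<in> borel_measurable \<nu>"
        by (rule measurable_emeasure_kernel[OF k1 B])
      have "emeasure (distr \<mu> X (\<lambda>x. x (Suc n))) B = (\<integral>\<^sup>+x. indicator B x \<partial>distr \<mu> X (\<lambda>x. x (Suc n)))" by simp
      also have "\<dots> = (\<integral>\<^sup>+x. indicator (space (history X n)) x * indicator B (x (Suc n)) \<partial>\<mu>)"
        by (subst nn_integral_distr) (auto intro!: nn_integral_cong simp: space_mu)
      also have "\<dots> = (\<integral>\<^sup>+x. emeasure (\<kappa>1 x0 (e (x n))) B \<partial>\<mu>)"
        unfolding law1[OF sets.top B] by (intro nn_integral_cong) (auto simp: space_mu)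
      also have "\<dots> = (\<integral>\<^sup>+x. emeasure (\<kappa>1 x0 (e x)) B \<partial>distr \<mu> X (\<lambda>x. x n))"
        by (subst nn_integral_distr) auto
      also have "\<dots> = (\<integral>\<^sup>+w. emeasure (\<kappa>1 x0 w) B \<partial>\<nu>)"
        unfolding Suc by (rule nn_integral_Q_e) simp
      also have "\<dots> = (\<integral>\<^sup>+w. emeasure (\<kappa> w) B \<partial>\<nu>)"
        by (rule nn_integral_cong_AE) (use \<kappa>1_AE in auto)
      also have "\<dots> = emeasure Q B"
        by (rule emeasure_bind[symmetric, OF _ \<kappa>]) (auto simp: nu.not_empty)
      finally show "emeasure (distr \<mu> X (\<lambda>x. x (Suc n))) B = emeasure Q B" .
    qed (simp add: sets_Q)
  qed
  have "is_law \<mu>"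
  proof (rule markov_chain_lawI[OF \<kappa>e mu.prob_space_axioms sets_mu distr])
    fix n B C assume B: "B \<in> sets X" and C: "C \<in> sets (history X n)"
    have "distr \<mu> \<nu> (\<lambda>x. e (x n)) = distr (distr \<mu> X (\<lambda>x. x n)) \<nu> e"
      by (subst distr_distr) (auto simp: comp_def)
    then have d: "distr \<mu> \<nu> (\<lambda>x. e (x n)) = \<nu>" by (simp only: distr distr_Q)
    have "AE x in \<mu>. \<kappa>1 x0 (e (x n)) = \<kappa> (e (x n))"
      by (rule AE_distrD[of "\<lambda>x. e (x n)" \<mu> \<nu>]) (simp_all only: d \<kappa>1_AE, measurable)
    then show "(\<integral>\<^sup>+x. indicator C x * indicator B (x (Suc n)) \<partial>\<mu>) = (\<integral>\<^sup>+x. indicator C x * emeasure (\<kappa> (e (x n))) B \<partial>\<mu>)"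
      unfolding law1[OF C B] by (intro nn_integral_cong_AE) auto
  qed
  then show ?thesis ..
qed

end

section \<open>Regeneration of the quenched process\<close>

abbreviation fwd :: "nat \<Rightarrow> (int \<Rightarrow> 's) \<Rightarrow> (int \<Rightarrow> 's)" where "fwd n \<equiv> env_shift (int n)"
abbreviation bwd :: "nat \<Rightarrow> (int \<Rightarrow> 's) \<Rightarrow> (int \<Rightarrow> 's)" where "bwd n \<equiv> env_shift (- int n)"

section \<open>Splicing independent samples\<close>

lemma nn_integral_pair_times:
  assumes "prob_space M" "prob_space N"
    and [measurable]: "f \<in> borel_measurable M" "g \<in> borel_measurable N"
  shows "(\<integral>\<^sup>+z. f (fst z) * g (snd z) \<partial>(M \<Otimes>\<^sub>M N)) = (\<integral>\<^sup>+x. f x \<partial>M) * (\<integral>\<^sup>+y. g y \<partial>N)"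
proof -
  interpret N: prob_space N by fact
  have "(\<integral>\<^sup>+z. f (fst z) * g (snd z) \<partial>(M \<Otimes>\<^sub>M N)) = (\<integral>\<^sup>+x. \<integral>\<^sup>+y. f x * g y \<partial>N \<partial>M)"
    by (subst N.nn_integral_fst[symmetric]) auto
  then show ?thesis by (simp add: nn_integral_cmult nn_integral_multc)
qed

text \<open>The quenched law is a product of an immigration part and an offspring part; this
  rearrangement allows them to be spliced separately.\<close>

lemma distr_pair_interchange:
  assumes pr: "prob_space A" "prob_space B" "prob_space A'" "prob_space B'"
    and f[measurable]: "f \<in> A \<Otimes>\<^sub>M A' \<rightarrow>\<^sub>M C" and g[measurable]: "g \<in> B \<Otimes>\<^sub>M B' \<rightarrow>\<^sub>M D"
  shows "distr ((A \<Otimes>\<^sub>M B) \<Otimes>\<^sub>M (A' \<Otimes>\<^sub>M B')) (C \<Otimes>\<^sub>M D)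
      (\<lambda>z. (f (fst (fst z), fst (snd z)), g (snd (fst z), snd (snd z)))) =
    distr (A \<Otimes>\<^sub>M A') C f \<Otimes>\<^sub>M distr (B \<Otimes>\<^sub>M B') D g" (is "distr ?M _ ?h = _")
proof -
  interpret A: prob_space A by fact
  interpret B: prob_space B by fact
  interpret A': prob_space A' by fact
  interpret B': prob_space B' by fact
  interpret AA: pair_prob_space A A' ..
  interpret BB: pair_prob_space B B' ..
  interpret AB: pair_prob_space A B ..
  interpret AB': pair_prob_space A' B' ..
  have fg: "prob_space (distr (A \<Otimes>\<^sub>M A') C f)" "prob_space (distr (B \<Otimes>\<^sub>M B') D g)"
    by (auto intro: AA.P.prob_space_distr BB.P.prob_space_distr)
  have "distr (A \<Otimes>\<^sub>M A') C f \<Otimes>\<^sub>M distr (B \<Otimes>\<^sub>M B') D g = distr ?M (C \<Otimes>\<^sub>M D) ?h"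
  proof (rule pair_measure_eqI)
    fix X Y assume "X \<in> sets (distr (A \<Otimes>\<^sub>M A') C f)" "Y \<in> sets (distr (B \<Otimes>\<^sub>M B') D g)"
    then have [measurable]: "X \<in> sets C" "Y \<in> sets D" by auto
    define F :: "_ \<Rightarrow> ennreal" where "F z = indicator X (f z)" for z
    define G :: "_ \<Rightarrow> ennreal" where "G z = indicator Y (g z)" for z
    have [measurable]: "F \<in> borel_measurable (A \<Otimes>\<^sub>M A')" "G \<in> borel_measurable (B \<Otimes>\<^sub>M B')"
      unfolding F_def[abs_def] G_def[abs_def] by measurable
    have "emeasure (distr ?M (C \<Otimes>\<^sub>M D) ?h) (X \<times> Y) = (\<integral>\<^sup>+z. indicator (X \<times> Y) z \<partial>distr ?M (C \<Otimes>\<^sub>M D) ?h)"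
      by simp
    also have "\<dots> = (\<integral>\<^sup>+z. F (fst (fst z), fst (snd z)) * G (snd (fst z), snd (snd z)) \<partial>?M)"
      by (subst nn_integral_distr) (auto simp: F_def G_def indicator_times)
    also have "\<dots> = (\<integral>\<^sup>+z. \<integral>\<^sup>+u. F (fst z, fst u) * G (snd z, snd u) \<partial>(A' \<Otimes>\<^sub>M B') \<partial>(A \<Otimes>\<^sub>M B))"
      by (subst AB'.P.nn_integral_fst[symmetric]) auto
    also have "\<dots> = (\<integral>\<^sup>+z. (\<integral>\<^sup>+x. F (fst z, x) \<partial>A') * (\<integral>\<^sup>+y. G (snd z, y) \<partial>B') \<partial>(A \<Otimes>\<^sub>M B))"
      by (intro nn_integral_cong nn_integral_pair_times pr) (auto simp: space_pair_measure)
    also have "\<dots> = (\<integral>\<^sup>+z. \<integral>\<^sup>+x. F (z, x) \<partial>A' \<partial>A) * (\<integral>\<^sup>+z. \<integral>\<^sup>+y. G (z, y) \<partial>B' \<partial>B)"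
      by (rule nn_integral_pair_times[OF pr(1,2)]) measurable
    also have "\<dots> = (\<integral>\<^sup>+z. F z \<partial>(A \<Otimes>\<^sub>M A')) * (\<integral>\<^sup>+z. G z \<partial>(B \<Otimes>\<^sub>M B'))"
      by (simp add: A'.nn_integral_fst B'.nn_integral_fst)
    also have "(\<integral>\<^sup>+z. F z \<partial>(A \<Otimes>\<^sub>M A')) = (\<integral>\<^sup>+z. indicator X z \<partial>distr (A \<Otimes>\<^sub>M A') C f)"
      unfolding F_def by (rule nn_integral_distr[symmetric]) auto
    also have "(\<integral>\<^sup>+z. G z \<partial>(B \<Otimes>\<^sub>M B')) = (\<integral>\<^sup>+z. indicator Y z \<partial>distr (B \<Otimes>\<^sub>M B') D g)"
      unfolding G_def by (rule nn_integral_distr[symmetric]) auto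
    finally show "emeasure (distr (A \<Otimes>\<^sub>M A') C f) X * emeasure (distr (B \<Otimes>\<^sub>M B') D g) Y =
        emeasure (distr ?M (C \<Otimes>\<^sub>M D) ?h) (X \<times> Y)" by simp
  next
    show "sets (distr (A \<Otimes>\<^sub>M A') C f \<Otimes>\<^sub>M distr (B \<Otimes>\<^sub>M B') D g) = sets (distr ?M (C \<Otimes>\<^sub>M D) ?h)"
      unfolding sets_distr by (intro sets_pair_measure_cong sets_distr)
  qed (rule fg[THEN prob_space_imp_sigma_finite])+
  then show ?thesis by simp
qed

text \<open>Coordinates are independent, so those outside \<open>s\<close> may be taken from an
  independent product with matching marginals; injectivity of \<open>t\<close> prevents a coordinate
  from being used twice.\<close>

lemma distr_PiM_splice:
  fixes M :: "'i \<Rightarrow> 'a measure" and N :: "'k \<Rightarrow> 'a measure"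
  assumes M: "\<And>i. prob_space (M i)" and N: "\<And>k. prob_space (N k)"
    and t: "inj_on t {i. \<not> s i}" and MN: "\<And>i. \<not> s i \<Longrightarrow> N (t i) = M i"
  shows "(\<lambda>z i. if s i then fst z i else snd z (t i)) \<in> Pi\<^sub>M UNIV M \<Otimes>\<^sub>M Pi\<^sub>M UNIV N \<rightarrow>\<^sub>M Pi\<^sub>M UNIV M" (is ?m)
    and "distr (Pi\<^sub>M UNIV M \<Otimes>\<^sub>M Pi\<^sub>M UNIV N) (Pi\<^sub>M UNIV M) (\<lambda>z i. if s i then fst z i else snd z (t i)) =
      Pi\<^sub>M UNIV M" (is "distr ?P _ ?f = _")
proof -
  interpret M: product_prob_space M UNIV
    by (simp add: product_prob_space_def product_sigma_finite_def product_prob_space_axioms_def M prob_space_imp_sigma_finite)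
  interpret N: product_prob_space N UNIV
    by (simp add: product_prob_space_def product_sigma_finite_def product_prob_space_axioms_def N prob_space_imp_sigma_finite)
  have comp: "(\<lambda>z. if s i then fst z i else snd z (t i)) \<in> ?P \<rightarrow>\<^sub>M M i" for i
  proof (cases "s i")
    case False
    have "(\<lambda>z. snd z (t i)) \<in> ?P \<rightarrow>\<^sub>M N (t i)" by measurable
    then show ?thesis using False MN by simp
  qed simp
  show m: ?m
  proof (rule measurable_PiM_single')
    show "(\<lambda>z i. if s i then fst z i else snd z (t i)) \<in> space ?P \<rightarrow> (\<Pi>\<^sub>E i\<in>UNIV. space (M i))"
      using measurable_space[OF comp] by auto
  qed (rule comp)
  show "distr ?P (Pi\<^sub>M UNIV M) ?f = Pi\<^sub>M UNIV M"
  proof (rule M.PiM_eq)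
    fix J F assume J: "finite J" "J \<subseteq> UNIV" and F: "\<And>j. j \<in> J \<Longrightarrow> F j \<in> sets (M j)"
    let ?J1 = "{j \<in> J. s j}" and ?J2 = "{j \<in> J. \<not> s j}"
    let ?E1 = "prod_emb UNIV M ?J1 (Pi\<^sub>E ?J1 F)"
    have t2: "inj_on t ?J2" by (rule inj_on_subset[OF t]) auto
    define F' where "F' k = F (the_inv_into ?J2 t k)" for k
    have F': "F' (t j) = F j" if "j \<in> ?J2" for j
      unfolding F'_def using the_inv_into_f_f[OF t2 that] by simp
    let ?E2 = "prod_emb UNIV N (t ` ?J2) (Pi\<^sub>E (t ` ?J2) F')"
    have F'': "F' k \<in> sets (N k)" if "k \<in> t ` ?J2" for k
      using that F' F MN by fastforce
    have E1: "?E1 \<in> sets (Pi\<^sub>M UNIV M)" and E2: "?E2 \<in> sets (Pi\<^sub>M UNIV N)"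
      using J F F'' by (auto intro!: sets_PiM_I)
    have "?f -` prod_emb UNIV M J (Pi\<^sub>E J F) \<inter> space ?P = ?E1 \<times> ?E2"
      using measurable_space[OF comp]
      by (auto simp: prod_emb_def space_pair_measure space_PiM PiE_iff F' split: if_splits)
    then have "emeasure (distr ?P (Pi\<^sub>M UNIV M) ?f) (prod_emb UNIV M J (Pi\<^sub>E J F)) = emeasure ?P (?E1 \<times> ?E2)"
      using J F by (subst emeasure_distr[OF m]) (auto intro!: sets_PiM_I)
    also have "\<dots> = emeasure (Pi\<^sub>M UNIV M) ?E1 * emeasure (Pi\<^sub>M UNIV N) ?E2"
      by (rule N.P.emeasure_pair_measure_Times[OF E1 E2])
    also have "emeasure (Pi\<^sub>M UNIV M) ?E1 = (\<Prod>j\<in>?J1. emeasure (M j) (F j))"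
      using J F by (intro M.emeasure_PiM_emb) auto
    also have "emeasure (Pi\<^sub>M UNIV N) ?E2 = (\<Prod>k\<in>t ` ?J2. emeasure (N k) (F' k))"
      using J F'' by (intro N.emeasure_PiM_emb) auto
    also have "\<dots> = (\<Prod>j\<in>?J2. emeasure (M j) (F j))"
      by (subst prod.reindex[OF t2]) (auto intro!: prod.cong simp: F' MN)
    also have "(\<Prod>j\<in>?J1. emeasure (M j) (F j)) * (\<Prod>j\<in>?J2. emeasure (M j) (F j)) = (\<Prod>j\<in>J. emeasure (M j) (F j))"
      using J by (subst prod.union_disjoint[symmetric]) (auto intro!: prod.cong)
    finally show "emeasure (distr ?P (Pi\<^sub>M UNIV M) ?f) (prod_emb UNIV M J (Pi\<^sub>E J F)) = (\<Prod>j\<in>J. emeasure (M j) (F j))" .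
  qed simp
qed

text \<open>Generation \<open>j\<close> of the result is generation 0 of the second sample. With
  \<open>splice_quenched\<close> this is the Markov property of the quenched process at time
  \<open>j\<close> in pathwise form.\<close>

definition splice_at :: "nat \<Rightarrow> 'd::finite sample \<times> 'd sample \<Rightarrow> 'd sample" where
  "splice_at j z = (\<lambda>n. if n < j then fst (fst z) n else fst (snd z) (n - j),
     \<lambda>k. if fst k < j then snd (fst z) k else snd (snd z) (fst k - j, snd k))"

lemma immigrants_splice: "immigrants (splice_at j (\<xi>, \<xi>')) n = (if n < j then immigrants \<xi> n else immigrants \<xi>' (n - j))"
  and offspring_splice: "offspring (splice_at j (\<xi>, \<xi>')) n m i = (if n < j then offspring \<xi> n m i else offspring \<xi>' (n - j) m i)"
  by (simp_all add: immigrants_def offspring_def splice_at_def)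

text \<open>The marginals match because \<open>fwd j w\<close> at \<open>n - j\<close> is
  \<open>w\<close> at \<open>n\<close>; for immigration both indices are lowered by one.\<close>

lemma splice_quenched:
  fixes q :: "'s \<Rightarrow> (nat^'d::finite) pmf"
  shows "splice_at j \<in> quenched q p w \<Otimes>\<^sub>M quenched q p (fwd j w) \<rightarrow>\<^sub>M quenched q p w" (is ?m)
    and "distr (quenched q p w \<Otimes>\<^sub>M quenched q p (fwd j w)) (quenched q p w) (splice_at j) = quenched q p w"
      (is ?d)
proof -
  let ?A = "\<lambda>w n. measure_pmf (q (w (int n - 1)))"
  let ?B = "\<lambda>w k. measure_pmf (p (snd (snd k)) (w (int (fst k)))) :: (nat^'d) measure"
  have qe: "quenched q p w = Pi\<^sub>M UNIV (?A w) \<Otimes>\<^sub>M Pi\<^sub>M UNIV (?B w)" for w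
    by (simp add: quenched_def split_def)
  let ?w = "fwd j w"
  let ?f = "\<lambda>z n. if n < j then fst z n else snd z (n - j)"
  let ?g = "\<lambda>z k. if fst k < j then fst z k else snd z (fst k - j, snd k)"
  have f: "?f \<in> Pi\<^sub>M UNIV (?A w) \<Otimes>\<^sub>M Pi\<^sub>M UNIV (?A ?w) \<rightarrow>\<^sub>M Pi\<^sub>M UNIV (?A w)"
    "distr (Pi\<^sub>M UNIV (?A w) \<Otimes>\<^sub>M Pi\<^sub>M UNIV (?A ?w)) (Pi\<^sub>M UNIV (?A w)) ?f = Pi\<^sub>M UNIV (?A w)"
    by (rule distr_PiM_splice; auto simp: inj_on_def env_shift_def of_nat_diff prob_space_measure_pmf)+
  have g: "?g \<in> Pi\<^sub>M UNIV (?B w) \<Otimes>\<^sub>M Pi\<^sub>M UNIV (?B ?w) \<rightarrow>\<^sub>M Pi\<^sub>M UNIV (?B w)"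
    "distr (Pi\<^sub>M UNIV (?B w) \<Otimes>\<^sub>M Pi\<^sub>M UNIV (?B ?w)) (Pi\<^sub>M UNIV (?B w)) ?g = Pi\<^sub>M UNIV (?B w)"
    by (rule distr_PiM_splice; auto simp: inj_on_def env_shift_def of_nat_diff prob_space_measure_pmf)+
  have sp: "splice_at j = (\<lambda>z. (?f (fst (fst z), fst (snd z)), ?g (snd (fst z), snd (snd z))))"
    by (simp add: splice_at_def fun_eq_iff)
  note [measurable] = f(1) g(1)
  show ?m unfolding qe sp by measurable
  show ?d unfolding qe sp
    by (subst distr_pair_interchange[OF _ _ _ _ f(1) g(1)])
      (auto simp: f(2) g(2) intro!: prob_space_PiM prob_space_measure_pmf)
qed

lemma nn_integral_quenched_splice':
  assumes H[measurable]: "H \<in> borel_measurable sample_space"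
  shows "(\<integral>\<^sup>+\<xi>. H \<xi> \<partial>quenched q p w) =
    (\<integral>\<^sup>+\<xi>. \<integral>\<^sup>+\<xi>'. H (splice_at j (\<xi>, \<xi>')) \<partial>quenched q p (fwd j w) \<partial>quenched q p w)"
proof -
  interpret prob_space "quenched q p (fwd j w)" by (rule prob_space_quenched)
  have m: "H \<in> borel_measurable (quenched q p w)"
    using H by (simp add: sets_quenched cong: measurable_cong_sets)
  have "(\<integral>\<^sup>+\<xi>. H \<xi> \<partial>quenched q p w) = (\<integral>\<^sup>+z. H (splice_at j z) \<partial>(quenched q p w \<Otimes>\<^sub>M quenched q p (fwd j w)))"
    by (subst (1) splice_quenched(2)[symmetric, of q p w j], rule nn_integral_distr[OF splice_quenched(1)]) (simp add: m)
  then show ?thesis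
    using nn_integral_fst[OF measurable_compose[OF splice_quenched(1) m]] by simp
qed

lemma nn_integral_quenched_splice:
  assumes H: "H \<in> borel_measurable sample_space" and F: "F \<in> borel_measurable sample_space"
    and G: "G \<in> borel_measurable sample_space"
    and eq: "\<And>\<xi> \<xi>'. H (splice_at j (\<xi>, \<xi>')) = F \<xi> * G \<xi>'"
  shows "(\<integral>\<^sup>+\<xi>. H \<xi> \<partial>quenched q p w) = (\<integral>\<^sup>+\<xi>. F \<xi> \<partial>quenched q p w) * (\<integral>\<^sup>+\<xi>. G \<xi> \<partial>quenched q p (fwd j w))"
proof -
  have m: "f \<in> borel_measurable (quenched q p w)" if "f \<in> borel_measurable sample_space" for f :: "_ \<Rightarrow> ennreal" and w
    using that by (simp add: sets_quenched cong: measurable_cong_sets)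
  show ?thesis
    unfolding nn_integral_quenched_splice'[OF H, of q p w j] eq
    by (simp add: nn_integral_cmult nn_integral_multc m F G)
qed

lemma Z_splice_le: "n \<le> j \<Longrightarrow> Z z (splice_at j (\<xi>, \<xi>')) n = Z z \<xi> n"
  by (induction n) (auto simp: immigrants_splice offspring_splice)

text \<open>Once \<open>Z z \<xi> j\<close> is 0, the right-hand side no longer involves the first
  sample; this is what makes zeros regeneration times.\<close>

lemma Z_splice_add: "Z z (splice_at j (\<xi>, \<xi>')) (j + k) = Z (Z z \<xi> j) \<xi>' k"
proof (induction k)
  case 0
  show ?case by (simp add: Z_splice_le)
next
  case (Suc k)
  then show ?case by (simp add: immigrants_splice offspring_splice)
qed

section \<open>Generating functions\<close>

text \<open>The monomial \<open>t^v\<close>. Since \<open>0 ^ 0 = 1\<close>, its value at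
  \<open>t = 0\<close> is the indicator of \<open>v = 0\<close>, so extinction probabilities are
  values of generating functions at 0.\<close>

definition vpow :: "('d::finite \<Rightarrow> ennreal) \<Rightarrow> nat^'d \<Rightarrow> ennreal" where
  "vpow t v = (\<Prod>i\<in>UNIV. t i ^ (v $ i))"

definition pgf :: "(nat^'d::finite) pmf \<Rightarrow> ('d \<Rightarrow> ennreal) \<Rightarrow> ennreal" where
  "pgf \<mu> t = (\<integral>\<^sup>+v. vpow t v \<partial>measure_pmf \<mu>)"

text \<open>die p k w i is the probability that the descendants of one individual of type i, living at time 0,
  are extinct at time k.\<close>

primrec die :: "('d::finite \<Rightarrow> 's \<Rightarrow> (nat^'d) pmf) \<Rightarrow> nat \<Rightarrow> (int \<Rightarrow> 's) \<Rightarrow> 'd \<Rightarrow> ennreal" where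
  "die p 0 w = (\<lambda>i. 0)"
| "die p (Suc k) w = (\<lambda>i. pgf (p i (w 0)) (die p k (env_shift 1 w)))"

text \<open>This is the factor a_k of the product formula, as \<open>emeasure_U_eq_0\<close> shows.
  The index -1 appears because the immigrants of time 0 have law \<open>q (w (-1))\<close>.\<close>

definition fam :: "('s \<Rightarrow> (nat^'d::finite) pmf) \<Rightarrow> ('d \<Rightarrow> 's \<Rightarrow> (nat^'d) pmf) \<Rightarrow> nat \<Rightarrow> (int \<Rightarrow> 's) \<Rightarrow> ennreal" where
  "fam q p k w = pgf (q (w (-1))) (die p k w)"

lemma vpow_add: "vpow t (v + u) = vpow t v * vpow t u"
  by (simp add: vpow_def power_add prod.distrib)

lemma vpow_0[simp]: "vpow t 0 = 1"
  by (simp add: vpow_def)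

lemma vpow_sum: "vpow t (\<Sum>x\<in>A. f x) = (\<Prod>x\<in>A. vpow t (f x))"
  by (induction A rule: infinite_finite_induct) (auto simp: vpow_add)

lemma vpow_zero: "vpow (\<lambda>_. 0) v = (if v = 0 then 1 else 0)"
  by (auto simp: vpow_def vec_eq_iff intro!: prod_zero)

lemma nn_integral_PiM_prod:
  fixes M :: "'i \<Rightarrow> 'a measure"
  assumes M: "\<And>i. prob_space (M i)" and J: "finite J" and f[measurable]: "\<And>i. i \<in> J \<Longrightarrow> f i \<in> borel_measurable (M i)"
  shows "(\<integral>\<^sup>+x. (\<Prod>i\<in>J. f i (x i)) \<partial>Pi\<^sub>M UNIV M) = (\<Prod>i\<in>J. \<integral>\<^sup>+y. f i y \<partial>M i)"
proof -
  interpret product_prob_space M UNIV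
    by (simp add: product_prob_space_def product_sigma_finite_def product_prob_space_axioms_def M prob_space_imp_sigma_finite)
  have r: "(\<lambda>x. restrict x J) \<in> Pi\<^sub>M UNIV M \<rightarrow>\<^sub>M Pi\<^sub>M J M" by (rule measurable_restrict_subset) simp
  have m: "(\<lambda>x. \<Prod>i\<in>J. f i (x i)) \<in> borel_measurable (Pi\<^sub>M J M)" by measurable
  have "(\<Prod>i\<in>J. \<integral>\<^sup>+y. f i y \<partial>M i) = (\<integral>\<^sup>+x. (\<Prod>i\<in>J. f i (x i)) \<partial>Pi\<^sub>M J M)"
    using J f by (rule product_nn_integral_prod[symmetric])
  also have "Pi\<^sub>M J M = distr (Pi\<^sub>M UNIV M) (Pi\<^sub>M J M) (\<lambda>x. restrict x J)"
    using J by (intro distr_PiM_restrict_finite[symmetric]) auto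
  also have "(\<integral>\<^sup>+x. (\<Prod>i\<in>J. f i (x i)) \<partial>\<dots>) = (\<integral>\<^sup>+x. (\<Prod>i\<in>J. f i (x i)) \<partial>Pi\<^sub>M UNIV M)"
    by (subst nn_integral_distr[OF r]) (auto simp: m intro!: nn_integral_cong prod.cong)
  finally show ?thesis by simp
qed

abbreviation imm_law :: "('s \<Rightarrow> (nat^'d::finite) pmf) \<Rightarrow> (int \<Rightarrow> 's) \<Rightarrow> (nat \<Rightarrow> nat^'d) measure" where
  "imm_law q w \<equiv> Pi\<^sub>M UNIV (\<lambda>n. measure_pmf (q (w (int n - 1))))"

abbreviation off_law :: "('d::finite \<Rightarrow> 's \<Rightarrow> (nat^'d) pmf) \<Rightarrow> (int \<Rightarrow> 's) \<Rightarrow> (nat \<times> nat \<times> 'd \<Rightarrow> nat^'d) measure" where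
  "off_law p w \<equiv> Pi\<^sub>M UNIV (\<lambda>k. measure_pmf (p (snd (snd k)) (w (int (fst k)))))"

lemma quenched_pair: "quenched q p w = imm_law q w \<Otimes>\<^sub>M off_law p w"
  by (simp add: quenched_def split_def)

lemma prob_space_imm_law: "prob_space (imm_law q w)"
  and prob_space_off_law: "prob_space (off_law p w)"
  by (auto intro!: prob_space_PiM prob_space_measure_pmf)

lemma measurable_quenched_iff: "f \<in> quenched q p w \<rightarrow>\<^sub>M N \<longleftrightarrow> f \<in> sample_space \<rightarrow>\<^sub>M N"
  by (simp cong: measurable_cong_sets add: sets_quenched)

lemma nn_integral_imm_law:
  "(\<integral>\<^sup>+x. f (x 0) \<partial>imm_law q w) = (\<integral>\<^sup>+v. f v \<partial>measure_pmf (q (w (-1))))"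
  using nn_integral_PiM_prod[of "\<lambda>n. measure_pmf (q (w (int n - 1)))" "{0::nat}" "\<lambda>_. f"]
  by (simp add: prob_space_measure_pmf)

text \<open>Offspring vectors are independent, so the generating function of their sum is a
  composition: each parent of type \<open>i\<close> contributes one factor
  \<open>pgf (p i (w 0)) t\<close>.\<close>

lemma nn_integral_off_law:
  "(\<integral>\<^sup>+y. vpow t (\<Sum>i\<in>UNIV. \<Sum>m = 1..v $ i. y (0, m, i)) \<partial>off_law p w) =
    vpow (\<lambda>i. pgf (p i (w 0)) t) v"
proof -
  let ?J = "Sigma UNIV (\<lambda>i. {1..v $ i})"
  let ?K = "(\<lambda>(i, m). (0::nat, m::nat, i)) ` ?J"
  have inj: "inj_on (\<lambda>(i, m). (0::nat, m::nat, i)) ?J" by (auto simp: inj_on_def)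
  have "vpow t (\<Sum>i\<in>UNIV. \<Sum>m = 1..v $ i. y (0, m, i)) = (\<Prod>k\<in>?K. vpow t (y k))" for y
    unfolding vpow_sum by (subst prod.reindex[OF inj]) (simp add: prod.Sigma split_def)
  then have "(\<integral>\<^sup>+y. vpow t (\<Sum>i\<in>UNIV. \<Sum>m = 1..v $ i. y (0, m, i)) \<partial>off_law p w) =
      (\<integral>\<^sup>+y. (\<Prod>k\<in>?K. vpow t (y k)) \<partial>off_law p w)" by simp
  also have "\<dots> = (\<Prod>k\<in>?K. \<integral>\<^sup>+u. vpow t u \<partial>measure_pmf (p (snd (snd k)) (w (int (fst k)))))"
    by (intro nn_integral_PiM_prod prob_space_measure_pmf) auto
  also have "\<dots> = (\<Prod>z\<in>?J. pgf (p (fst z) (w 0)) t)"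
    by (subst prod.reindex[OF inj]) (simp add: pgf_def split_def)
  also have "\<dots> = (\<Prod>i\<in>UNIV. \<Prod>m\<in>{1..v $ i}. pgf (p i (w 0)) t)"
    by (subst prod.Sigma) (simp_all add: split_def)
  finally show ?thesis by (simp add: vpow_def)
qed

lemma measurable_offspring_sum:
  "(\<lambda>z. vpow t (\<Sum>i\<in>UNIV. \<Sum>m = 1..(u + fst z 0) $ i. snd z (0, m, i))) \<in> borel_measurable (sample_space :: 'd::finite sample measure)"
proof -
  have "(\<lambda>z. Z u z 1) \<in> (sample_space :: 'd sample measure) \<rightarrow>\<^sub>M count_space UNIV" by (rule measurable_Z)
  from measurable_compose[OF this, of "vpow t"]
  show ?thesis by (simp add: immigrants_def offspring_def)
qed

lemma nn_integral_vpow_Z1: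
  "(\<integral>\<^sup>+\<xi>. vpow t (Z v \<xi> 1) \<partial>quenched q p w) =
    vpow (\<lambda>i. pgf (p i (w 0)) t) v * pgf (q (w (-1))) (\<lambda>i. pgf (p i (w 0)) t)"
proof -
  interpret O: prob_space "off_law p w" by (rule prob_space_off_law)
  let ?G = "\<lambda>i. pgf (p i (w 0)) t"
  have m: "(\<lambda>z. vpow t (\<Sum>i\<in>UNIV. \<Sum>m = 1..(v + fst z 0) $ i. snd z (0, m, i))) \<in> borel_measurable (imm_law q w \<Otimes>\<^sub>M off_law p w)"
    unfolding quenched_pair[symmetric] measurable_quenched_iff by (rule measurable_offspring_sum)
  have "(\<integral>\<^sup>+\<xi>. vpow t (Z v \<xi> 1) \<partial>quenched q p w) =
      (\<integral>\<^sup>+z. vpow t (\<Sum>i\<in>UNIV. \<Sum>m = 1..(v + fst z 0) $ i. snd z (0, m, i)) \<partial>(imm_law q w \<Otimes>\<^sub>M off_law p w))"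
    by (simp add: quenched_pair immigrants_def offspring_def)
  also have "\<dots> = (\<integral>\<^sup>+x. \<integral>\<^sup>+y. vpow t (\<Sum>i\<in>UNIV. \<Sum>m = 1..(v + x 0) $ i. y (0, m, i)) \<partial>off_law p w \<partial>imm_law q w)"
    using O.nn_integral_fst[OF m] by simp
  also have "\<dots> = (\<integral>\<^sup>+x. vpow ?G v * vpow ?G (x 0) \<partial>imm_law q w)"
    unfolding nn_integral_off_law vpow_add ..
  also have "\<dots> = (\<integral>\<^sup>+u. vpow ?G v * vpow ?G u \<partial>measure_pmf (q (w (-1))))"
    by (rule nn_integral_imm_law)
  also have "\<dots> = vpow ?G v * pgf (q (w (-1))) ?G"
    unfolding pgf_def[of "q (w (-1))"] by (rule nn_integral_cmult) simp
  finally show ?thesis .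
qed

lemma env_shift_0[simp]: "env_shift 0 = (\<lambda>w. w)"
  by (simp add: env_shift_def fun_eq_iff)

lemma env_shift_env_shift: "env_shift a (env_shift b w) = env_shift (a + b) w"
  by (simp add: env_shift_def add.commute add.left_commute)

text \<open>Being at 0 at time \<open>n\<close> means that the families of the initial individuals
  and of the immigrants of all times \<open>i < n\<close> have died out, the latter within
  \<open>n - i\<close> generations. The induction splits off the first generation, which changes
  both the starting vector and the environment.\<close>

lemma emeasure_Z_eq_0:
  "emeasure (quenched q p w) {\<xi>. Z v \<xi> n = 0} = vpow (die p n w) v * (\<Prod>i<n. fam q p (n - i) (fwd i w))"
proof (induction n arbitrary: v w)
  case 0
  interpret prob_space "quenched q p w" by (rule prob_space_quenched)
  show ?case using emeasure_space_1 by (auto simp: vpow_zero space_quenched)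
next
  case (Suc n)
  have s: "{\<xi>. Z u \<xi> k = 0} \<in> sets (quenched q p w)" for u k w
  proof -
    have "{\<xi> \<in> space sample_space. Z u \<xi> k = 0} \<in> sets sample_space" by measurable
    then show ?thesis by (simp add: sets_quenched space_pair_measure space_PiM)
  qed
  let ?w = "env_shift 1 w"
  define c where "c = (\<Prod>i<n. fam q p (n - i) (fwd i ?w))"
  have "emeasure (quenched q p w) {\<xi>. Z v \<xi> (Suc n) = 0} = (\<integral>\<^sup>+\<xi>. indicator {\<xi>. Z v \<xi> (Suc n) = 0} \<xi> \<partial>quenched q p w)"
    by (rule nn_integral_indicator[symmetric, OF s])
  also have "\<dots> = (\<integral>\<^sup>+\<xi>. \<integral>\<^sup>+\<xi>'. indicator {\<xi>. Z v \<xi> (Suc n) = 0} (splice_at 1 (\<xi>, \<xi>')) \<partial>quenched q p ?w \<partial>quenched q p w)"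
    using nn_integral_quenched_splice'[of "indicator {\<xi>. Z v \<xi> (Suc n) = 0}" q p w 1] s[of v "Suc n"]
    by (simp add: sets_quenched)
  also have "\<dots> = (\<integral>\<^sup>+\<xi>. emeasure (quenched q p ?w) {\<xi>'. Z (Z v \<xi> 1) \<xi>' n = 0} \<partial>quenched q p w)"
    using Z_splice_add[of v 1 _ _ n]
    by (intro nn_integral_cong) (auto simp: s nn_integral_indicator[symmetric] indicator_def simp del: nn_integral_indicator Z.simps intro!: nn_integral_cong)
  also have "\<dots> = (\<integral>\<^sup>+\<xi>. vpow (die p n ?w) (Z v \<xi> 1) * c \<partial>quenched q p w)"
    unfolding Suc c_def ..
  also have "\<dots> = (\<integral>\<^sup>+\<xi>. vpow (die p n ?w) (Z v \<xi> 1) \<partial>quenched q p w) * c"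
    by (rule nn_integral_multc) (auto simp: measurable_quenched_iff simp del: Z.simps intro: measurable_compose[OF measurable_Z])
  also have "\<dots> = vpow (die p (Suc n) w) v * fam q p (Suc n) w * c"
    unfolding nn_integral_vpow_Z1 by (simp add: fam_def)
  also have "\<dots> = vpow (die p (Suc n) w) v * (\<Prod>i<Suc n. fam q p (Suc n - i) (fwd i w))"
    unfolding prod.lessThan_Suc_shift c_def by (simp add: env_shift_env_shift add.commute mult.assoc)
  finally show ?case .
qed

text \<open>Family 0 is numbered first in every generation, so its members carry the labels from 1
  on, exactly as in a process that receives no immigrants after time 0.\<close>

lemma U_0_eq_Z: "U \<xi> k 0 = Z (immigrants \<xi> 0) (\<lambda>_. 0, snd \<xi>) k"
proof (induction k)
  case (Suc k)
  show ?case by (simp add: Suc immigrants_def offspring_def atLeastSucAtMost_greaterThanAtMost)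
qed simp

text \<open>For the immigration law concentrated at 0 the family factors in
  \<open>emeasure_Z_eq_0\<close> are 1, and the immigration vectors vanish almost surely; only the
  offspring part remains.\<close>

lemma nn_integral_off_law_Z:
  fixes p :: "'d::finite \<Rightarrow> 's \<Rightarrow> (nat^'d) pmf"
  shows "(\<integral>\<^sup>+y. indicator {y. Z v (\<lambda>_. 0, y) k = 0} y \<partial>off_law p w) = vpow (die p k w) v"
proof -
  let ?q = "\<lambda>_ :: 's. return_pmf (0 :: nat^'d)"
  let ?H = "\<lambda>z. indicator {\<xi>. Z v \<xi> k = 0} z :: ennreal"
  interpret O: prob_space "off_law p w" by (rule prob_space_off_law)
  interpret I: prob_space "imm_law ?q w" by (rule prob_space_imm_law)
  have "{\<xi> \<in> space sample_space. Z v \<xi> k = 0} \<in> sets sample_space" by measurable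
  then have s: "{\<xi>. Z v \<xi> k = 0} \<in> sets (quenched q p w)" for q
    by (simp add: sets_quenched space_pair_measure space_PiM)
  then have m: "?H \<in> borel_measurable (imm_law ?q w \<Otimes>\<^sub>M off_law p w)"
    unfolding quenched_pair[symmetric] by measurable
  have "fam ?q p j w' = 1" for j w'
    by (simp add: fam_def pgf_def)
  then have "vpow (die p k w) v = emeasure (quenched ?q p w) {\<xi>. Z v \<xi> k = 0}"
    by (simp add: emeasure_Z_eq_0)
  also have "\<dots> = (\<integral>\<^sup>+z. ?H z \<partial>(imm_law ?q w \<Otimes>\<^sub>M off_law p w))"
    using s[of ?q] by (simp add: quenched_pair)
  also have "\<dots> = (\<integral>\<^sup>+x. \<integral>\<^sup>+y. ?H (x, y) \<partial>off_law p w \<partial>imm_law ?q w)"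
    by (rule O.nn_integral_fst[symmetric, OF m])
  also have "\<dots> = (\<integral>\<^sup>+x. \<integral>\<^sup>+y. ?H (\<lambda>_. 0, y) \<partial>off_law p w \<partial>imm_law ?q w)"
  proof (rule nn_integral_cong_AE)
    have "AE x in imm_law ?q w. \<forall>n. x n = 0"
      unfolding AE_all_countable by (intro allI AE_PiM_component prob_space_measure_pmf) (auto simp: AE_measure_pmf_iff)
    then show "AE x in imm_law ?q w. (\<integral>\<^sup>+y. ?H (x, y) \<partial>off_law p w) = (\<integral>\<^sup>+y. ?H (\<lambda>_. 0, y) \<partial>off_law p w)"
      by eventually_elim (auto simp: fun_eq_iff[symmetric] intro!: nn_integral_cong arg_cong[where f = ?H])
  qed
  also have "\<dots> = (\<integral>\<^sup>+y. indicator {y. Z v (\<lambda>_. 0, y) k = 0} y \<partial>off_law p w)"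
    by (simp add: I.emeasure_space_1 indicator_def)
  finally show ?thesis by simp
qed

lemma emeasure_U_eq_0: "emeasure (quenched q p w) {\<xi>. U \<xi> k 0 = 0} = fam q p k w"
proof -
  interpret O: prob_space "off_law p w" by (rule prob_space_off_law)
  have "{\<xi> \<in> space sample_space. U \<xi> k 0 = 0} \<in> sets sample_space"
    using measurable_U by measurable
  then have s: "{\<xi>. U \<xi> k 0 = 0} \<in> sets (imm_law q w \<Otimes>\<^sub>M off_law p w)"
    using sets_quenched[of q p w] by (simp add: space_pair_measure space_PiM quenched_pair)
  have "emeasure (quenched q p w) {\<xi>. U \<xi> k 0 = 0} = (\<integral>\<^sup>+\<xi>. indicator {\<xi>. U \<xi> k 0 = 0} \<xi> \<partial>(imm_law q w \<Otimes>\<^sub>M off_law p w))"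
    using s by (simp add: quenched_pair)
  also have "\<dots> = (\<integral>\<^sup>+x. \<integral>\<^sup>+y. indicator {\<xi>. U \<xi> k 0 = 0} (x, y) \<partial>off_law p w \<partial>imm_law q w)"
    using s by (intro O.nn_integral_fst[symmetric]) auto
  also have "\<dots> = (\<integral>\<^sup>+x. \<integral>\<^sup>+y. indicator {y. Z (x 0) (\<lambda>_. 0, y) k = 0} y \<partial>off_law p w \<partial>imm_law q w)"
    by (intro nn_integral_cong) (simp add: U_0_eq_Z immigrants_def indicator_def)
  also have "\<dots> = (\<integral>\<^sup>+v. vpow (die p k w) v \<partial>measure_pmf (q (w (-1))))"
    unfolding nn_integral_off_law_Z by (rule nn_integral_imm_law)
  finally show ?thesis by (simp add: fam_def pgf_def)
qed

section \<open>Returns to zero\<close>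

definition hit :: "('s \<Rightarrow> (nat^'d::finite) pmf) \<Rightarrow> ('d \<Rightarrow> 's \<Rightarrow> (nat^'d) pmf) \<Rightarrow> nat \<Rightarrow> (int \<Rightarrow> 's) \<Rightarrow> ennreal" where
  "hit q p n w = emeasure (quenched q p w) {\<xi>. Z 0 \<xi> n = 0}"

text \<open>For \<open>n \<ge> 1\<close> this is the law of the first return time. At
  \<open>n = 0\<close> the value is 1, because the process starts at 0; sums over return times
  therefore run over \<open>Suc j\<close>.\<close>

definition first_hit :: "('s \<Rightarrow> (nat^'d::finite) pmf) \<Rightarrow> ('d \<Rightarrow> 's \<Rightarrow> (nat^'d) pmf) \<Rightarrow> nat \<Rightarrow> (int \<Rightarrow> 's) \<Rightarrow> ennreal" where
  "first_hit q p n w = emeasure (quenched q p w) {\<xi>. (\<forall>k\<in>{1..<n}. Z 0 \<xi> k \<noteq> 0) \<and> Z 0 \<xi> n = 0}"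

definition never_hit :: "('s \<Rightarrow> (nat^'d::finite) pmf) \<Rightarrow> ('d \<Rightarrow> 's \<Rightarrow> (nat^'d) pmf) \<Rightarrow> (int \<Rightarrow> 's) \<Rightarrow> ennreal" where
  "never_hit q p w = emeasure (quenched q p w) {\<xi>. \<forall>k\<ge>1. Z 0 \<xi> k \<noteq> 0}"

definition zero_prob :: "('s \<Rightarrow> (nat^'d::finite) pmf) \<Rightarrow> ('d \<Rightarrow> 's \<Rightarrow> (nat^'d) pmf) \<Rightarrow> (int \<Rightarrow> 's) \<Rightarrow> ennreal" where
  "zero_prob q p w = ennreal (pi_quenched q p w 0)"

lemma space_sample_space[simp]: "space sample_space = UNIV"
  by (simp add: space_pair_measure space_PiM)

lemma sets_Z_event:
  assumes "Measurable.pred (sample_space :: 'd::finite sample measure) \<Phi>"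
  shows "{\<xi>. \<Phi> \<xi>} \<in> sets (quenched q p w)"
  using assms by (simp add: sets_quenched pred_def)

lemma hit_eq_prod: "hit q p n w = (\<Prod>i<n. fam q p (n - i) (fwd i w))"
  by (simp add: hit_def emeasure_Z_eq_0)

text \<open>When the process starts at time \<open>- n\<close>, the factor with index
  \<open>k\<close> refers to the immigrants of time \<open>- k\<close> and does not involve
  \<open>n\<close>; all these products are thus partial products of one infinite product.\<close>

lemma hit_shift: "hit q p n (bwd n w) = (\<Prod>k=1..n. fam q p k (bwd k w))"
  unfolding hit_eq_prod
  by (rule prod.reindex_bij_witness[of _ "\<lambda>k. n - k" "\<lambda>i. n - i"])
    (auto simp: env_shift_env_shift of_nat_diff)

lemma hit_le_1: "hit q p n w \<le> 1"
  unfolding hit_def by (rule prob_space.emeasure_le_1[OF prob_space_quenched])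

lemma fam_le_1: "fam q p k w \<le> 1"
  unfolding emeasure_U_eq_0[symmetric] by (rule prob_space.emeasure_le_1[OF prob_space_quenched])

lemma emeasure_family_law: "emeasure (family_law q p w) {u \<in> space vec_seq. u k = 0} = fam q p k w"
proof -
  have m: "(\<lambda>\<xi> n. U \<xi> n 0) \<in> quenched q p w \<rightarrow>\<^sub>M vec_seq"
    unfolding measurable_quenched_iff by (rule measurable_PiM_single') (auto intro: measurable_U)
  have "{u \<in> space vec_seq. u k = 0} \<in> sets vec_seq" by measurable
  then show ?thesis
    unfolding family_law_def by (subst emeasure_distr[OF m]) (auto simp: space_quenched space_PiM emeasure_U_eq_0[symmetric] vimage_def)
qed

lemma sets_family_law: "sets (family_law q p w) = sets vec_seq"
  by (simp add: family_law_def)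

lemma prob_space_family_law: "prob_space (family_law q p w)"
proof -
  have m: "(\<lambda>\<xi> n. U \<xi> n 0) \<in> quenched q p w \<rightarrow>\<^sub>M vec_seq"
    unfolding measurable_quenched_iff by (rule measurable_PiM_single') (auto intro: measurable_U)
  show ?thesis unfolding family_law_def
    by (rule prob_space.prob_space_distr[OF prob_space_quenched m])
qed

lemma Z_tilde_eq_0:
  "Z_tilde \<zeta> 0 = (\<chi> j. enat ((0 :: nat^'d::finite) $ j)) \<longleftrightarrow> (\<forall>k\<ge>1. snd \<zeta> (- int k) k = 0)"
proof -
  have "Z_tilde \<zeta> 0 = (\<chi> j. enat ((0 :: nat^'d) $ j)) \<longleftrightarrow> (\<forall>j. infsum (\<lambda>i. enat (U_ext \<zeta> i 0 $ j)) {..<0} = 0)"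
    by (simp add: Z_tilde_def vec_eq_iff zero_enat_def)
  also have "\<dots> \<longleftrightarrow> (\<forall>j. \<forall>i<0. U_ext \<zeta> i 0 $ j = 0)"
  proof (intro iff_allI)
    fix j
    show "infsum (\<lambda>i. enat (U_ext \<zeta> i 0 $ j)) {..<0} = 0 \<longleftrightarrow> (\<forall>i<0. U_ext \<zeta> i 0 $ j = 0)"
    proof
      assume *: "infsum (\<lambda>i. enat (U_ext \<zeta> i 0 $ j)) {..<0} = 0"
      show "\<forall>i<0. U_ext \<zeta> i 0 $ j = 0"
      proof (intro allI impI)
        fix i :: int assume "i < 0"
        with * show "U_ext \<zeta> i 0 $ j = 0"
          unfolding infsum_enat_eq_iff by (auto simp: zero_enat_def dest!: bspec[of _ _ "{i}"])
      qed
    next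
      assume "\<forall>i<0. U_ext \<zeta> i 0 $ j = 0"
      then have "infsum (\<lambda>i. enat (U_ext \<zeta> i 0 $ j)) {..<0} = infsum (\<lambda>_. 0) {..<0::int}"
        by (intro infsum_cong) (simp add: zero_enat_def)
      then show "infsum (\<lambda>i. enat (U_ext \<zeta> i 0 $ j)) {..<0} = 0" by simp
    qed
  qed
  also have "\<dots> \<longleftrightarrow> (\<forall>i<0. snd \<zeta> i (nat (- i)) = 0)"
    by (auto simp: U_ext_def vec_eq_iff)
  also have "\<dots> \<longleftrightarrow> (\<forall>k\<ge>1. snd \<zeta> (- int k) k = 0)"
  proof safe
    fix i :: int assume *: "\<forall>k\<ge>1. snd \<zeta> (- int k) k = 0" and "i < 0"
    then show "snd \<zeta> i (nat (- i)) = 0" using *[rule_format, of "nat (- i)"] by simp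
  next
    fix k :: nat assume *: "\<forall>i<0. snd \<zeta> i (nat (- i)) = 0" and "1 \<le> k"
    then show "snd \<zeta> (- int k) k = 0" using *[rule_format, of "- int k"] by simp
  qed
  finally show ?thesis .
qed

text \<open>Extinction at time 0 of the families from the last \<open>n\<close> times is a finite
  intersection of independent events; its probability is that of reaching 0 after starting at time
  \<open>- n\<close>. Continuity from above gives the infimum.\<close>

lemma zero_prob_INF:
  fixes q :: "'s \<Rightarrow> (nat^'d::finite) pmf"
  shows "zero_prob q p w = (INF n. hit q p n (bwd n w))"
proof -
  let ?F = "\<lambda>i. family_law q p (env_shift i w)"
  let ?R = "Pi\<^sub>M {..<0} ?F"
  let ?M = "quenched_ext q p w"
  have M: "?M = quenched q p w \<Otimes>\<^sub>M ?R" by (simp add: quenched_ext_def)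
  interpret Q: prob_space "quenched q p w" by (rule prob_space_quenched)
  interpret R: prob_space ?R by (intro prob_space_PiM prob_space_family_law)
  interpret QR: pair_prob_space "quenched q p w" ?R ..
  define E where "E n = {\<zeta> \<in> space ?M. \<forall>k\<in>{1..n}. snd \<zeta> (- int k) k = 0}" for n :: nat
  define A :: "int \<Rightarrow> (nat \<Rightarrow> nat^'d) set" where "A i = {u \<in> space vec_seq. u (nat (- i)) = 0}" for i
  let ?J = "\<lambda>n. (\<lambda>k. - int k) ` {1..n}"
  let ?B = "\<lambda>n. prod_emb {..<0} ?F (?J n) (Pi\<^sub>E (?J n) A)"
  have A: "A i \<in> sets (?F i)" for i unfolding sets_family_law A_def by measurable
  have B: "?B n \<in> sets ?R" for n by (intro sets_PiM_I) (use A in auto)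
  have spF: "space (?F i) = UNIV" for i
    using sets_eq_imp_space_eq[OF sets_family_law[of q p]] by (simp add: space_PiM)
  have EB: "E n = space (quenched q p w) \<times> ?B n" for n
    unfolding E_def M by (auto simp: space_pair_measure prod_emb_def space_PiM A_def spF PiE_iff)
  have "emeasure ?M (E n) = emeasure (quenched q p w) (space (quenched q p w)) * emeasure ?R (?B n)" for n
    unfolding EB M by (rule R.emeasure_pair_measure_Times) (use B in auto)
  also have "\<dots> n = (\<Prod>i\<in>?J n. emeasure (?F i) (A i))" for n
    using A by (subst emeasure_PiM_emb) (auto simp: Q.emeasure_space_1 prob_space_family_law)
  also have "\<dots> n = hit q p n (bwd n w)" for n
    unfolding hit_shift by (subst prod.reindex) (auto simp: inj_on_def A_def emeasure_family_law)
  finally have em: "emeasure ?M (E n) = hit q p n (bwd n w)" for n .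
  have all: "(\<forall>k\<ge>1. R k) \<longleftrightarrow> (\<forall>n. \<forall>k\<in>{1..n}. R k)" for R :: "nat \<Rightarrow> bool"
    by (meson atLeastAtMost_iff order_refl)
  have "{\<zeta> \<in> space ?M. Z_tilde \<zeta> 0 = (\<chi> j. enat ((0 :: nat^'d) $ j))} = (\<Inter>n. E n)"
    unfolding Z_tilde_eq_0 all E_def by blast
  then have "zero_prob q p w = emeasure ?M (\<Inter>n. E n)"
    unfolding zero_prob_def pi_quenched_def M by (simp add: QR.P.emeasure_eq_measure)
  also have "\<dots> = (INF n. emeasure ?M (E n))"
  proof (rule INF_emeasure_decseq[symmetric])
    show "range E \<subseteq> sets ?M" using B by (auto simp: EB M)
    show "decseq E" by (auto simp: decseq_def E_def)
  qed (simp add: M QR.P.emeasure_finite)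
  finally show ?thesis by (simp add: em)
qed

text \<open>One member of the infimum: ignoring the families that arrived before time 0 can only
  make a zero at time \<open>n\<close> more likely.\<close>

lemma zero_prob_le_hit: "zero_prob q p (fwd n w) \<le> hit q p n w"
proof -
  have "zero_prob q p (fwd n w) \<le> hit q p n (bwd n (fwd n w))"
    unfolding zero_prob_INF by (rule INF_lower) simp
  then show ?thesis by (simp add: env_shift_env_shift)
qed

lemma zero_prob_le_1: "zero_prob q p w \<le> 1"
  using zero_prob_le_hit[of q p 0 w] hit_le_1[of q p 0 w] by simp

section \<open>Decompositions according to the zeros\<close>

lemma emeasure_regeneration:
  assumes A: "Measurable.pred (sample_space :: 'd::finite sample measure) A" and B: "Measurable.pred sample_space B"
    and C: "Measurable.pred sample_space C"
    and eq: "\<And>\<xi> \<xi>'. C (splice_at j (\<xi>, \<xi>')) \<longleftrightarrow> A \<xi> \<and> B \<xi>'"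
  shows "emeasure (quenched q p w) {\<xi>. C \<xi>} =
    emeasure (quenched q p w) {\<xi>. A \<xi>} * emeasure (quenched q p (fwd j w)) {\<xi>. B \<xi>}"
proof -
  have "(\<integral>\<^sup>+\<xi>. indicator {\<xi>. C \<xi>} \<xi> \<partial>quenched q p w) = (\<integral>\<^sup>+\<xi>. indicator {\<xi>. A \<xi>} \<xi> \<partial>quenched q p w) *
     (\<integral>\<^sup>+\<xi>. indicator {\<xi>. B \<xi>} \<xi> \<partial>quenched q p (fwd j w))"
    by (rule nn_integral_quenched_splice)
      (use A B C eq in \<open>auto simp: pred_def split: split_indicator\<close>)
  then show ?thesis by (simp add: sets_Z_event A B C)
qed

lemma pred_Z[measurable]: "Measurable.pred sample_space (\<lambda>\<xi>. Z z \<xi> n = 0)"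
  by measurable

lemmas pred_hit = pred_intros_logic(2,3) pred_intros_imp' pred_intros_countable_bounded(3,4) pred_intros_countable pred_Z

lemma Z_splice_zero: "Z 0 \<xi> j = 0 \<Longrightarrow> j \<le> n \<Longrightarrow> Z 0 (splice_at j (\<xi>, \<xi>')) n = Z 0 \<xi>' (n - j)"
  using Z_splice_add[of 0 j \<xi> \<xi>' "n - j"] by simp

lemma emeasure_sum_disjoint:
  assumes "finite I" "\<And>i. i \<in> I \<Longrightarrow> Measurable.pred (sample_space :: 'd::finite sample measure) (C i)"
    and "\<And>i j \<xi>. i \<in> I \<Longrightarrow> j \<in> I \<Longrightarrow> C i \<xi> \<Longrightarrow> C j \<xi> \<Longrightarrow> i = j"
  shows "(\<Sum>i\<in>I. emeasure (quenched q p w) {\<xi>. C i \<xi>}) = emeasure (quenched q p w) {\<xi>. \<exists>i\<in>I. C i \<xi>}"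
proof -
  have "(\<Sum>i\<in>I. emeasure (quenched q p w) {\<xi>. C i \<xi>}) = emeasure (quenched q p w) (\<Union>i\<in>I. {\<xi>. C i \<xi>})"
    by (rule sum_emeasure) (use assms in \<open>auto simp: disjoint_family_on_def sets_Z_event\<close>)
  also have "(\<Union>i\<in>I. {\<xi>. C i \<xi>}) = {\<xi>. \<exists>i\<in>I. C i \<xi>}" by auto
  finally show ?thesis .
qed

lemma first_zero_decomposition:
  fixes q :: "'s \<Rightarrow> (nat^'d::finite) pmf"
  assumes "1 \<le> n"
  shows "hit q p n w = (\<Sum>j=1..n. first_hit q p j w * hit q p (n - j) (fwd j w))"
proof -
  let ?F = "\<lambda>j \<xi>. (\<forall>k\<in>{1..<j}. Z 0 \<xi> k \<noteq> 0) \<and> Z 0 \<xi> j = 0"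
  let ?C = "\<lambda>j \<xi>. ?F j \<xi> \<and> Z 0 \<xi> n = 0"
  have "first_hit q p j w * hit q p (n - j) (fwd j w) = emeasure (quenched q p w) {\<xi>. ?C j \<xi>}"
    if "j \<in> {1..n}" for j
    unfolding first_hit_def hit_def
  proof (rule emeasure_regeneration[symmetric, where A = "?F j" and B = "\<lambda>\<xi>. Z 0 \<xi> (n - j) = 0" and C = "?C j"], (intro pred_hit)+)
      fix \<xi> \<xi>' :: "'d sample"
      show "?C j (splice_at j (\<xi>, \<xi>')) \<longleftrightarrow> ?F j \<xi> \<and> Z 0 \<xi>' (n - j) = 0"
        using that Z_splice_zero[of \<xi> j n \<xi>'] by (auto simp: Z_splice_le)
  qed
  then have "(\<Sum>j=1..n. first_hit q p j w * hit q p (n - j) (fwd j w)) =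
      (\<Sum>j=1..n. emeasure (quenched q p w) {\<xi>. ?C j \<xi>})" by simp
  also have "\<dots> = emeasure (quenched q p w) {\<xi>. \<exists>j\<in>{1..n}. ?C j \<xi>}"
  proof (rule emeasure_sum_disjoint)
    have *: False if "i \<in> {1..n}" "?C i \<xi>" "?C j \<xi>" "i < j" for i j and \<xi> :: "'d sample"
    proof -
      have "i \<in> {1..<j}" using that(1,4) by auto
      then show False using that(2,3) by blast
    qed
    fix i j and \<xi> :: "'d sample" assume "i \<in> {1..n}" "j \<in> {1..n}" "?C i \<xi>" "?C j \<xi>"
    then show "i = j" using *[of i \<xi> j] *[of j \<xi> i] by (cases i j rule: linorder_cases) auto
  qed (simp, intro pred_hit)
  also have "{\<xi> :: 'd sample. \<exists>j\<in>{1..n}. ?C j \<xi>} = {\<xi>. Z 0 \<xi> n = 0}"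
  proof (intro Collect_cong iffI)
    fix \<xi> assume Zn: "Z 0 \<xi> n = (0 :: nat^'d)"
    define j where "j = (LEAST j. 1 \<le> j \<and> Z 0 \<xi> j = 0)"
    have j: "1 \<le> j \<and> Z 0 \<xi> j = 0" unfolding j_def by (rule LeastI[of _ n]) (use assms Zn in simp)
    have jn: "j \<le> n" unfolding j_def by (rule Least_le) (use assms Zn in simp)
    have "Z 0 \<xi> k \<noteq> 0" if "k \<in> {1..<j}" for k
      using not_less_Least[of k "\<lambda>j. 1 \<le> j \<and> Z 0 \<xi> j = 0"] that unfolding j_def[symmetric] by auto
    then show "\<exists>j\<in>{1..n}. ?C j \<xi>" using j jn Zn by (intro bexI[of _ j]) auto
  qed blast
  finally show ?thesis by (simp add: hit_def)
qed

text \<open>Here \<open>j\<close> is the time elapsed since the last zero before \<open>n\<close>;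
  such a zero exists because the process starts at 0, which is the case
  \<open>j = n\<close>.\<close>

lemma last_zero_decomposition:
  fixes q :: "'s \<Rightarrow> (nat^'d::finite) pmf"
  assumes "1 \<le> n"
  shows "hit q p n w = (\<Sum>j=1..n. hit q p (n - j) w * first_hit q p j (fwd (n - j) w))"
proof -
  let ?C = "\<lambda>j \<xi>. Z 0 \<xi> (n - j) = 0 \<and> (\<forall>k\<in>{1..<j}. Z 0 \<xi> (n - j + k) \<noteq> 0) \<and> Z 0 \<xi> n = 0"
  have "hit q p (n - j) w * first_hit q p j (fwd (n - j) w) = emeasure (quenched q p w) {\<xi>. ?C j \<xi>}"
    if "j \<in> {1..n}" for j
    unfolding first_hit_def hit_def
  proof (rule emeasure_regeneration[symmetric, where A = "\<lambda>\<xi>. Z 0 \<xi> (n - j) = 0" and B = "\<lambda>\<xi>. (\<forall>k\<in>{1..<j}. Z 0 \<xi> k \<noteq> 0) \<and> Z 0 \<xi> j = 0" and C = "?C j"], (intro pred_hit)+)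
      fix \<xi> \<xi>' :: "'d sample"
      show "?C j (splice_at (n - j) (\<xi>, \<xi>')) \<longleftrightarrow> Z 0 \<xi> (n - j) = 0 \<and> (\<forall>k\<in>{1..<j}. Z 0 \<xi>' k \<noteq> 0) \<and> Z 0 \<xi>' j = 0"
      proof (cases "Z 0 \<xi> (n - j) = 0")
        case True
        show ?thesis using that Z_splice_zero[OF True, of _ \<xi>'] True by (auto simp: Z_splice_le)
      qed (simp add: Z_splice_le)
    qed
  then have "(\<Sum>j=1..n. hit q p (n - j) w * first_hit q p j (fwd (n - j) w)) =
      (\<Sum>j=1..n. emeasure (quenched q p w) {\<xi>. ?C j \<xi>})" by simp
  also have "\<dots> = emeasure (quenched q p w) {\<xi>. \<exists>j\<in>{1..n}. ?C j \<xi>}"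
  proof (rule emeasure_sum_disjoint)
    have *: False if "i \<in> {1..n}" "j \<in> {1..n}" "?C i \<xi>" "?C j \<xi>" "i < j" for i j and \<xi> :: "'d sample"
    proof -
      have "j - i \<in> {1..<j}" "n - j + (j - i) = n - i" using that by auto
      then show False using that by metis
    qed
    fix i j and \<xi> :: "'d sample" assume "i \<in> {1..n}" "j \<in> {1..n}" "?C i \<xi>" "?C j \<xi>"
    then show "i = j" using *[of i j \<xi>] *[of j i \<xi>] by (cases i j rule: linorder_cases) auto
  qed (simp, intro pred_hit)
  also have "{\<xi> :: 'd sample. \<exists>j\<in>{1..n}. ?C j \<xi>} = {\<xi>. Z 0 \<xi> n = 0}"
  proof (intro Collect_cong iffI)
    fix \<xi> assume Zn: "Z 0 \<xi> n = (0 :: nat^'d)"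
    define j where "j = (LEAST j. 1 \<le> j \<and> Z 0 \<xi> (n - j) = 0)"
    have j: "1 \<le> j \<and> Z 0 \<xi> (n - j) = 0" unfolding j_def by (rule LeastI[of _ n]) (use assms in simp)
    have jn: "j \<le> n" unfolding j_def by (rule Least_le) (use assms in simp)
    have "Z 0 \<xi> (n - j + k) \<noteq> 0" if "k \<in> {1..<j}" for k
    proof -
      have "n - j + k = n - (j - k)" using that jn by auto
      then show ?thesis
        using not_less_Least[of "j - k" "\<lambda>j. 1 \<le> j \<and> Z 0 \<xi> (n - j) = 0"] that unfolding j_def[symmetric] by auto
    qed
    then show "\<exists>j\<in>{1..n}. ?C j \<xi>" using j jn Zn by (intro bexI[of _ j]) auto
  qed blast
  finally show ?thesis by (simp add: hit_def)
qed

text \<open>The summand \<open>k\<close> is the probability that \<open>k\<close> is the last zero,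
  and these events are disjoint.\<close>

lemma never_hit_decomposition:
  fixes q :: "'s \<Rightarrow> (nat^'d::finite) pmf"
  shows "(\<Sum>k\<le>n. hit q p k w * never_hit q p (fwd k w)) \<le> 1"
proof -
  let ?C = "\<lambda>k \<xi>. Z 0 \<xi> k = 0 \<and> (\<forall>l\<ge>1. Z 0 \<xi> (k + l) \<noteq> 0)"
  have "hit q p k w * never_hit q p (fwd k w) = emeasure (quenched q p w) {\<xi>. ?C k \<xi>}" for k
    unfolding hit_def never_hit_def
  proof (rule emeasure_regeneration[symmetric, where A = "\<lambda>\<xi>. Z 0 \<xi> k = 0" and B = "\<lambda>\<xi>. \<forall>l\<ge>1. Z 0 \<xi> l \<noteq> 0" and C = "?C k"], (intro pred_hit)+)
      fix \<xi> \<xi>' :: "'d sample"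
      show "?C k (splice_at k (\<xi>, \<xi>')) \<longleftrightarrow> Z 0 \<xi> k = 0 \<and> (\<forall>l\<ge>1. Z 0 \<xi>' l \<noteq> 0)"
      proof (cases "Z 0 \<xi> k = 0")
        case True
        show ?thesis using Z_splice_zero[OF True, of _ \<xi>'] True by (auto simp: Z_splice_le)
      qed (simp add: Z_splice_le)
    qed
  then have "(\<Sum>k\<le>n. hit q p k w * never_hit q p (fwd k w)) =
      (\<Sum>k\<le>n. emeasure (quenched q p w) {\<xi>. ?C k \<xi>})" by simp
  also have "\<dots> = emeasure (quenched q p w) {\<xi>. \<exists>k\<in>{..n}. ?C k \<xi>}"
  proof (rule emeasure_sum_disjoint)
    have *: False if "?C i \<xi>" "?C j \<xi>" "i < j" for i j and \<xi> :: "'d sample"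
    proof -
      have "1 \<le> j - i" using that(3) by simp
      then show False using that(1)[THEN conjunct2, rule_format, of "j - i"] that(2,3) by simp
    qed
    fix i j and \<xi> :: "'d sample" assume "?C i \<xi>" "?C j \<xi>"
    then show "i = j" using *[of \<xi> i j] *[of \<xi> j i] by (cases i j rule: linorder_cases) auto
  qed (simp, intro pred_hit)
  also have "\<dots> \<le> 1" by (rule prob_space.emeasure_le_1[OF prob_space_quenched])
  finally show ?thesis .
qed

lemma hit_total:
  fixes q :: "'s \<Rightarrow> (nat^'d::finite) pmf"
  shows "(\<Sum>j. first_hit q p (Suc j) w) + never_hit q p w = 1"
proof -
  let ?F = "\<lambda>j \<xi>. (\<forall>k\<in>{1..<Suc j}. Z 0 \<xi> k \<noteq> 0) \<and> Z 0 \<xi> (Suc j) = 0"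
  have sF: "{\<xi>. ?F j \<xi>} \<in> sets (quenched q p w)" for j
    by (rule sets_Z_event) (intro pred_hit)
  have sN: "{\<xi>. \<forall>k\<ge>1. Z 0 \<xi> k \<noteq> 0} \<in> sets (quenched q p w)"
    by (rule sets_Z_event) (intro pred_hit)
  have un: "(\<Union>j. {\<xi> :: 'd sample. ?F j \<xi>}) = UNIV - {\<xi>. \<forall>k\<ge>1. Z 0 \<xi> k \<noteq> 0}"
  proof (intro equalityI subsetI)
    fix \<xi> :: "'d sample" assume "\<xi> \<in> UNIV - {\<xi>. \<forall>k\<ge>1. Z 0 \<xi> k \<noteq> 0}"
    then obtain k where k: "1 \<le> k" "Z 0 \<xi> k = 0" by blast
    define j where "j = (LEAST j. 1 \<le> j \<and> Z 0 \<xi> j = 0)"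
    have j: "1 \<le> j \<and> Z 0 \<xi> j = 0" unfolding j_def by (rule LeastI[of _ k]) (use k in simp)
    have "Z 0 \<xi> l \<noteq> 0" if "l \<in> {1..<j}" for l
      using not_less_Least[of l "\<lambda>j. 1 \<le> j \<and> Z 0 \<xi> j = 0"] that unfolding j_def[symmetric] by auto
    then show "\<xi> \<in> (\<Union>j. {\<xi>. ?F j \<xi>})" using j by (intro UN_I[of "j - 1"]) auto
  next
    fix \<xi> :: "'d sample" assume "\<xi> \<in> (\<Union>j. {\<xi>. ?F j \<xi>})"
    then obtain j where "Z 0 \<xi> (Suc j) = 0" by blast
    then show "\<xi> \<in> UNIV - {\<xi>. \<forall>k\<ge>1. Z 0 \<xi> k \<noteq> 0}"
      by (auto simp del: Z.simps intro!: exI[of _ "Suc j"])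
  qed
  have "(\<Sum>j. first_hit q p (Suc j) w) = emeasure (quenched q p w) (\<Union>j. {\<xi>. ?F j \<xi>})"
    unfolding first_hit_def
  proof (rule suminf_emeasure)
    show "disjoint_family (\<lambda>j. {\<xi> :: 'd sample. ?F j \<xi>})"
    proof -
      have *: False if "?F i \<xi>" "?F j \<xi>" "i < j" for i j and \<xi> :: "'d sample"
        using that(1) that(2)[THEN conjunct1, THEN bspec, of "Suc i"] that(3) by (auto simp del: Z.simps)
      show ?thesis
        unfolding disjoint_family_on_def using * by (blast elim: linorder_neqE_nat)
    qed
  qed (use sF in auto)
  note first = this
  have "(\<Sum>j. first_hit q p (Suc j) w) + never_hit q p w =
      emeasure (quenched q p w) ((\<Union>j. {\<xi>. ?F j \<xi>}) \<union> {\<xi>. \<forall>k\<ge>1. Z 0 \<xi> k \<noteq> 0})"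
    unfolding never_hit_def first
  proof (rule plus_emeasure)
    show "(\<Union>j. {\<xi>. ?F j \<xi>}) \<in> sets (quenched q p w)" using sF by blast
  qed (rule sN, unfold un, blast)
  also have "\<dots> = 1"
    unfolding un using prob_space.emeasure_space_1[OF prob_space_quenched[of q p w]] by (simp add: space_quenched Un_absorb2)
  finally show ?thesis .
qed

section \<open>Excursions between zeros\<close>

lemma first_hit_block:
  fixes q :: "'s \<Rightarrow> (nat^'d::finite) pmf"
  assumes "1 \<le> j"
  shows "(\<integral>\<^sup>+y. ennreal (block_prob q p w j y) \<partial>count_space Upsilon) = first_hit q p j w"
proof -
  have "(\<integral>\<^sup>+y. ennreal (block_prob q p w j y) \<partial>count_space Upsilon) =
      (\<integral>\<^sup>+y. emeasure (quenched q p w) {\<xi>. Z_block \<xi> j = y} \<partial>count_space Upsilon)"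
    by (simp add: emeasure_Z_block)
  also have "\<dots> = emeasure (quenched q p w) (\<Union>y\<in>Upsilon. {\<xi>. Z_block \<xi> j = y})"
    by (rule emeasure_UN_countable[symmetric]) (auto simp: disjoint_family_on_def sets_quenched measurable_Z_block)
  also have "(\<Union>y\<in>Upsilon. {\<xi> :: 'd sample. Z_block \<xi> j = y}) = {\<xi>. (\<forall>k\<in>{1..<j}. Z 0 \<xi> k \<noteq> 0) \<and> Z 0 \<xi> j = 0}"
  proof -
    have "Z_block \<xi> j = map (Z 0 \<xi>) [1..<j] @ [Z 0 \<xi> j]" for \<xi> :: "'d sample"
      using assms by (simp add: Z_block_def)
    then have "Z_block \<xi> j \<in> Upsilon \<longleftrightarrow> (\<forall>k\<in>{1..<j}. Z 0 \<xi> k \<noteq> 0) \<and> Z 0 \<xi> j = 0" for \<xi> :: "'d sample"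
      by (auto simp: Upsilon_def simp del: split_paired_All)
    moreover have "(\<Union>y\<in>Upsilon. {\<xi> :: 'd sample. Z_block \<xi> j = y}) = {\<xi>. Z_block \<xi> j \<in> Upsilon}" by blast
    ultimately show ?thesis by (simp only:)
  qed
  finally show ?thesis by (simp only: first_hit_def)
qed

lemma nn_integral_block_prob:
  fixes c :: "nat \<Rightarrow> ennreal" and q :: "'s \<Rightarrow> (nat^'d::finite) pmf"
  shows "(\<integral>\<^sup>+z. ennreal (block_prob q p w (fst z) (snd z)) * c (fst z) \<partial>count_space ({1..} \<times> Upsilon)) =
    (\<Sum>j. first_hit q p (Suc j) w * c (Suc j))"
proof -
  let ?f = "\<lambda>j y. ennreal (block_prob q p w j y) * c j * indicator {1..} j * indicator Upsilon y"
  have "(\<integral>\<^sup>+z. ennreal (block_prob q p w (fst z) (snd z)) * c (fst z) \<partial>count_space ({1..} \<times> Upsilon)) =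
      (\<integral>\<^sup>+z. (case z of (j, y) \<Rightarrow> ?f j y) \<partial>count_space UNIV)"
    by (subst nn_integral_count_space_indicator) (auto intro!: nn_integral_cong split: split_indicator)
  also have "\<dots> = (\<integral>\<^sup>+j. \<integral>\<^sup>+y. ?f j y \<partial>count_space UNIV \<partial>count_space UNIV)"
    by (subst nn_integral_fst_count_space[symmetric]) simp
  also have "\<dots> = (\<integral>\<^sup>+j. first_hit q p j w * c j * indicator {1..} j \<partial>count_space UNIV)"
  proof (rule nn_integral_cong)
    fix j
    have "(\<integral>\<^sup>+y. ?f j y \<partial>count_space UNIV) = (\<integral>\<^sup>+y. ennreal (block_prob q p w j y) * (c j * indicator {1..} j) \<partial>count_space Upsilon)"
      by (subst (2) nn_integral_count_space_indicator) (auto simp: ac_simps)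
    also have "\<dots> = first_hit q p j w * c j * indicator {1..} j"
      using first_hit_block[of j q p w] by (subst nn_integral_multc) (auto simp: mult.assoc split: split_indicator)
    finally show "(\<integral>\<^sup>+y. ?f j y \<partial>count_space UNIV) = first_hit q p j w * c j * indicator {1..} j" .
  qed
  also have "\<dots> = (\<Sum>j. first_hit q p j w * c j * indicator {1..} j)"
    by (rule nn_integral_count_space_nat)
  also have "\<dots> = (\<Sum>j. first_hit q p (Suc j) w * c (Suc j))"
    by (subst suminf_offset[where i = 1]) auto
  finally show ?thesis .
qed

section \<open>The stationary environment seen from the zeros\<close>

locale branching_env = prob_space P
  for P :: "(int \<Rightarrow> 's) measure" +
  fixes S :: "'s measure" and q :: "'s \<Rightarrow> (nat^'d::finite) pmf" and p :: "'d \<Rightarrow> 's \<Rightarrow> (nat^'d) pmf"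
  assumes sets_P: "sets P = sets (env_space S)"
    and stationary: "stationary_under P (env_shift 1)"
    and q: "(\<lambda>s. measure_pmf (q s)) \<in> S \<rightarrow>\<^sub>M prob_algebra (count_space UNIV)"
    and p: "\<And>i. (\<lambda>s. measure_pmf (p i s)) \<in> S \<rightarrow>\<^sub>M prob_algebra (count_space UNIV)"
begin

lemma sets_P_cong[measurable_cong]: "sets P = sets (env_space S)" by (rule sets_P)

lemma space_P: "space P = space (env_space S)" by (rule sets_eq_imp_space_eq[OF sets_P])

lemma shift_measurable[measurable]: "env_shift k \<in> P \<rightarrow>\<^sub>M P"
  using measurable_env_shift[of k S] by (simp cong: measurable_cong_sets add: sets_P)

text \<open>The shift is invertible, so invariance under one step passes to its inverse and to all
  powers.\<close>

lemma distr_shift: "distr P P (env_shift k) = P"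
proof -
  have 1: "distr P P (env_shift 1) = P" using stationary by (simp add: stationary_under_def)
  have m1: "distr P P (env_shift (- 1)) = P"
  proof -
    have "distr P P (env_shift (- 1)) = distr (distr P P (env_shift 1)) P (env_shift (- 1))" by (simp add: 1)
    also have "\<dots> = distr P P (\<lambda>w. w)"
      by (subst distr_distr) (auto simp: comp_def env_shift_env_shift)
    finally show ?thesis by (simp add: distr_id)
  qed
  have c: "distr P P (env_shift (a + b)) = P" if "distr P P (env_shift a) = P" "distr P P (env_shift b) = P" for a b
  proof -
    have "distr P P (env_shift (a + b)) = distr (distr P P (env_shift b)) P (env_shift a)"
      by (subst distr_distr) (auto simp: comp_def env_shift_env_shift)
    then show ?thesis using that by simp
  qed
  have n: "distr P P (fwd n) = P \<and> distr P P (bwd n) = P" for n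
  proof (induction n)
    case (Suc n)
    then show ?case using c[OF 1, of "int n"] c[OF m1, of "- int n"] by simp
  qed (simp add: distr_id)
  show ?thesis using n[of "nat k"] n[of "nat (- k)"] by (cases "k \<ge> 0") auto
qed

lemma nn_integral_shift: "f \<in> borel_measurable P \<Longrightarrow> (\<integral>\<^sup>+w. f (env_shift k w) \<partial>P) = (\<integral>\<^sup>+w. f w \<partial>P)"
  by (subst (2) distr_shift[of k, symmetric], subst nn_integral_distr) auto

lemma AE_shift: "AE w in P. \<Phi> w \<Longrightarrow> AE w in P. \<Phi> (env_shift k w)"
  by (rule AE_distrD[OF shift_measurable], unfold distr_shift)

lemma emeasure_quenched_measurable:
  assumes "Measurable.pred (sample_space :: 'd sample measure) \<Phi>"
  shows "(\<lambda>w. emeasure (quenched q p w) {\<xi>. \<Phi> \<xi>}) \<in> borel_measurable P"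
  using measurable_emeasure_kernel[OF measurable_prob_algebraD[OF measurable_quenched[OF q p]], of "{\<xi>. \<Phi> \<xi>}"] assms
  by (simp add: pred_def)

lemma first_hit_measurable[measurable]: "first_hit q p n \<in> borel_measurable P"
  unfolding first_hit_def[abs_def] by (rule emeasure_quenched_measurable) (intro pred_hit)

lemma never_hit_measurable[measurable]: "never_hit q p \<in> borel_measurable P"
  unfolding never_hit_def[abs_def] by (rule emeasure_quenched_measurable) (intro pred_hit)

lemma pi_quenched_measurable[measurable]: "(\<lambda>w. pi_quenched q p w v) \<in> borel_measurable P"
  using measurable_pi_quenched[OF q p] by simp

lemma zero_prob_measurable[measurable]: "zero_prob q p \<in> borel_measurable P"
  unfolding zero_prob_def[abs_def] by measurable

section \<open>Recurrence and the renewal equation\<close>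

abbreviation z where "z \<equiv> zero_prob q p"
abbreviation r where "r \<equiv> first_hit q p"
text \<open>In the stationary picture, the probability that time \<open>- Suc j\<close> is a zero
  and the next zero is time 0.\<close>

abbreviation ret where "ret j w \<equiv> z (bwd (Suc j) w) * r (Suc j) (bwd (Suc j) w)"

text \<open>Poincare recurrence: the events that 0 is hit at time k for the last time are disjoint, and by
  stationarity each of them has annealed probability at least the integral of z * never_hit.\<close>

lemma recurrence: "AE w in P. z w * never_hit q p w = 0"
proof -
  define c where "c = (\<integral>\<^sup>+w. z w * never_hit q p w \<partial>P)"
  have le: "of_nat (Suc N) * c \<le> 1" for N
  proof -
    have "of_nat (Suc N) * c = (\<Sum>k\<le>N. (\<integral>\<^sup>+w. z (fwd k w) * never_hit q p (fwd k w) \<partial>P))"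
      unfolding c_def by (subst nn_integral_shift) (auto simp: algebra_simps)
    also have "\<dots> = (\<integral>\<^sup>+w. (\<Sum>k\<le>N. z (fwd k w) * never_hit q p (fwd k w)) \<partial>P)"
      by (rule nn_integral_sum[symmetric]) measurable
    also have "\<dots> \<le> (\<integral>\<^sup>+w. 1 \<partial>P)"
    proof (rule nn_integral_mono)
      fix w
      have "(\<Sum>k\<le>N. z (fwd k w) * never_hit q p (fwd k w)) \<le>
          (\<Sum>k\<le>N. hit q p k w * never_hit q p (fwd k w))"
        by (intro sum_mono mult_right_mono zero_prob_le_hit) simp
      also have "\<dots> \<le> 1" by (rule never_hit_decomposition)
      finally show "(\<Sum>k\<le>N. z (fwd k w) * never_hit q p (fwd k w)) \<le> 1" .
    qed
    finally show ?thesis by (simp add: emeasure_space_1)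
  qed
  have "c \<le> 1" using le[of 0] by simp
  then obtain x where x: "c = ennreal x" "0 \<le> x" by (cases c) (auto simp: top_unique)
  have xN: "real (Suc N) * x \<le> 1" for N
  proof -
    have "ennreal (real (Suc N) * x) \<le> ennreal 1"
      using le[of N] x by (simp add: ennreal_mult ennreal_of_nat_eq_real_of_nat)
    then show ?thesis by (simp add: ennreal_le_iff)
  qed
  have "\<not> 0 < x"
  proof
    assume "0 < x"
    then obtain n where "1 < real n * x" using reals_Archimedean3 by blast
    moreover have "real n * x \<le> real (Suc n) * x" using x(2) by (intro mult_right_mono) auto
    ultimately show False using xN[of n] by linarith
  qed
  then have "(\<integral>\<^sup>+w. z w * never_hit q p w \<partial>P) = 0" using x by (simp add: c_def)
  then show ?thesis by (subst (asm) nn_integral_0_iff_AE) auto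
qed

lemma hit_shift_antimono:
  assumes "M \<le> N" shows "hit q p N (bwd N w) \<le> hit q p M (bwd M w)"
proof -
  have "(\<Prod>k=1..N. fam q p k (bwd k w)) =
      (\<Prod>k=1..M. fam q p k (bwd k w)) * (\<Prod>k\<in>{M<..N}. fam q p k (bwd k w))"
    using assms by (subst prod.union_disjoint[symmetric]) (auto intro!: prod.cong)
  also have "\<dots> \<le> (\<Prod>k=1..M. fam q p k (bwd k w)) * 1"
    by (intro mult_left_mono prod_le_1) (auto simp: fam_le_1)
  finally show ?thesis by (simp add: hit_shift)
qed

text \<open>For the process started at time \<open>- N\<close> the last-zero decomposition is exact.
  Replacing the probability of a zero at \<open>- j\<close> by the smaller
  \<open>z (bwd j w)\<close> gives a bound that survives the infimum over starting times.\<close>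

lemma renewal_le:
  "(\<Sum>j<J. ret j w) \<le> z w"
  unfolding zero_prob_INF[of q p w]
proof (rule INF_greatest)
  fix N0 :: nat
  \<comment> \<open>At least 1 for the decomposition, at least \<open>J\<close> to contain all
    summands, and at least \<open>N0\<close> for comparison with the given member of the
    infimum.\<close>
  define N where "N = max 1 (max N0 J)"
  have N: "1 \<le> N" "J \<le> N" "N0 \<le> N" by (auto simp: N_def)
  have sh: "fwd (N - j) (bwd N w) = bwd j w" if "j \<le> N" for j
    using that by (simp add: env_shift_env_shift of_nat_diff)
  have "(\<Sum>j<J. ret j w) \<le>
      (\<Sum>j<N. ret j w)"
    using N by (intro sum_mono2) auto
  also have "\<dots> = (\<Sum>j=1..N. z (bwd j w) * r j (bwd j w))"
    by (rule sum.reindex_bij_witness[of _ "\<lambda>j. j - 1" Suc]) auto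
  also have "\<dots> \<le> (\<Sum>j=1..N. hit q p (N - j) (bwd N w) * r j (fwd (N - j) (bwd N w)))"
  proof (rule sum_mono)
    fix j assume "j \<in> {1..N}"
    then have e: "fwd (N - j) (bwd N w) = bwd j w" by (intro sh) simp
    show "z (bwd j w) * r j (bwd j w) \<le>
        hit q p (N - j) (bwd N w) * r j (fwd (N - j) (bwd N w))"
      using zero_prob_le_hit[of q p "N - j" "bwd N w"]
      unfolding e by (intro mult_mono) simp_all
  qed
  also have "\<dots> = hit q p N (bwd N w)"
    by (rule last_zero_decomposition[symmetric, OF N(1)])
  also have "\<dots> \<le> hit q p N0 (bwd N0 w)"
    by (rule hit_shift_antimono[OF N(3)])
  finally show "(\<Sum>j<J. ret j w) \<le> hit q p N0 (bwd N0 w)" .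
qed

text \<open>A single summand of the renewal bound. It carries positivity of \<open>z\<close> from
  one zero to every possible next one.\<close>

lemma zero_prob_first_hit_le: "z w * r (Suc j) w \<le> z (fwd (Suc j) w)"
proof -
  let ?w = "fwd (Suc j) w"
  have "z w * r (Suc j) w = ret j ?w"
    by (simp add: env_shift_env_shift)
  also have "\<dots> \<le> (\<Sum>j<Suc j. ret j ?w)"
    by (subst sum.lessThan_Suc) (rule add_increasing, auto)
  also have "\<dots> \<le> z ?w" by (rule renewal_le)
  finally show ?thesis .
qed

lemma recurrence': "AE w in P. z w * (\<Sum>j. r (Suc j) w) = z w"
  using recurrence
proof eventually_elim
  case (elim w)
  have "z w = z w * ((\<Sum>j. r (Suc j) w) + never_hit q p w)" by (simp add: hit_total)
  also have "\<dots> = z w * (\<Sum>j. r (Suc j) w)" using elim by (simp add: distrib_left)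
  finally show ?case by simp
qed

lemma renewal:
  "AE w in P. (\<Sum>j. ret j w) = z w"
proof (rule AE_eq_of_nn_integral_ge)
  let ?L = "\<lambda>w. \<Sum>j. ret j w"
  show le: "AE w in P. ?L w \<le> z w"
    by (intro AE_I2 suminf_le_const summableI renewal_le)
  have "(\<integral>\<^sup>+w. ?L w \<partial>P) = (\<Sum>j. \<integral>\<^sup>+w. ret j w \<partial>P)"
    by (rule nn_integral_suminf) measurable
  also have "\<dots> = (\<Sum>j. \<integral>\<^sup>+w. z w * r (Suc j) w \<partial>P)"
    by (subst nn_integral_shift) auto
  also have "\<dots> = (\<integral>\<^sup>+w. (\<Sum>j. z w * r (Suc j) w) \<partial>P)"
    by (rule nn_integral_suminf[symmetric]) measurable
  also have "\<dots> = (\<integral>\<^sup>+w. z w \<partial>P)"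
    by (rule nn_integral_cong_AE) (use recurrence' in auto)
  finally show "(\<integral>\<^sup>+w. z w \<partial>P) \<le> (\<integral>\<^sup>+w. ?L w \<partial>P)" by simp
  have "(\<integral>\<^sup>+w. z w \<partial>P) \<le> (\<integral>\<^sup>+w. 1 \<partial>P)" by (intro nn_integral_mono zero_prob_le_1)
  then show "(\<integral>\<^sup>+w. ?L w \<partial>P) \<noteq> \<infinity>"
    using nn_integral_mono_AE[OF le] by (auto simp: emeasure_space_1 top_unique)
qed measurable

text \<open>The measure with density \<open>z\<close> is invariant under the jump to the next zero.
  Shifting summand \<open>j\<close> by \<open>Suc j\<close> turns first zeros after time 0 into last
  zeros before it, where the renewal equation applies.\<close>

lemma invariance:
  assumes f[measurable]: "f \<in> borel_measurable P"
  shows "(\<integral>\<^sup>+w. z w * (\<Sum>j. r (Suc j) w * f (fwd (Suc j) w)) \<partial>P) = (\<integral>\<^sup>+w. z w * f w \<partial>P)"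
proof -
  have "(\<integral>\<^sup>+w. z w * (\<Sum>j. r (Suc j) w * f (fwd (Suc j) w)) \<partial>P) =
      (\<Sum>j. \<integral>\<^sup>+w. z w * (r (Suc j) w * f (fwd (Suc j) w)) \<partial>P)"
    by (subst nn_integral_suminf[symmetric]) auto
  also have "\<dots> = (\<Sum>j. \<integral>\<^sup>+w. ret j w * f w \<partial>P)"
  proof (rule suminf_cong)
    fix j
    show "(\<integral>\<^sup>+w. z w * (r (Suc j) w * f (fwd (Suc j) w)) \<partial>P) =
        (\<integral>\<^sup>+w. ret j w * f w \<partial>P)"
      by (subst (2) nn_integral_shift[where k = "int (Suc j)", symmetric])
        (auto simp: env_shift_env_shift mult.assoc)
  qed
  also have "\<dots> = (\<integral>\<^sup>+w. (\<Sum>j. ret j w) * f w \<partial>P)"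
    by (subst nn_integral_suminf[symmetric]) auto
  also have "\<dots> = (\<integral>\<^sup>+w. z w * f w \<partial>P)"
    by (rule nn_integral_cong_AE) (use renewal in auto)
  finally show ?thesis .
qed

abbreviation \<nu> where "\<nu> \<equiv> P_tilde q p P"

lemma sets_\<nu>[measurable_cong]: "sets \<nu> = sets P"
  by (simp add: P_tilde_def)

lemma pi_annealed: "ennreal (pi_annealed q p P 0) = (\<integral>\<^sup>+w. z w \<partial>P)"
proof -
  have "integrable P (\<lambda>w. pi_quenched q p w 0)"
  proof (rule integrable_const_bound[where B = 1])
    have "pi_quenched q p w 0 \<le> 1" for w
      using zero_prob_le_1[of q p w] by (simp add: zero_prob_def)
    then show "AE w in P. norm (pi_quenched q p w 0) \<le> 1" by (simp add: pi_quenched_def)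
  qed measurable
  then show ?thesis
    unfolding pi_annealed_def zero_prob_def
    by (subst nn_integral_eq_integral) (auto simp: pi_quenched_def)
qed

end

section \<open>The chain of environments and excursions\<close>

locale positive_branching_env = branching_env P S q p
  for P :: "(int \<Rightarrow> 's) measure" and S :: "'s measure" and q :: "'s \<Rightarrow> (nat^'d::finite) pmf" and p +
  assumes ergodic: "ergodic_under P (env_shift 1)"
    and positive: "(\<integral>\<^sup>+w. zero_prob q p w \<partial>P) \<noteq> 0"
begin

abbreviation \<kappa> where "\<kappa> \<equiv> \<lambda>w. chain_kernel S q p (w, 1, [0])"

lemma pi0_pos: "0 < pi_annealed q p P 0"
  using positive pi_annealed by (metis ennreal_0 ennreal_neg linorder_not_le order_le_less)

lemma density_eq: "ennreal (pi_quenched q p w 0 / pi_annealed q p P 0) = ennreal (1 / pi_annealed q p P 0) * z w"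
  using pi0_pos by (simp add: zero_prob_def ennreal_mult'[symmetric])

lemma nn_integral_\<nu>:
  assumes [measurable]: "f \<in> borel_measurable P"
  shows "(\<integral>\<^sup>+w. f w \<partial>\<nu>) = ennreal (1 / pi_annealed q p P 0) * (\<integral>\<^sup>+w. z w * f w \<partial>P)"
  unfolding P_tilde_def density_eq
  by (subst nn_integral_density) (auto simp: mult.assoc nn_integral_cmult)

text \<open>\<open>P_tilde\<close> lives on the environments with positive \<open>z\<close> and is
  equivalent to \<open>P\<close> there.\<close>

lemma AE_\<nu>: "(AE w in \<nu>. \<Phi> w) \<longleftrightarrow> (AE w in P. z w \<noteq> 0 \<longrightarrow> \<Phi> w)"
  unfolding P_tilde_def density_eq using pi0_pos
  by (subst AE_density) (auto simp: zero_less_iff_neq_zero ennreal_eq_0_iff not_le)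

lemma prob_space_\<nu>: "prob_space \<nu>"
proof (rule prob_spaceI)
  have "emeasure \<nu> (space \<nu>) = (\<integral>\<^sup>+w. 1 \<partial>\<nu>)" by simp
  also have "\<dots> = ennreal (1 / pi_annealed q p P 0) * ennreal (pi_annealed q p P 0)"
    unfolding pi_annealed by (subst nn_integral_\<nu>) auto
  also have "\<dots> = 1" using pi0_pos by (simp add: ennreal_mult'[symmetric])
  finally show "emeasure \<nu> (space \<nu>) = 1" .
qed

lemma space_\<nu>: "space \<nu> = space (env_space S)"
  by (simp add: P_tilde_def space_P)

lemma fst_measurable: "fst \<in> state_space S \<rightarrow>\<^sub>M \<nu>"
  by (simp add: state_space_def cong: measurable_cong_sets add: sets_\<nu> sets_P)

abbreviation over where "over B \<equiv> fst -` B \<inter> space (state_space S)"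

lemma emeasure_\<kappa>:
  assumes "w \<in> space (env_space S)" and B[measurable]: "B \<in> sets (env_space S)"
  shows "emeasure (\<kappa> w) (over B) =
    (\<Sum>j. r (Suc j) w * indicator B (fwd (Suc j) w))"
proof -
  have s: "over B \<in> sets (state_space S)"
    by (rule measurable_sets[OF fst_measurable]) (simp add: sets_\<nu> sets_P B)
  have "emeasure (\<kappa> w) (over B) =
      (\<integral>\<^sup>+z. ennreal (block_prob q p w (fst z) (snd z)) * indicator B (fwd (fst z) w) \<partial>count_space ({1..} \<times> Upsilon))"
    unfolding emeasure_kernel'[OF assms(1) s]
    by (intro nn_integral_cong) (use measurable_space[OF measurable_env_shift assms(1)] in
      \<open>auto simp: state_space_def space_pair_measure split: split_indicator\<close>)
  also have "\<dots> = (\<Sum>j. r (Suc j) w * indicator B (fwd (Suc j) w))"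
    by (rule nn_integral_block_prob)
  finally show ?thesis .
qed

lemma \<kappa>_measurable: "\<kappa> \<in> \<nu> \<rightarrow>\<^sub>M subprob_algebra (state_space S)"
proof -
  have "(1 :: nat, [0]) \<in> space (count_space {1..} \<Otimes>\<^sub>M count_space Upsilon)"
    by (auto simp: space_pair_measure Upsilon_def)
  then have "(\<lambda>w. (w, 1, [0])) \<in> env_space S \<rightarrow>\<^sub>M state_space S"
    unfolding state_space_def by (intro measurable_Pair measurable_const) auto
  from measurable_compose[OF this measurable_kernel[OF q p]]
  show ?thesis by (simp cong: measurable_cong_sets add: sets_\<nu> sets_P)
qed

sublocale chain: env_chain \<nu> "state_space S" \<kappa> fst
proof (intro env_chain.intro env_chain_axioms.intro prob_space_\<nu> \<kappa>_measurable fst_measurable)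
  have "AE w in P. z w \<noteq> 0 \<longrightarrow> emeasure (\<kappa> w) (space (state_space S)) = 1"
    using recurrence AE_space
  proof eventually_elim
    case (elim w)
    have "emeasure (\<kappa> w) (space (state_space S)) = emeasure (\<kappa> w) (fst -` space (env_space S) \<inter> space (state_space S))"
      by (rule arg_cong[where f = "emeasure _"]) (auto simp: state_space_def space_pair_measure)
    also have "\<dots> = (\<Sum>j. r (Suc j) w)"
      using elim(2) measurable_space[OF measurable_env_shift, of w S] by (subst emeasure_\<kappa>) (auto simp: space_P)
    finally have *: "emeasure (\<kappa> w) (space (state_space S)) = (\<Sum>j. r (Suc j) w)" .
    show ?case
    proof
      assume "z w \<noteq> 0"
      then have "never_hit q p w = 0" using elim(1) by auto
      then show "emeasure (\<kappa> w) (space (state_space S)) = 1"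
        unfolding * using hit_total[of q p w] by simp
    qed
  qed
  then show "AE w in \<nu>. emeasure (\<kappa> w) (space (state_space S)) = 1" by (simp only: AE_\<nu>)
  fix B assume "B \<in> sets \<nu>"
  then have B[measurable]: "B \<in> sets P" and B': "B \<in> sets (env_space S)" by (simp_all add: sets_\<nu> sets_P)
  have "(\<integral>\<^sup>+w. emeasure (\<kappa> w) (over B) \<partial>\<nu>) =
      (\<integral>\<^sup>+w. (\<Sum>j. r (Suc j) w * indicator B (fwd (Suc j) w)) \<partial>\<nu>)"
    by (intro nn_integral_cong emeasure_\<kappa> B') (simp add: space_\<nu>)
  also have "\<dots> = ennreal (1 / pi_annealed q p P 0) * (\<integral>\<^sup>+w. z w * indicator B w \<partial>P)"
    by (subst nn_integral_\<nu>, measurable, subst invariance) auto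
  also have "\<dots> = (\<integral>\<^sup>+w. indicator B w \<partial>\<nu>)"
    by (rule nn_integral_\<nu>[symmetric]) measurable
  finally show "(\<integral>\<^sup>+w. emeasure (\<kappa> w) (over B) \<partial>\<nu>) = emeasure \<nu> B"
    by simp
qed

lemma chain_kernel_fst: "(\<lambda>x. \<kappa> (fst x)) = chain_kernel S q p"
  by (auto simp: chain_kernel_def fun_eq_iff)

lemma init_law_eq: "init_law S q p P = chain.Q"
  by (simp add: init_law_def)

text \<open>If time \<open>n\<close> can be a zero, it is reached through successive first zeros.
  Each jump keeps membership in \<open>B\<close> provided \<open>z\<close> is positive where it
  starts, and \<open>zero_prob_first_hit_le\<close> passes this positivity on to where it
  ends.\<close>

lemma zeros_agree:
  assumes B[measurable]: "B \<in> sets P"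
    and inv: "AE w in \<nu>. AE y in \<kappa> w. fst y \<in> B \<longleftrightarrow> w \<in> B"
  shows "AE w in P. \<forall>n. z w \<noteq> 0 \<longrightarrow> hit q p n w \<noteq> 0 \<longrightarrow> (fwd n w \<in> B \<longleftrightarrow> w \<in> B)"
proof -
  \<comment> \<open>The one-jump property. It is needed along the whole forward orbit of
    \<open>w\<close>; countably many shifts keep it almost sure.\<close>
  define G where "G w \<longleftrightarrow> (z w \<noteq> 0 \<longrightarrow> (\<forall>j. r (Suc j) w \<noteq> 0 \<longrightarrow> (fwd (Suc j) w \<in> B \<longleftrightarrow> w \<in> B)))" for w
  have "AE w in P. z w \<noteq> 0 \<longrightarrow> (AE y in \<kappa> w. fst y \<in> B \<longleftrightarrow> w \<in> B)"
    using inv by (simp only: AE_\<nu>)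
  then have "AE w in P. G w"
    using AE_space
  proof eventually_elim
    case (elim w)
    have w: "w \<in> space (env_space S)" using elim by (simp add: space_P)
    show ?case unfolding G_def
    proof (intro impI allI)
      fix j assume z: "z w \<noteq> 0" and rj: "r (Suc j) w \<noteq> 0"
      \<comment> \<open>The side of \<open>B\<close> on which \<open>w\<close> does not lie. The
        kernel gives it no mass, so no jump of positive probability lands there.\<close>
      define D where "D = (if w \<in> B then space P - B else B)"
      have D: "D \<in> sets P" using B sets.compl_sets[OF B] by (simp only: D_def split: if_split) simp
      have s: "over D \<in> sets (\<kappa> w)"
        unfolding sets_kernel by (rule measurable_sets[OF fst_measurable]) (simp add: sets_\<nu> D)
      have "AE y in \<kappa> w. y \<notin> over D"
        using elim(1)[rule_format, OF z] by eventually_elim (auto simp: D_def split: if_splits)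
      then have "emeasure (\<kappa> w) (over D) = 0"
        by (subst (asm) AE_iff_measurable[OF s]) (use sets.sets_into_space[OF s] in auto)
      then have "(\<Sum>j. r (Suc j) w * indicator D (fwd (Suc j) w)) = 0"
        using D by (subst (asm) emeasure_\<kappa>[OF w]) (auto simp: sets_P)
      then have "r (Suc j) w * indicator D (fwd (Suc j) w) = 0"
        by (subst (asm) suminf_eq_zero_iff) (auto intro: summableI)
      then have "fwd (Suc j) w \<notin> D" using rj by (auto split: split_indicator_asm)
      moreover have "fwd (Suc j) w \<in> space P"
        using measurable_space[OF measurable_env_shift w] by (simp add: space_P)
      ultimately show "fwd (Suc j) w \<in> B \<longleftrightarrow> w \<in> B" by (auto simp: D_def split: if_splits)
    qed
  qed
  then have "AE w in P. G (fwd m w)" for m by (rule AE_shift)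
  then have "AE w in P. \<forall>m. G (fwd m w)" by (simp add: AE_all_countable)
  then show ?thesis
  proof eventually_elim
    case (elim w)
    have "z (fwd m w) \<noteq> 0 \<Longrightarrow> hit q p n (fwd m w) \<noteq> 0 \<Longrightarrow>
        fwd (n + m) w \<in> B \<longleftrightarrow> fwd m w \<in> B" for n m
    proof (induction n arbitrary: m rule: less_induct)
      case (less n)
      let ?w = "fwd m w"
      show ?case
      proof (cases "n = 0")
        case False
        then have "(\<Sum>j=1..n. r j ?w * hit q p (n - j) (fwd j ?w)) \<noteq> 0"
          using less.prems(2) first_zero_decomposition[of n q p ?w] by simp
        \<comment> \<open>A first zero \<open>j\<close> with both factors positive; the remaining
          stretch has length \<open>n - j < n\<close>, so the induction applies at
          \<open>j\<close>.\<close>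
        then obtain j where j: "j \<in> {1..n}" "r j ?w * hit q p (n - j) (fwd j ?w) \<noteq> 0"
          by (meson sum.neutral)
        then have rj: "r (Suc (j - 1)) ?w \<noteq> 0" and hj: "hit q p (n - j) (fwd j ?w) \<noteq> 0" by auto
        have Sj: "Suc (j - 1) = j" using j by simp
        have eq: "fwd j ?w = fwd (j + m) w" by (simp add: env_shift_env_shift)
        have "z ?w * r j ?w \<noteq> 0" using less.prems(1) rj Sj by simp
        then have z: "z (fwd j ?w) \<noteq> 0"
          using zero_prob_first_hit_le[of ?w "j - 1"] Sj by auto
        have "fwd (n - j + (j + m)) w \<in> B \<longleftrightarrow> fwd (j + m) w \<in> B"
          using j(1) z hj by (intro less.IH) (auto simp: eq)
        moreover have "fwd (j + m) w \<in> B \<longleftrightarrow> ?w \<in> B"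
          using elim[rule_format, of m] less.prems(1) rj unfolding G_def Sj by (metis Sj eq)
        ultimately show ?thesis using j(1) by simp
      qed simp
    qed
    from this[of 0] show ?case by simp
  qed
qed

text \<open>Shifts to times that are not zeros need not preserve \<open>B\<close>, so ergodicity is
  applied to the invariant set \<open>V\<close> of environments some shift of which lies in
  \<open>B\<close> with positive \<open>z\<close>. Almost surely \<open>V\<close> and
  \<open>B\<close> agree where \<open>z\<close> is positive.\<close>

lemma zero_one:
  assumes B[measurable]: "B \<in> sets P"
    and inv: "AE w in \<nu>. AE y in \<kappa> w. fst y \<in> B \<longleftrightarrow> w \<in> B"
  shows "emeasure \<nu> B = 0 \<or> emeasure \<nu> B = 1"
proof -
  define H where "H w \<longleftrightarrow> (\<forall>n. z w \<noteq> 0 \<longrightarrow> z (fwd n w) \<noteq> 0 \<longrightarrow> (fwd n w \<in> B \<longleftrightarrow> w \<in> B))" for w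
  have "AE w in P. H w"
    using zeros_agree[OF assms]
  proof eventually_elim
    case (elim w)
    show ?case unfolding H_def
    proof (intro allI impI)
      fix n assume "z w \<noteq> 0" "z (fwd n w) \<noteq> 0"
      moreover from this have "hit q p n w \<noteq> 0"
        using zero_prob_le_hit[of q p n w] by auto
      ultimately show "fwd n w \<in> B \<longleftrightarrow> w \<in> B" using elim by blast
    qed
  qed
  then have "AE w in P. H (env_shift k w)" for k by (rule AE_shift)
  then have H: "AE w in P. \<forall>k::int. H (env_shift k w)" by (simp add: AE_all_countable)
  define V where "V = {w \<in> space P. \<exists>k::int. z (env_shift k w) \<noteq> 0 \<and> env_shift k w \<in> B}"
  have V: "V \<in> sets P" unfolding V_def by measurable
  have "env_shift 1 -` V \<inter> space P = V"
  proof (intro equalityI subsetI)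
    fix w assume "w \<in> env_shift 1 -` V \<inter> space P"
    then obtain k where "w \<in> space P" "z (env_shift (k + 1) w) \<noteq> 0" "env_shift (k + 1) w \<in> B"
      by (auto simp: V_def env_shift_env_shift)
    then show "w \<in> V" by (auto simp: V_def)
  next
    fix w assume w: "w \<in> V"
    then obtain k where "z (env_shift k w) \<noteq> 0" "env_shift k w \<in> B" by (auto simp: V_def)
    then have "z (env_shift (k - 1) (env_shift 1 w)) \<noteq> 0" "env_shift (k - 1) (env_shift 1 w) \<in> B"
      by (simp_all add: env_shift_env_shift)
    moreover have "env_shift 1 w \<in> space P"
      using measurable_space[OF shift_measurable] w by (auto simp: V_def)
    ultimately show "w \<in> env_shift 1 -` V \<inter> space P" using w by (auto simp: V_def)
  qed
  then have "prob V = 0 \<or> prob V = 1" using ergodic V by (auto simp: ergodic_under_def)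
  then show ?thesis
  proof
    assume "prob V = 0"
    then have "V \<in> null_sets P" using V by (auto simp: null_sets_def emeasure_eq_measure)
    then have "AE w in P. w \<notin> V" by (rule AE_not_in)
    then have "AE w in P. z w \<noteq> 0 \<longrightarrow> w \<notin> B"
      using AE_space
    proof eventually_elim
      case (elim w)
      then have "\<not> (z (env_shift 0 w) \<noteq> 0 \<and> env_shift 0 w \<in> B)" unfolding V_def by blast
      then show ?case by auto
    qed
    then have "AE w in \<nu>. w \<notin> B" by (simp only: AE_\<nu>)
    then have "emeasure \<nu> B = 0"
      by (subst (asm) AE_iff_measurable[of B]) (use sets.sets_into_space[OF B] in \<open>auto simp: sets_\<nu> space_\<nu> space_P\<close>)
    then show ?thesis ..
  next
    assume "prob V = 1"
    then have "AE w in P. w \<in> V" by (simp add: AE_in_set_eq_1 V)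
    then have "AE w in P. z w \<noteq> 0 \<longrightarrow> w \<in> B"
      using H
    proof eventually_elim
      case (elim w)
      then obtain k where k: "z (env_shift k w) \<noteq> 0" "env_shift k w \<in> B" by (auto simp: V_def)
      show ?case
      proof
        assume z: "z w \<noteq> 0"
        show "w \<in> B"
        \<comment> \<open>\<open>H\<close> compares an environment with its forward shifts; for
          negative \<open>k\<close> it is applied at the shifted environment, from which
          \<open>w\<close> is reached forward.\<close>
        proof (cases "k \<ge> 0")
          case True
          then have "int (nat k) = k" by simp
          then show ?thesis
            using elim(2)[rule_format, of 0] k z unfolding H_def env_shift_0 by metis
        next
          case False
          then have "fwd (nat (- k)) (env_shift k w) = w" by (simp add: env_shift_env_shift)
          then show ?thesis
            using elim(2)[rule_format, of k] k z unfolding H_def by metis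
        qed
      qed
    qed
    then have "AE w in \<nu>. w \<in> B" by (simp only: AE_\<nu>)
    then show ?thesis
      by (simp add: chain.nu.AE_in_set_eq_1 chain.nu.emeasure_eq_measure sets_\<nu>)
  qed
qed

theorem chain_stationary_ergodic:
  "(\<exists>!\<mu>. markov_chain_law (state_space S) (init_law S q p P) (chain_kernel S q p) \<mu>) \<and>
   (\<forall>\<mu>. markov_chain_law (state_space S) (init_law S q p P) (chain_kernel S q p) \<mu> \<longrightarrow>
      stationary_under \<mu> path_shift \<and> ergodic_under \<mu> path_shift)"
proof -
  have eq: "markov_chain_law (state_space S) (init_law S q p P) (chain_kernel S q p) = chain.is_law"
    unfolding chain_kernel_fst init_law_eq ..
  show ?thesis unfolding eq
  proof (intro conjI allI impI)
    show "\<exists>!\<mu>. chain.is_law \<mu>" using chain.law_exists chain.law_unique by blast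
    fix \<mu> assume "chain.is_law \<mu>"
    then interpret law: env_chain_law \<nu> "state_space S" \<kappa> fst \<mu> by (rule chain.env_chain_lawI)
    show "stationary_under \<mu> path_shift" by (rule law.stationary)
    show "ergodic_under \<mu> path_shift"
      by (rule law.ergodic, rule zero_one) (simp_all only: sets_\<nu>)
  qed
qed

end

section \<open>Means and extinction probabilities\<close>

text \<open>Bernoulli's inequality 1 - t^n \<le> n (1 - t), with \<open>s\<close> as a bound for 1 -
  t. Bounds of this kind are written additively because subtraction in \<open>ennreal\<close> is
  truncated.\<close>

lemma one_le_power_plus:
  fixes t s :: ennreal
  assumes t: "t \<le> 1" and ts: "1 \<le> t + s"
  shows "1 \<le> t ^ n + of_nat n * s"
proof (induction n)
  case (Suc n)
  have "t * (of_nat n * s) \<le> of_nat n * s" using t mult_right_mono[of t 1 "of_nat n * s"] by simp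
  then have "t * (t ^ n + of_nat n * s) \<le> t ^ Suc n + of_nat n * s" by (simp add: distrib_left add_left_mono)
  moreover have "t \<le> t * (t ^ n + of_nat n * s)" using mult_left_mono[OF Suc, of t] by simp
  ultimately have "t + s \<le> t ^ Suc n + of_nat n * s + s" by (intro add_right_mono) (rule order_trans)
  with ts have "1 \<le> t ^ Suc n + of_nat n * s + s" by (rule order_trans)
  then show ?case by (simp add: distrib_right add.assoc add.commute[of s])
qed simp

text \<open>The union bound for independent events: the defect of a product is at most the sum of
  the defects of its factors.\<close>

lemma one_le_prod_plus_sum:
  fixes t s :: "'i \<Rightarrow> ennreal"
  assumes "\<And>i. i \<in> A \<Longrightarrow> t i \<le> 1" "\<And>i. i \<in> A \<Longrightarrow> 1 \<le> t i + s i"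
  shows "1 \<le> (\<Prod>i\<in>A. t i) + (\<Sum>i\<in>A. s i)"
  using assms
proof (induction A rule: infinite_finite_induct)
  case (insert i A)
  let ?p = "\<Prod>i\<in>A. t i" and ?s = "\<Sum>i\<in>A. s i"
  have ti: "t i \<le> 1" "1 \<le> t i + s i" using insert.prems by auto
  have "t i * ?s \<le> ?s" using ti mult_right_mono[of "t i" 1 ?s] by simp
  then have "t i * (?p + ?s) \<le> t i * ?p + ?s" by (simp add: distrib_left add_left_mono)
  moreover have "t i \<le> t i * (?p + ?s)" using mult_left_mono[of 1 "?p + ?s" "t i"] insert by simp
  ultimately have "t i + s i \<le> t i * ?p + ?s + s i" by (intro add_right_mono) (rule order_trans)
  with ti(2) have "1 \<le> t i * ?p + ?s + s i" by (rule order_trans)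
  then show ?case using insert.hyps by (simp add: add.assoc add.commute[of "s i"])
qed auto

lemma one_le_vpow_plus:
  assumes "\<And>i. t i \<le> 1" "\<And>i. 1 \<le> t i + s i"
  shows "1 \<le> vpow t v + (\<Sum>i\<in>UNIV. of_nat (v $ i) * s i)"
  unfolding vpow_def
  by (rule one_le_prod_plus_sum) (auto intro: power_le_one one_le_power_plus assms)

definition pmf_mean :: "(nat^'d::finite) pmf \<Rightarrow> 'd \<Rightarrow> ennreal" where
  "pmf_mean \<mu> j = (\<integral>\<^sup>+v. of_nat (v $ j) \<partial>measure_pmf \<mu>)"

lemma vpow_le_1: "(\<And>i. t i \<le> 1) \<Longrightarrow> vpow t v \<le> 1"
  unfolding vpow_def by (intro prod_le_1) (auto intro: power_le_one)

lemma pgf_le_1: "(\<And>i. t i \<le> 1) \<Longrightarrow> pgf \<mu> t \<le> 1"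
  unfolding pgf_def
  using nn_integral_mono[of "measure_pmf \<mu>" "vpow t" "\<lambda>_. 1"] by (simp add: vpow_le_1)

lemma one_le_pgf_plus:
  assumes "\<And>i. t i \<le> 1" "\<And>i. 1 \<le> t i + s i"
  shows "1 \<le> pgf \<mu> t + (\<Sum>i\<in>UNIV. pmf_mean \<mu> i * s i)"
proof -
  have "1 = (\<integral>\<^sup>+v. 1 \<partial>measure_pmf \<mu>)" by simp
  also have "\<dots> \<le> (\<integral>\<^sup>+v. vpow t v + (\<Sum>i\<in>UNIV. of_nat (v $ i) * s i) \<partial>measure_pmf \<mu>)"
    by (intro nn_integral_mono one_le_vpow_plus assms)
  also have "\<dots> = pgf \<mu> t + (\<Sum>i\<in>UNIV. pmf_mean \<mu> i * s i)"
    by (simp add: nn_integral_add nn_integral_sum nn_integral_multc pgf_def pmf_mean_def)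
  finally show ?thesis .
qed

lemma pgf_nonzero: "(\<And>i. t i \<noteq> 0) \<Longrightarrow> pgf \<mu> t \<noteq> 0"
  unfolding pgf_def
  by (subst nn_integral_0_iff_AE) (auto simp: AE_measure_pmf_iff vpow_def set_pmf_not_empty ex_in_conv)

lemma pgf_mono: "(\<And>i. t i \<le> t' i) \<Longrightarrow> pgf \<mu> t \<le> pgf \<mu> t'"
  unfolding pgf_def vpow_def by (intro nn_integral_mono prod_mono_ennreal power_mono) auto

lemma die_le_1: "die p k w i \<le> 1"
  by (induction k arbitrary: w i) (auto intro: pgf_le_1)

text \<open>An extinct family stays extinct; positivity in the first generation thus passes to all
  later ones.\<close>

lemma die_1_le: "die p 1 w i \<le> die p (Suc k) w i"
  by (auto intro: pgf_mono)

lemma nn_integral_component: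
  fixes M :: "'i \<Rightarrow> 'a measure"
  assumes "\<And>i. prob_space (M i)" and [measurable]: "f \<in> borel_measurable (M k)"
  shows "(\<integral>\<^sup>+x. f (x k) \<partial>Pi\<^sub>M UNIV M) = (\<integral>\<^sup>+y. f y \<partial>M k)"
  using nn_integral_PiM_prod[of M "{k}" "\<lambda>_. f"] assms by simp

lemma nn_integral_offspring:
  "(\<integral>\<^sup>+\<xi>. f (offspring \<xi> n m i) \<partial>quenched q p w) = (\<integral>\<^sup>+v. f v \<partial>measure_pmf (p i (w (int n))))"
proof -
  interpret prob_space "imm_law q w" by (rule prob_space_imm_law)
  have "(\<integral>\<^sup>+\<xi>. f (offspring \<xi> n m i) \<partial>quenched q p w) =
      (\<integral>\<^sup>+z. (\<lambda>_. 1) (fst z) * (\<lambda>y. f (y (n, m, i))) (snd z) \<partial>(imm_law q w \<Otimes>\<^sub>M off_law p w))"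
    by (simp add: quenched_pair offspring_def)
  also have "\<dots> = (\<integral>\<^sup>+y. f (y (n, m, i)) \<partial>off_law p w)"
    by (subst nn_integral_pair_times[OF prob_space_imm_law prob_space_off_law])
      (auto simp: emeasure_space_1 intro!: measurable_compose[OF measurable_component_singleton])
  also have "\<dots> = (\<integral>\<^sup>+v. f v \<partial>measure_pmf (p i (w (int n))))"
    by (subst nn_integral_component) (auto simp: prob_space_measure_pmf)
  finally show ?thesis .
qed

lemma nn_integral_immigrants:
  "(\<integral>\<^sup>+\<xi>. f (immigrants \<xi> n) \<partial>quenched q p w) = (\<integral>\<^sup>+v. f v \<partial>measure_pmf (q (w (int n - 1))))"
proof -
  interpret prob_space "off_law p w" by (rule prob_space_off_law)
  have "(\<integral>\<^sup>+\<xi>. f (immigrants \<xi> n) \<partial>quenched q p w) =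
      (\<integral>\<^sup>+z. (\<lambda>x. f (x n)) (fst z) * (\<lambda>_. 1) (snd z) \<partial>(imm_law q w \<Otimes>\<^sub>M off_law p w))"
    by (simp add: quenched_pair immigrants_def)
  also have "\<dots> = (\<integral>\<^sup>+x. f (x n) \<partial>imm_law q w)"
    by (subst nn_integral_pair_times[OF prob_space_imm_law prob_space_off_law])
      (auto simp: emeasure_space_1 intro!: measurable_compose[OF measurable_component_singleton])
  also have "\<dots> = (\<integral>\<^sup>+v. f v \<partial>measure_pmf (q (w (int n - 1))))"
    by (subst nn_integral_component) (auto simp: prob_space_measure_pmf)
  finally show ?thesis .
qed

lemma offspring_measurable_quenched: "(\<lambda>\<xi>. real (offspring \<xi> n m i $ j)) \<in> borel_measurable (quenched q p w)"
  unfolding measurable_quenched_iff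
  by (rule measurable_compose[OF measurable_nth_count[OF measurable_offspring]]) simp

lemma immigrants_measurable_quenched: "(\<lambda>\<xi>. real (immigrants \<xi> n $ j)) \<in> borel_measurable (quenched q p w)"
  unfolding measurable_quenched_iff
  by (rule measurable_compose[OF measurable_nth_count[OF measurable_immigrants]]) simp

lemma nn_integral_offspring_mean:
  "(\<integral>\<^sup>+\<xi>. ennreal (real (offspring \<xi> n m i $ j)) \<partial>quenched q p w) = pmf_mean (p i (w (int n))) j"
  unfolding pmf_mean_def ennreal_of_nat_eq_real_of_nat by (rule nn_integral_offspring)

lemma nn_integral_immigrants_mean:
  "(\<integral>\<^sup>+\<xi>. ennreal (real (immigrants \<xi> n $ i)) \<partial>quenched q p w) = pmf_mean (q (w (int n - 1))) i"
  unfolding pmf_mean_def ennreal_of_nat_eq_real_of_nat by (rule nn_integral_immigrants)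

text \<open>An infinite mean becomes 0 here, as in the Bochner integral; bounds in terms of the
  matrix therefore carry \<open>finite_mean_matrix\<close>.\<close>

lemma mean_matrix_eq: "mean_matrix q p w n $ j $ i = enn2real (pmf_mean (p i (w (int n))) j)"
  by (simp add: mean_matrix_def integral_eq_nn_integral[OF offspring_measurable_quenched] nn_integral_offspring_mean)

lemma mean_immigration_eq: "mean_immigration q p w n $ i = enn2real (pmf_mean (q (w (int n - 1))) i)"
  by (simp add: mean_immigration_def integral_eq_nn_integral[OF immigrants_measurable_quenched] nn_integral_immigrants_mean)

lemma finite_mean_matrix_iff: "finite_mean_matrix q p w n \<longleftrightarrow> (\<forall>i j. pmf_mean (p i (w (int n))) j \<noteq> \<infinity>)"
  unfolding finite_mean_matrix_def integrable_iff_bounded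
  by (simp add: offspring_measurable_quenched nn_integral_offspring_mean less_top)

lemma finite_mean_immigration_iff: "finite_mean_immigration q p w n \<longleftrightarrow> (\<forall>i. pmf_mean (q (w (int n - 1))) i \<noteq> \<infinity>)"
  unfolding finite_mean_immigration_def integrable_iff_bounded
  by (simp add: immigrants_measurable_quenched nn_integral_immigrants_mean less_top)

lemma mean_matrix_shift: "mean_matrix q p (fwd k w) n = mean_matrix q p w (n + k)"
  by (simp add: vec_eq_iff mean_matrix_eq env_shift_def)

lemma mean_matrix_prod_add:
  "mean_matrix_prod q p w (a + b) = mean_matrix_prod q p (fwd b w) a ** mean_matrix_prod q p w b"
  by (induction a) (simp_all add: mean_matrix_shift matrix_mul_assoc)

lemma mean_matrix_nonneg: "0 \<le> mean_matrix q p w n $ j $ i"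
  by (simp add: mean_matrix_eq)

lemma mean_immigration_nonneg: "0 \<le> mean_immigration q p w n $ i"
  by (simp add: mean_immigration_eq)

lemma mean_matrix_prod_nonneg: "0 \<le> mean_matrix_prod q p w n $ j $ i"
  by (induction n arbitrary: i j)
    (auto simp: mat_def matrix_matrix_mult_def mean_matrix_nonneg intro!: sum_nonneg mult_nonneg_nonneg)

text \<open>Survival is at most as likely as the expected number of descendants is large, and column
  \<open>i\<close> of the matrix product lists these expectations by type. Conditioning on the first
  generation removes the rightmost factor, whereas \<open>mean_matrix_prod\<close> grows on the
  left; hence the detour through \<open>mean_matrix_prod_add\<close>.\<close>

lemma one_le_die_plus:
  assumes "\<And>n. finite_mean_matrix q p w n"
  shows "1 \<le> die p k w i + ennreal (\<Sum>l\<in>UNIV. mean_matrix_prod q p w k $ l $ i)"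
  using assms
proof (induction k arbitrary: w i)
  case 0
  show ?case by (simp add: mat_def)
next
  case (Suc k)
  let ?w = "env_shift 1 w"
  have fin: "finite_mean_matrix q p ?w n" for n
    using Suc.prems[of "Suc n"] by (simp add: finite_mean_matrix_iff env_shift_def add.commute)
  have m: "pmf_mean (p i (w 0)) j = ennreal (mean_matrix q p w 0 $ j $ i)" for j
    using Suc.prems[of 0] by (simp add: finite_mean_matrix_iff mean_matrix_eq less_top)
  have "(\<Sum>j\<in>UNIV. pmf_mean (p i (w 0)) j * ennreal (\<Sum>l\<in>UNIV. mean_matrix_prod q p ?w k $ l $ j)) =
      ennreal (\<Sum>j\<in>UNIV. mean_matrix q p w 0 $ j $ i * (\<Sum>l\<in>UNIV. mean_matrix_prod q p ?w k $ l $ j))"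
    unfolding m
    by (subst sum_ennreal[symmetric])
      (auto simp: ennreal_mult mean_matrix_nonneg mean_matrix_prod_nonneg sum_nonneg intro!: mult_nonneg_nonneg)
  also have "(\<Sum>j\<in>UNIV. mean_matrix q p w 0 $ j $ i * (\<Sum>l\<in>UNIV. mean_matrix_prod q p ?w k $ l $ j)) =
      (\<Sum>l\<in>UNIV. mean_matrix_prod q p w (Suc k) $ l $ i)"
  proof -
    have "mean_matrix_prod q p w (Suc k) = mean_matrix_prod q p ?w k ** mean_matrix q p w 0"
      using mean_matrix_prod_add[of q p w k 1] by simp
    then show ?thesis
      by (simp add: matrix_matrix_mult_def sum_distrib_left mult.commute del: mean_matrix_prod.simps) (rule sum.swap)
  qed
  finally show ?case
    using one_le_pgf_plus[of "die p k ?w" "\<lambda>j. ennreal (\<Sum>l\<in>UNIV. mean_matrix_prod q p ?w k $ l $ j)" "p i (w 0)"]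
      Suc.IH[OF fin] die_le_1[of p k ?w] by simp
qed

text \<open>The same first-moment bound for the immigrants of time 0; all entries are nonnegative,
  so summing the expected descendants over types gives the norm.\<close>

lemma one_le_fam_plus:
  assumes "\<And>n. finite_mean_matrix q p w n" "finite_mean_immigration q p w 0"
  shows "1 \<le> fam q p k w + ennreal (norm1 (mean_matrix_prod q p w k *v mean_immigration q p w 0))"
proof -
  let ?M = "mean_matrix_prod q p w k" and ?I = "mean_immigration q p w 0"
  have m: "pmf_mean (q (w (- 1))) j = ennreal (?I $ j)" for j
    using assms(2) by (simp add: finite_mean_immigration_iff mean_immigration_eq less_top)
  have "(\<Sum>j\<in>UNIV. pmf_mean (q (w (- 1))) j * ennreal (\<Sum>l\<in>UNIV. ?M $ l $ j)) =
      ennreal (\<Sum>j\<in>UNIV. ?I $ j * (\<Sum>l\<in>UNIV. ?M $ l $ j))"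
    unfolding m
    by (subst sum_ennreal[symmetric])
      (auto simp: ennreal_mult mean_immigration_nonneg mean_matrix_prod_nonneg sum_nonneg intro!: mult_nonneg_nonneg)
  also have "(\<Sum>j\<in>UNIV. ?I $ j * (\<Sum>l\<in>UNIV. ?M $ l $ j)) = (\<Sum>l\<in>UNIV. (?M *v ?I) $ l)"
    by (simp add: matrix_vector_mult_def sum_distrib_left mult.commute) (rule sum.swap)
  also have "\<dots> = norm1 (?M *v ?I)"
  proof -
    have "0 \<le> (?M *v ?I) $ l" for l
      by (auto simp: matrix_vector_mult_def mean_immigration_nonneg mean_matrix_prod_nonneg intro!: sum_nonneg)
    then show ?thesis by (simp add: norm1_def)
  qed
  finally show ?thesis
    using one_le_pgf_plus[of "die p k w" "\<lambda>j. ennreal (\<Sum>l\<in>UNIV. ?M $ l $ j)" "q (w (- 1))"]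
      one_le_die_plus[OF assms(1), of k] die_le_1[of p k w] by (simp add: fam_def)
qed

section \<open>The operator norm\<close>

lemma norm1_nonneg: "0 \<le> norm1 v"
  by (simp add: norm1_def sum_nonneg)

text \<open>The largest absolute column sum is the operator norm belonging to the 1-norm. This form
  shows that the supremum in \<open>opnorm1\<close> is attained, and it makes measurability
  evident.\<close>

definition max_col :: "real^'d^'d::finite \<Rightarrow> real" where
  "max_col A = (MAX i. \<Sum>j\<in>UNIV. \<bar>A $ j $ i\<bar>)"

lemma norm1_le_max_col: "norm1 (A *v v) \<le> max_col A * norm1 v"
proof -
  have "norm1 (A *v v) \<le> (\<Sum>j\<in>UNIV. \<Sum>i\<in>UNIV. \<bar>A $ j $ i\<bar> * \<bar>v $ i\<bar>)"
    unfolding norm1_def matrix_vector_mult_def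
    by (intro sum_mono) (auto simp: abs_mult[symmetric] intro: sum_abs)
  also have "\<dots> = (\<Sum>i\<in>UNIV. (\<Sum>j\<in>UNIV. \<bar>A $ j $ i\<bar>) * \<bar>v $ i\<bar>)"
    by (subst sum.swap) (simp add: sum_distrib_right)
  also have "\<dots> \<le> (\<Sum>i\<in>UNIV. max_col A * \<bar>v $ i\<bar>)"
    unfolding max_col_def by (intro sum_mono mult_right_mono Max_ge) auto
  finally show ?thesis by (simp add: norm1_def sum_distrib_left)
qed

lemma max_col_nonneg: "0 \<le> max_col A"
  unfolding max_col_def by (subst Max_ge_iff) (auto intro!: sum_nonneg)

lemma opnorm1_eq_max_col: "opnorm1 A = max_col A"
  unfolding opnorm1_def
proof (rule cSup_eq_maximum)
  have "max_col A \<in> range (\<lambda>i. \<Sum>j\<in>UNIV. \<bar>A $ j $ i\<bar>)"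
    unfolding max_col_def by (intro Max_in) auto
  then obtain i where i: "max_col A = (\<Sum>j\<in>UNIV. \<bar>A $ j $ i\<bar>)" by auto
  \<comment> \<open>The supremum is attained at the unit vector of a maximal column.\<close>
  have "norm1 (axis i 1) = 1" by (simp add: norm1_def axis_def if_distrib cong: if_cong)
  moreover have "norm1 (A *v axis i 1) = max_col A"
    by (simp add: i norm1_def matrix_vector_mult_basis column_def)
  ultimately show "max_col A \<in> range (\<lambda>v. norm1 (A *v v) / norm1 v)"
    by (intro image_eqI[of _ _ "axis i 1"]) auto
next
  fix x assume "x \<in> range (\<lambda>v. norm1 (A *v v) / norm1 v)"
  then obtain v where v: "x = norm1 (A *v v) / norm1 v" by auto
  show "x \<le> max_col A"
    using norm1_le_max_col[of A v] norm1_nonneg[of v] max_col_nonneg[of A]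
    by (cases "norm1 v = 0") (auto simp: v divide_le_eq)
qed

lemma opnorm1_nonneg: "0 \<le> opnorm1 A"
  by (simp add: opnorm1_eq_max_col max_col_nonneg)

lemma norm1_le_opnorm1: "norm1 (A *v v) \<le> opnorm1 A * norm1 v"
  by (simp add: opnorm1_eq_max_col norm1_le_max_col)

lemma opnorm1_mult_le: "opnorm1 (A ** B) \<le> opnorm1 A * opnorm1 B"
  unfolding opnorm1_def[of "A ** B"]
proof (rule cSUP_least)
  fix v
  have "norm1 ((A ** B) *v v) \<le> opnorm1 A * (opnorm1 B * norm1 v)"
    unfolding matrix_vector_mul_assoc[symmetric]
    by (rule order_trans[OF norm1_le_opnorm1 mult_left_mono[OF norm1_le_opnorm1 opnorm1_nonneg]])
  then show "norm1 ((A ** B) *v v) / norm1 v \<le> opnorm1 A * opnorm1 B"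
    using norm1_nonneg[of v] opnorm1_nonneg[of A] opnorm1_nonneg[of B]
    by (cases "norm1 v = 0") (auto simp: divide_le_eq mult.assoc)
qed simp

lemma opnorm1_mat_1_le: "opnorm1 (mat 1) \<le> 1"
  unfolding opnorm1_def by (rule cSUP_least) (auto simp: divide_le_eq norm1_nonneg)

lemma log_plus_nonneg: "0 \<le> log_plus x"
  by (simp add: log_plus_def)

lemma le_exp_log_plus: "0 \<le> x \<Longrightarrow> x \<le> exp (log_plus x)"
  by (cases "x = 0") (auto simp: log_plus_def max_def ln_ge_zero_iff)

text \<open>Serves twice: to make \<open>log_plus\<close> of the norm of a product integrable, and
  to bound an incomplete block of fewer than \<open>m\<close> factors.\<close>

lemma opnorm1_prod_le:
  "opnorm1 (mean_matrix_prod q p w n) \<le> exp (\<Sum>l<n. log_plus (opnorm1 (mean_matrix q p (fwd l w) 0)))"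
proof (induction n)
  case (Suc n)
  have "opnorm1 (mean_matrix_prod q p w (Suc n)) \<le> opnorm1 (mean_matrix q p w n) * opnorm1 (mean_matrix_prod q p w n)"
    by (simp add: opnorm1_mult_le)
  also have "\<dots> \<le> exp (log_plus (opnorm1 (mean_matrix q p w n))) * exp (\<Sum>l<n. log_plus (opnorm1 (mean_matrix q p (fwd l w) 0)))"
    by (intro mult_mono le_exp_log_plus opnorm1_nonneg Suc) simp
  finally show ?case by (simp add: mean_matrix_shift exp_add[symmetric] add.commute)
qed (simp add: opnorm1_mat_1_le)

section \<open>Positivity of the probability of zero\<close>

text \<open>Garsia's proof of the maximal ergodic lemma: F n x is the maximum of 0 and the first n Birkhoff sums.\<close>

lemma (in prob_space) maximal_ergodic:
  fixes f :: "'a \<Rightarrow> real"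
  assumes T[measurable]: "T \<in> M \<rightarrow>\<^sub>M M" and dT: "distr M M T = M" and f: "integrable M f" and neg: "(\<integral>x. f x \<partial>M) < 0"
  shows "\<not> (AE x in M. \<exists>n. 0 < (\<Sum>k<n. f ((T ^^ k) x)))"
proof
  assume pos: "AE x in M. \<exists>n. 0 < (\<Sum>k<n. f ((T ^^ k) x))"
  define F :: "nat \<Rightarrow> 'a \<Rightarrow> real" where "F = rec_nat (\<lambda>_. 0 :: real) (\<lambda>_ g x. max 0 (f x + g (T x)))"
  have F0: "F 0 x = 0" and FS: "F (Suc n) x = max 0 (f x + F n (T x))" for n x
    by (simp_all add: F_def)
  have fm[measurable]: "f \<in> borel_measurable M" using f by auto
  have intT: "integrable M (\<lambda>x. g (T x)) \<and> (\<integral>x. g (T x) \<partial>M) = (\<integral>x. g x \<partial>M)" if g: "integrable M g" for g :: "'a \<Rightarrow> real"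
  proof
    show "integrable M (\<lambda>x. g (T x))" by (rule integrable_distr[OF T]) (simp add: dT g)
    have [measurable]: "g \<in> borel_measurable M" using g by auto
    have "(\<integral>x. g x \<partial>distr M M T) = (\<integral>x. g (T x) \<partial>M)" by (rule integral_distr) measurable
    then show "(\<integral>x. g (T x) \<partial>M) = (\<integral>x. g x \<partial>M)" by (simp add: dT)
  qed
  have iF: "integrable M (F n)" for n
  proof (induction n)
    case (Suc n)
    have "integrable M (\<lambda>x. max 0 (f x + F n (T x)))"
      using intT[OF Suc] f by (intro integrable_max) auto
    then show ?case by (simp add: FS[abs_def])
  qed (simp add: F0[abs_def])
  have F_nonneg: "0 \<le> F n x" for n x by (cases n) (auto simp: F0 FS)
  have F_mono: "F n x \<le> F (Suc n) x" for n x
  proof (induction n arbitrary: x)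
    case 0 show ?case by (simp add: F0 FS)
  next
    case (Suc n) show ?case using Suc[of "T x"] unfolding FS[of "Suc n"] FS[of n] by linarith
  qed
  have S_le: "(\<Sum>k<n. f ((T ^^ k) x)) \<le> F n x" for n x
  proof (induction n arbitrary: x)
    case (Suc n)
    have "(\<Sum>k<Suc n. f ((T ^^ k) x)) = f x + (\<Sum>k<n. f ((T ^^ k) (T x)))"
      by (subst sum.lessThan_Suc_shift) (simp add: funpow_swap1)
    also have "\<dots> \<le> f x + F n (T x)" using Suc[of "T x"] by simp
    finally show ?case by (simp add: FS)
  qed (simp add: F0)
  define D where "D n = {x \<in> space M. 0 < F (Suc n) x}" for n
  have [measurable]: "F n \<in> borel_measurable M" for n using iF[of n] by auto
  have D[measurable]: "D n \<in> sets M" for n unfolding D_def by measurable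
  \<comment> \<open>On \<open>D n\<close> the difference \<open>F (Suc n) x - F n (T x)\<close> is
    \<open>f x\<close>; elsewhere \<open>F (Suc n) x = 0\<close> and the difference is at most 0.
    Its integral is nonnegative since \<open>F\<close> increases with \<open>n\<close> and
    \<open>T\<close> preserves the measure.\<close>
  have ge: "0 \<le> (\<integral>x. f x * indicator (D n) x \<partial>M)" for n
  proof -
    have "0 \<le> (\<integral>x. F (Suc n) x \<partial>M) - (\<integral>x. F n x \<partial>M)"
      using integral_mono[OF iF iF, of n "Suc n"] F_mono by simp
    also have "\<dots> = (\<integral>x. F (Suc n) x - F n (T x) \<partial>M)"
      using intT[OF iF[of n]] iF[of "Suc n"] by simp
    also have "\<dots> \<le> (\<integral>x. f x * indicator (D n) x \<partial>M)"
    proof (rule integral_mono)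
      show "integrable M (\<lambda>x. F (Suc n) x - F n (T x))" using intT[OF iF[of n]] iF[of "Suc n"] by simp
      show "integrable M (\<lambda>x. f x * indicator (D n) x)" using f by (rule integrable_real_mult_indicator[OF D])
      fix x assume "x \<in> space M"
      then show "F (Suc n) x - F n (T x) \<le> f x * indicator (D n) x"
        using F_nonneg[of n "T x"] by (cases "x \<in> D n") (auto simp: D_def FS)
    qed
    finally show ?thesis .
  qed
  \<comment> \<open>Under the assumption to be refuted, the sets \<open>D n\<close> exhaust the
    space up to a null set.\<close>
  have "(\<lambda>n. \<integral>x. f x * indicator (D n) x \<partial>M) \<longlonglongrightarrow> (\<integral>x. f x \<partial>M)"
  proof (rule integral_dominated_convergence[where w = "\<lambda>x. \<bar>f x\<bar>"])
    show "AE x in M. (\<lambda>n. f x * indicator (D n) x) \<longlonglongrightarrow> f x"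
      using pos AE_space
    proof eventually_elim
      case (elim x)
      then obtain n where "0 < (\<Sum>k<n. f ((T ^^ k) x))" by blast
      then have n: "0 < F n x" using S_le[of x n] by linarith
      have "0 < F (Suc m) x" if "n \<le> m" for m
        using lift_Suc_mono_le[of "\<lambda>n. F n x" n "Suc m"] F_mono n that by fastforce
      then have "\<forall>\<^sub>F m in sequentially. f x * indicator (D m) x = f x"
        using elim by (auto simp: eventually_sequentially D_def intro!: exI[of _ n])
      then show ?case by (rule tendsto_eventually)
    qed
    show "integrable M (\<lambda>x. \<bar>f x\<bar>)" using f by (rule integrable_abs)
    show "AE x in M. norm (f x * indicator (D n) x) \<le> \<bar>f x\<bar>" for n by (auto split: split_indicator)
  qed measurable
  then have "0 \<le> (\<integral>x. f x \<partial>M)" by (rule LIMSEQ_le_const) (use ge in auto)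
  then show False using neg by simp
qed

text \<open>Counts the integers below \<open>y\<close>; after integration this compares a sum of
  tail probabilities with an expectation.\<close>

lemma sum_indicator_le:
  fixes y :: real
  assumes "0 \<le> y"
  shows "(\<Sum>k<N. if real k < y then 1 else 0 :: real) \<le> y + 1"
proof -
  have "(\<Sum>k<N. if real k < y then 1 else 0 :: real) = real (card {k \<in> {..<N}. real k < y})"
    by (simp add: sum.If_cases Int_def)
  also have "\<dots> \<le> real (card {..<nat \<lceil>y\<rceil>})"
    by (intro of_nat_mono card_mono) (auto simp: zless_nat_eq_int_zless less_ceiling_iff)
  also have "\<dots> \<le> y + 1" using assms by simp
  finally show ?thesis .
qed

section \<open>Integrability along the orbit and the truncated logarithm\<close>

context branching_env
begin

abbreviation M where "M \<equiv> mean_matrix q p"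
abbreviation Mprod where "Mprod \<equiv> mean_matrix_prod q p"
abbreviation I where "I \<equiv> mean_immigration q p"

lemma integrable_shift: "integrable P g \<Longrightarrow> integrable P (\<lambda>w. g (env_shift k w) :: real)"
  by (rule integrable_distr[OF shift_measurable]) (simp add: distr_shift)

lemma integral_shift: "g \<in> borel_measurable P \<Longrightarrow> (\<integral>w. g (env_shift k w) \<partial>P) = (\<integral>w. g w \<partial>P :: real)"
  using integral_distr[OF shift_measurable[of k], of g] by (simp add: distr_shift)

text \<open>Borel-Cantelli: by stationarity the event \<open>\<delta> * real K < g (bwd K w)\<close>
  is as likely as \<open>real K < g w / \<delta>\<close>, and these probabilities are summable
  because \<open>g\<close> is integrable.\<close>

lemma sublinear:
  assumes g: "integrable P g" and nonneg: "\<And>w. 0 \<le> g w" and \<delta>: "0 < (\<delta> :: real)"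
  shows "AE w in P. \<forall>\<^sub>F K in sequentially. g (bwd K w) \<le> \<delta> * real K"
proof -
  define A where "A K = {w \<in> space P. \<delta> * real K < g (bwd K w)}" for K
  have gm[measurable]: "g \<in> borel_measurable P" using g by auto
  have A: "A K \<in> sets P" for K unfolding A_def by measurable
  have mA: "prob (A K) = (\<integral>w. (if real K < g w / \<delta> then 1 else 0) \<partial>P)" for K
  proof -
    have "prob (A K) = (\<integral>w. indicator (A K) w \<partial>P)" using A by simp
    also have "\<dots> = (\<integral>w. (if real K < g (bwd K w) / \<delta> then 1 else 0) \<partial>P)"
      using \<delta> by (intro Bochner_Integration.integral_cong) (auto simp: A_def field_simps)
    also have "\<dots> = (\<integral>w. (if real K < g w / \<delta> then 1 else 0) \<partial>P)"
      by (rule integral_shift[where g = "\<lambda>w. if real K < g w / \<delta> then 1 else 0"]) measurable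
    finally show ?thesis .
  qed
  have i: "integrable P (\<lambda>w. if real K < g w / \<delta> then 1 else 0 :: real)" for K
    by (rule integrable_const_bound[where B = 1]) auto
  have "(\<Sum>K<N. prob (A K)) \<le> (\<integral>w. g w / \<delta> + 1 \<partial>P)" for N
  proof -
    have "(\<Sum>K<N. prob (A K)) = (\<integral>w. (\<Sum>K<N. if real K < g w / \<delta> then 1 else 0) \<partial>P)"
      unfolding mA by (rule Bochner_Integration.integral_sum[symmetric]) (rule i)
    also have "\<dots> \<le> (\<integral>w. g w / \<delta> + 1 \<partial>P)"
      using g \<delta> nonneg by (intro integral_mono sum_indicator_le Bochner_Integration.integrable_sum i) auto
    finally show ?thesis .
  qed
  then have "summable (\<lambda>K. prob (A K))" by (intro summableI_nonneg_bounded) auto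
  from borel_cantelli_AE1[OF A _ this]
  have "AE w in P. \<forall>\<^sub>F K in sequentially. w \<in> space P - A K" by (simp add: emeasure_eq_measure)
  then show ?thesis
    by eventually_elim (auto simp: A_def not_less elim!: eventually_mono)
qed

lemma pmf_mean_measurable:
  assumes "(\<lambda>s. measure_pmf (h s)) \<in> S \<rightarrow>\<^sub>M prob_algebra (count_space UNIV)"
  shows "(\<lambda>w. pmf_mean (h (w k)) j) \<in> borel_measurable P"
proof -
  have "(\<lambda>w. w k) \<in> P \<rightarrow>\<^sub>M S" by measurable
  from measurable_compose[OF this measurable_prob_algebraD[OF assms]]
  show ?thesis unfolding pmf_mean_def
    by (rule measurable_compose) (rule nn_integral_measurable_subprob_algebra, simp)
qed

lemma mean_matrix_measurable[measurable]: "(\<lambda>w. M w n $ j $ i) \<in> borel_measurable P"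
  unfolding mean_matrix_eq using pmf_mean_measurable[OF p] by measurable

lemma mean_immigration_measurable[measurable]: "(\<lambda>w. I w n $ i) \<in> borel_measurable P"
  unfolding mean_immigration_eq using pmf_mean_measurable[OF q] by measurable

lemma mean_matrix_prod_measurable[measurable]: "(\<lambda>w. Mprod w n $ j $ i) \<in> borel_measurable P"
proof (induction n arbitrary: j i)
  case (Suc n)
  note Suc[measurable]
  show ?case by (simp add: matrix_matrix_mult_def)
qed simp

lemma opnorm1_prod_measurable[measurable]: "(\<lambda>w. opnorm1 (Mprod w n)) \<in> borel_measurable P"
  unfolding opnorm1_eq_max_col max_col_def by (rule borel_measurable_Max) auto

text \<open>By \<open>A3\<close> some \<open>m\<close> gives the log norm a negative mean, possibly
  -infinity. Cutting its negative part off at \<open>C\<close> yields an integrable \<phi> that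
  dominates it, and by monotone convergence the integral is still negative for large
  \<open>C\<close>.\<close>

lemma log_norm_integral_neg:
  assumes A2: "integrable P (\<lambda>w. log_plus (opnorm1 (M w 0)))"
    and A3: "\<exists>L<0. (\<lambda>n. ereal (1 / real n) *
               ext_expectation P (\<lambda>w. ext_log (opnorm1 (Mprod w n)))) \<longlonglongrightarrow> L"
  obtains m \<phi> where "1 \<le> m" "integrable P \<phi>" "(\<integral>w. \<phi> w \<partial>P) < 0"
    "\<And>w. opnorm1 (Mprod w m) \<le> exp (\<phi> w)"
proof -
  let ?y = "\<lambda>m w. opnorm1 (Mprod w m)"
  from A3 obtain L where L: "L < 0" "(\<lambda>n. ereal (1 / real n) * ext_expectation P (\<lambda>w. ext_log (?y n w))) \<longlonglongrightarrow> L" by blast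
  then have "\<forall>\<^sub>F n in sequentially. 1 \<le> n \<and> ereal (1 / real n) * ext_expectation P (\<lambda>w. ext_log (?y n w)) < 0"
    by (intro eventually_conj eventually_ge_at_top order_tendstoD(2)[OF L(2)])
  then obtain m where m: "1 \<le> m" "ereal (1 / real m) * ext_expectation P (\<lambda>w. ext_log (?y m w)) < 0"
    unfolding eventually_sequentially by blast
  define y where "y = ?y m"
  have y0: "0 \<le> y w" for w by (simp add: y_def opnorm1_nonneg)
  have ym[measurable]: "y \<in> borel_measurable P" unfolding y_def by measurable
  \<comment> \<open>The negative part of the logarithm, infinite where the matrix product
    vanishes.\<close>
  define b where "b w = e2ennreal (- ext_log (y w))" for w
  have b_eq: "b w = (if y w = 0 then \<infinity> else ennreal (- ln (y w)))" for w
    by (simp add: b_def ext_log_def e2ennreal_ereal)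
  have bm[measurable]: "b \<in> borel_measurable P" unfolding b_eq[abs_def] by measurable
  have a_eq: "e2ennreal (ext_log (y w)) = ennreal (log_plus (y w))" for w
    using y0[of w] by (auto simp: ext_log_def log_plus_def e2ennreal_ereal ennreal_neg max_def e2ennreal_neg)
  have "ext_expectation P (\<lambda>w. ext_log (y w)) < 0"
    using m unfolding y_def by (auto simp: ereal_mult_less_0_iff)
  then have neg: "enn2ereal (\<integral>\<^sup>+w. ennreal (log_plus (y w)) \<partial>P) - enn2ereal (\<integral>\<^sup>+w. b w \<partial>P) < 0"
    by (simp add: ext_expectation_def a_eq b_def)
  have lp: "integrable P (\<lambda>w. log_plus (y w))"
  proof (rule Bochner_Integration.integrable_bound)
    show "integrable P (\<lambda>w. \<Sum>l<m. log_plus (opnorm1 (M (fwd l w) 0)))"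
      by (intro Bochner_Integration.integrable_sum integrable_shift[OF A2])
    show "(\<lambda>w. log_plus (y w)) \<in> borel_measurable P" unfolding log_plus_def by measurable
    have "log_plus (y w) \<le> (\<Sum>l<m. log_plus (opnorm1 (M (fwd l w) 0)))" (is "_ \<le> ?s") for w
    proof -
      have "0 \<le> ?s" by (intro sum_nonneg log_plus_nonneg)
      moreover have "ln (y w) \<le> ?s" if "y w > 0"
        using opnorm1_prod_le[of q p w m] that ln_le_cancel_iff[of "y w" "exp ?s"] unfolding y_def by simp
      ultimately show ?thesis using y0[of w] by (cases "y w = 0") (auto simp: log_plus_def)
    qed
    then show "AE w in P. norm (log_plus (y w)) \<le> norm (\<Sum>l<m. log_plus (opnorm1 (M (fwd l w) 0)))"
      using log_plus_nonneg by (auto intro!: AE_I2 simp: sum_nonneg)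
  qed
  define a where "a = (\<integral>w. log_plus (y w) \<partial>P)"
  have a: "(\<integral>\<^sup>+w. ennreal (log_plus (y w)) \<partial>P) = ennreal a"
    unfolding a_def using lp by (intro nn_integral_eq_integral) (auto simp: log_plus_nonneg)
  have "ennreal a < (\<integral>\<^sup>+w. b w \<partial>P)"
  proof (rule ccontr)
    assume "\<not> ennreal a < (\<integral>\<^sup>+w. b w \<partial>P)"
    then have "enn2ereal (\<integral>\<^sup>+w. b w \<partial>P) \<le> enn2ereal (ennreal a)" by (simp add: not_less less_eq_ennreal.rep_eq[symmetric])
    then have "0 \<le> enn2ereal (ennreal a) - enn2ereal (\<integral>\<^sup>+w. b w \<partial>P)"
      by (intro ereal_diff_positive)
    then show False using neg a by simp
  qed
  also have "(\<integral>\<^sup>+w. b w \<partial>P) = (\<integral>\<^sup>+w. (SUP C::nat. min (b w) (of_nat C)) \<partial>P)"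
  proof (intro nn_integral_cong)
    fix w
    have "(SUP C::nat. min (b w) (of_nat C)) = min (b w) (SUP C::nat. of_nat C)"
      by (simp add: inf_SUP[of "b w" _ UNIV, unfolded inf_min])
    then show "b w = (SUP C::nat. min (b w) (of_nat C))" by (simp add: ennreal_SUP_of_nat_eq_top)
  qed
  also have "\<dots> = (SUP C::nat. \<integral>\<^sup>+w. min (b w) (of_nat C) \<partial>P)"
    by (rule nn_integral_monotone_convergence_SUP) (auto simp: incseq_def le_fun_def min_le_iff_disj intro!: min.mono)
  finally obtain C :: nat where C: "ennreal a < (\<integral>\<^sup>+w. min (b w) (of_nat C) \<partial>P)"
    unfolding less_SUP_iff by blast
  define c where "c w = enn2real (min (b w) (of_nat C))" for w
  have cb: "min (b w) (of_nat C) = ennreal (c w)" for w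
    unfolding c_def by (subst ennreal_enn2real) (auto simp: min_less_iff_disj ennreal_of_nat_eq_real_of_nat)
  have [measurable]: "c \<in> borel_measurable P" unfolding c_def[abs_def] by measurable
  have cC: "0 \<le> c w" "c w \<le> real C" for w
  proof -
    show "0 \<le> c w" by (simp add: c_def)
    have "ennreal (c w) \<le> ennreal (real C)" unfolding cb[symmetric] by (simp add: ennreal_of_nat_eq_real_of_nat)
    then show "c w \<le> real C" by (simp add: ennreal_le_iff)
  qed
  have ci: "integrable P c" by (rule integrable_const_bound[where B = "real C"]) (use cC in auto)
  have "(\<integral>\<^sup>+w. min (b w) (of_nat C) \<partial>P) = ennreal (\<integral>w. c w \<partial>P)"
    unfolding cb using ci cC by (intro nn_integral_eq_integral) auto
  with C have ac: "a < (\<integral>w. c w \<partial>P)"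
    by (simp add: ennreal_less_iff a_def log_plus_nonneg)
  show ?thesis
  proof
    show "1 \<le> m" by fact
    show "integrable P (\<lambda>w. log_plus (y w) - c w)" using lp ci by simp
    show "(\<integral>w. log_plus (y w) - c w \<partial>P) < 0" using lp ci ac by (simp add: a_def)
    fix w
    show "opnorm1 (Mprod w m) \<le> exp (log_plus (y w) - c w)"
    proof (cases "y w = 0")
      case False
      then have y: "0 < y w" using y0[of w] by simp
      have "ennreal (c w) \<le> ennreal (max 0 (- ln (y w)))"
        unfolding cb[symmetric] using False by (simp add: b_eq min_le_iff_disj ennreal_max_0)
      then have "c w \<le> max 0 (- ln (y w))" by (subst (asm) ennreal_le_iff) auto
      then have "ln (y w) \<le> log_plus (y w) - c w" by (auto simp: log_plus_def max_def split: if_splits)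
      then have "exp (ln (y w)) \<le> exp (log_plus (y w) - c w)" by simp
      then have "y w \<le> exp (log_plus (y w) - c w)" by (simp only: exp_ln[OF y])
      then show ?thesis by (simp add: y_def)
    qed (simp add: y_def)
  qed
qed

end

section \<open>Positivity from summable survival probabilities\<close>

context branching_env
begin

text \<open>An infinite product of positive factors with summable defects is positive: beyond
  \<open>K\<close> the defects sum to at most 1/2, so every product over later indices is at least
  1/2 by \<open>one_le_prod_plus_sum\<close>.\<close>

lemma zero_prob_pos_of_summable:
  assumes fam_pos: "\<And>k. 1 \<le> k \<Longrightarrow> fam q p k (bwd k w) \<noteq> 0"
    and c: "\<And>k. 1 \<le> fam q p k (bwd k w) + ennreal (c k)" "\<And>k. 0 \<le> c k" "summable c"
  shows "zero_prob q p w \<noteq> 0"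
proof -
  let ?a = "\<lambda>k. fam q p k (bwd k w)"
  obtain K where K: "\<And>m. norm (\<Sum>k\<in>{K..<m}. c k) < 1 / 2"
  proof -
    from c(3) have "\<exists>K. \<forall>m\<ge>K. \<forall>n. norm (\<Sum>k\<in>{m..<n}. c k) < 1 / 2"
      unfolding summable_Cauchy by (meson half_gt_zero zero_less_one)
    then show ?thesis using that by blast
  qed
  define b where "b = (\<Prod>k=1..K. ?a k)"
  have b: "b \<noteq> 0" unfolding b_def by (auto simp: prod_zero_iff fam_pos)
  have tail: "ennreal (1 / 2) \<le> (\<Prod>k\<in>{K<..n}. ?a k)" for n
  proof -
    have "1 \<le> (\<Prod>k\<in>{K<..n}. ?a k) + (\<Sum>k\<in>{K<..n}. ennreal (c k))"
      by (rule one_le_prod_plus_sum) (auto simp: fam_le_1 c)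
    moreover have "(\<Sum>k\<in>{K<..n}. ennreal (c k)) \<le> ennreal (1 / 2)"
    proof -
      have "(\<Sum>k\<in>{K<..n}. c k) \<le> (\<Sum>k\<in>{K..<Suc n}. c k)" by (rule sum_mono2) (auto simp: c)
      also have "\<dots> \<le> 1 / 2" using K[of "Suc n"] by (simp add: abs_if split: if_splits)
      finally have "ennreal (\<Sum>k\<in>{K<..n}. c k) \<le> ennreal (1 / 2)" by (rule ennreal_leI)
      then show ?thesis by (subst sum_ennreal) (simp_all only: c)
    qed
    ultimately have "1 \<le> (\<Prod>k\<in>{K<..n}. ?a k) + ennreal (1 / 2)"
      by (meson add_left_mono order_trans)
    then have "1 - ennreal (1 / 2) \<le> (\<Prod>k\<in>{K<..n}. ?a k)"
      by (simp add: ennreal_minus_le_iff add.commute)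
    also have "1 - ennreal (1 / 2) = ennreal (1 / 2)"
      using ennreal_minus[of "1 / 2" 1] by simp
    finally show ?thesis .
  qed
  have "b * ennreal (1 / 2) \<le> zero_prob q p w"
    unfolding zero_prob_INF
  proof (rule INF_greatest)
    fix n
    define N where "N = max n K"
    have "b * ennreal (1 / 2) \<le> b * (\<Prod>k\<in>{K<..N}. ?a k)" by (intro mult_left_mono tail) simp
    also have "\<dots> = (\<Prod>k=1..N. ?a k)"
      unfolding b_def by (subst prod.union_disjoint[symmetric]) (auto simp: N_def intro!: prod.cong)
    also have "\<dots> = hit q p N (bwd N w)" by (simp add: hit_shift)
    also have "\<dots> \<le> hit q p n (bwd n w)" by (rule hit_shift_antimono) (simp add: N_def)
    finally show "b * ennreal (1 / 2) \<le> hit q p n (bwd n w)" .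
  qed
  moreover have "b * ennreal (1 / 2) \<noteq> 0" using b by simp
  ultimately show ?thesis by auto
qed

text \<open>The start \<open>1\<close> is the all-ones vector, so reaching 0 in one step requires an
  individual of every type to have no offspring. Hence \<open>die p 1 w i\<close> is positive for
  each \<open>i\<close>, and \<open>die_1_le\<close> covers later generations.\<close>

lemma fam_pos:
  assumes ext: "AE w in P. measure (quenched q p w) {\<xi> \<in> space (quenched q p w). Z 1 \<xi> 1 = 0} > 0"
  shows "AE w in P. \<forall>k\<ge>1. fam q p k (bwd k w) \<noteq> 0"
proof -
  have "AE w in P. \<forall>i. die p 1 w i \<noteq> 0"
    using ext
  proof eventually_elim
    case (elim w)
    interpret Q: prob_space "quenched q p w" by (rule prob_space_quenched)
    have "emeasure (quenched q p w) {\<xi>. Z 1 \<xi> 1 = 0} \<noteq> 0"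
      using elim by (simp add: space_quenched Q.emeasure_eq_measure)
    then have "vpow (die p 1 w) 1 \<noteq> 0" unfolding emeasure_Z_eq_0 by auto
    then show ?case by (simp add: vpow_def prod_zero_iff)
  qed
  then have "AE w in P. \<forall>k::nat. \<forall>i. die p 1 (bwd k w) i \<noteq> 0"
    unfolding AE_all_countable[where P = "\<lambda>k w. \<forall>i. die p 1 (bwd k w) i \<noteq> 0"] by (intro allI AE_shift)
  then show ?thesis
  proof eventually_elim
    case (elim w)
    show ?case
    proof (intro allI impI)
      fix k :: nat assume "1 \<le> k"
      then obtain n where k: "k = Suc n" by (cases k) auto
      have "die p k (bwd k w) i \<noteq> 0" for i
        using elim[rule_format, of k i] die_1_le[of p "bwd k w" i n] unfolding k by auto
      then show "fam q p k (bwd k w) \<noteq> 0" unfolding fam_def by (rule pgf_nonzero)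
    qed
  qed
qed

text \<open>Going back in time, \<open>m * n\<close> generations split into \<open>n\<close> blocks
  of length \<open>m\<close>; block \<open>k\<close> starts at time
  \<open>- m * Suc k\<close>.\<close>

lemma matrix_prod_decay:
  assumes \<phi>: "\<And>w. opnorm1 (Mprod w m) \<le> exp (\<phi> w)"
  shows "opnorm1 (Mprod (bwd (m * n) w) (m * n)) \<le>
    exp (\<Sum>k<n. \<phi> (bwd (m * Suc k) w))"
proof (induction n)
  case (Suc n)
  let ?w = "bwd (m * Suc n) w"
  have "Mprod ?w (m * Suc n) = Mprod (fwd m ?w) (m * n) ** Mprod ?w m"
    using mean_matrix_prod_add[of q p ?w "m * n" m] by (simp add: add.commute)
  moreover have "fwd m ?w = bwd (m * n) w"
    by (simp add: env_shift_env_shift algebra_simps)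
  ultimately have "opnorm1 (Mprod ?w (m * Suc n)) \<le>
      opnorm1 (Mprod (bwd (m * n) w) (m * n)) * opnorm1 (Mprod ?w m)"
    by (simp add: opnorm1_mult_le)
  also have "\<dots> \<le> exp (\<Sum>k<n. \<phi> (bwd (m * Suc k) w)) * exp (\<phi> ?w)"
    by (intro mult_mono Suc \<phi> opnorm1_nonneg) simp
  finally show ?case by (simp add: exp_add)
qed (simp add: opnorm1_mat_1_le)

text \<open>Write \<open>K = m * n + r'\<close>. The last \<open>m * n\<close> generations before
  time 0 contribute exp(-\<epsilon> n); the first \<open>r' < m\<close> generations and the
  immigration contribute at most exp(\<epsilon> K / (2 m)). Since K \<le> m (n + 1), half of the
  rate \<epsilon> / m per generation remains, and rounding costs the factor exp \<epsilon>.\<close>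

lemma survival_bound:
  fixes m :: nat
  assumes m: "1 \<le> m" and \<epsilon>: "0 < \<epsilon>"
    and decay: "\<And>n. opnorm1 (Mprod (bwd (m * n) w) (m * n)) \<le> exp (- \<epsilon> * real n)"
    and rest: "(\<Sum>l<m. log_plus (opnorm1 (M (fwd l (bwd K w)) 0))) +
      log_plus (norm1 (I (bwd K w) 0)) \<le> \<epsilon> / (2 * real m) * real K"
  shows "norm1 (Mprod (bwd K w) K *v I (bwd K w) 0)
    \<le> exp \<epsilon> * exp (- \<epsilon> / (2 * real m)) ^ K"
proof -
  let ?w = "bwd K w"
  let ?l = "\<lambda>l. log_plus (opnorm1 (M (fwd l ?w) 0))"
  let ?im = "I ?w 0"
  define n where "n = K div m"
  define r' where "r' = K mod m"
  have K: "K = m * n + r'" and r': "r' < m" using m by (auto simp: n_def r'_def)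
  have "Mprod ?w K = Mprod (fwd r' ?w) (m * n) ** Mprod ?w r'"
    using mean_matrix_prod_add[of q p ?w "m * n" r'] by (simp add: K)
  also have "fwd r' ?w = bwd (m * n) w"
    by (simp add: env_shift_env_shift K)
  finally have prod: "Mprod ?w K = Mprod (bwd (m * n) w) (m * n) ** Mprod ?w r'" .
  have "norm1 (Mprod ?w K *v ?im) \<le> opnorm1 (Mprod ?w K) * norm1 ?im"
    by (rule norm1_le_opnorm1)
  also have "\<dots> \<le> (opnorm1 (Mprod (bwd (m * n) w) (m * n)) * opnorm1 (Mprod ?w r')) * norm1 ?im"
    unfolding prod by (intro mult_right_mono opnorm1_mult_le norm1_nonneg)
  also have "\<dots> \<le> (exp (- \<epsilon> * real n) * exp (\<Sum>l<r'. ?l l)) * exp (log_plus (norm1 ?im))"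
    by (intro mult_mono decay opnorm1_prod_le le_exp_log_plus opnorm1_nonneg norm1_nonneg mult_nonneg_nonneg) auto
  also have "\<dots> = exp (- \<epsilon> * real n + (\<Sum>l<r'. ?l l) + log_plus (norm1 ?im))" by (simp only: exp_add)
  also have "\<dots> \<le> exp (\<epsilon> + - \<epsilon> / (2 * real m) * real K)"
  proof -
    have "(\<Sum>l<r'. ?l l) \<le> (\<Sum>l<m. ?l l)" using r' by (intro sum_mono2) (auto simp: log_plus_nonneg)
    moreover define y where "y = \<epsilon> / (2 * real m) * real K"
    ultimately have 1: "(\<Sum>l<r'. ?l l) + log_plus (norm1 ?im) \<le> y" using rest by linarith
    have "real K \<le> real m * (real n + 1)"
      using r' by (simp add: K algebra_simps)
    then have "\<epsilon> * real K \<le> \<epsilon> * (real m * (real n + 1))" using \<epsilon> by (intro mult_left_mono) auto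
    then have 2: "2 * y \<le> \<epsilon> * real n + \<epsilon>" using m by (simp add: y_def field_simps)
    have "- \<epsilon> / (2 * real m) * real K = - y" by (simp add: y_def)
    then show ?thesis using 1 2 unfolding exp_le_cancel_iff by simp
  qed
  also have "\<dots> = exp \<epsilon> * exp (- \<epsilon> / (2 * real m)) ^ K"
    unfolding exp_add mult.commute[of _ "real K"] exp_of_nat_mult ..
  finally show ?thesis .
qed

text \<open>If \<open>zero_prob\<close> vanished almost everywhere, almost every orbit would have a
  positive Birkhoff sum of \<open>f\<close>: otherwise the matrix products decay geometrically, the
  survival probabilities are summable and \<open>zero_prob\<close> is positive. The maximal ergodic
  lemma excludes this, since \<open>f\<close> has negative integral.\<close>

lemma positive_probability:
  assumes A1: "AE w in P. finite_mean_immigration q p w 0"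
            "integrable P (\<lambda>w. log_plus (norm1 (I w 0)))"
    and A2: "AE w in P. finite_mean_matrix q p w 0"
            "integrable P (\<lambda>w. log_plus (opnorm1 (M w 0)))"
    and A3: "\<exists>L<0. (\<lambda>n. ereal (1 / real n) *
               ext_expectation P (\<lambda>w. ext_log (opnorm1 (Mprod w n)))) \<longlonglongrightarrow> L"
    and ext: "AE w in P. measure (quenched q p w) {\<xi> \<in> space (quenched q p w). Z 1 \<xi> 1 = 0} > 0"
  shows "(\<integral>\<^sup>+w. zero_prob q p w \<partial>P) \<noteq> 0"
proof
  assume "(\<integral>\<^sup>+w. zero_prob q p w \<partial>P) = 0"
  then have z0: "AE w in P. zero_prob q p w = 0" by (subst (asm) nn_integral_0_iff_AE) auto
  obtain m \<phi> where m: "1 \<le> m" and \<phi>: "integrable P \<phi>" "(\<integral>w. \<phi> w \<partial>P) < 0"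
    "\<And>w. opnorm1 (Mprod w m) \<le> exp (\<phi> w)"
    by (rule log_norm_integral_neg[OF A2(2) A3]) blast
  \<comment> \<open>Half of the size of the negative mean of \<phi>, so that adding \<epsilon> still
    leaves the negative integral -\<epsilon>.\<close>
  define \<epsilon> where "\<epsilon> = - (\<integral>w. \<phi> w \<partial>P) / 2"
  have \<epsilon>: "0 < \<epsilon>" using \<phi>(2) by (simp add: \<epsilon>_def)
  \<comment> \<open>Half of the decay rate \<epsilon> / m per generation, so that the sublinear
    corrections cannot use up the decay.\<close>
  define \<delta> where "\<delta> = \<epsilon> / (2 * real m)"
  have \<delta>: "0 < \<delta>" using \<epsilon> m by (simp add: \<delta>_def)
  define f where "f w = \<phi> (bwd m w) + \<epsilon>" for w
  have [measurable]: "\<phi> \<in> borel_measurable P" using \<phi>(1) by auto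
  have fi: "integrable P f" unfolding f_def[abs_def] using integrable_shift[OF \<phi>(1)] by simp
  have "(\<integral>w. f w \<partial>P) = (\<integral>w. \<phi> w \<partial>P) + \<epsilon>"
    unfolding f_def using integrable_shift[OF \<phi>(1)] by (simp add: integral_shift prob_space)
  then have fneg: "(\<integral>w. f w \<partial>P) < 0" using \<phi>(2) by (simp add: \<epsilon>_def)
  have iter: "(bwd m ^^ k) w = bwd (m * k) w" for k w
    by (induction k) (simp_all add: env_shift_env_shift algebra_simps)
  \<comment> \<open>Bounds the logarithmic cost of the immigration and of an incomplete block at the
    start.\<close>
  define \<psi> where "\<psi> w = (\<Sum>l<m. log_plus (opnorm1 (M (fwd l w) 0))) +
      log_plus (norm1 (I w 0))" for w
  have "integrable P \<psi>" unfolding \<psi>_def[abs_def]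
    by (intro Bochner_Integration.integrable_add Bochner_Integration.integrable_sum A1(2) integrable_shift[OF A2(2)])
  then have sub: "AE w in P. \<forall>\<^sub>F K in sequentially. \<psi> (bwd K w) \<le> \<delta> * real K"
    by (rule sublinear[OF _ _ \<delta>]) (auto simp: \<psi>_def intro!: add_nonneg_nonneg sum_nonneg log_plus_nonneg)
  have fin: "AE w in P. (\<forall>k::int. finite_mean_immigration q p (env_shift k w) 0) \<and> (\<forall>k::int. finite_mean_matrix q p (env_shift k w) 0)"
    unfolding AE_conj_iff AE_all_countable using AE_shift[OF A1(1)] AE_shift[OF A2(1)] by blast
  have "AE w in P. \<exists>n. 0 < (\<Sum>k<n. f ((bwd m ^^ k) w))"
    using z0 sub fin fam_pos[OF ext]
  proof eventually_elim
    case (elim w)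
    show ?case
    proof (rule ccontr)
      assume "\<not> (\<exists>n. 0 < (\<Sum>k<n. f ((bwd m ^^ k) w)))"
      \<comment> \<open>Nonpositive Birkhoff sums say that \<phi> summed over \<open>n\<close>
        blocks is at most \<open>- \<epsilon> * n\<close>, for every \<open>n\<close> and not merely
        in the limit.\<close>
      then have S: "(\<Sum>k<n. f ((bwd m ^^ k) w)) \<le> 0" for n by (simp add: not_less)
      have decay: "opnorm1 (Mprod (bwd (m * n) w) (m * n)) \<le> exp (- \<epsilon> * real n)" for n
      proof -
        have e: "bwd m (bwd (m * k) w) = bwd (m * Suc k) w" for k
          by (simp add: env_shift_env_shift algebra_simps)
        have "(\<Sum>k<n. \<phi> (bwd (m * Suc k) w)) + \<epsilon> * real n \<le> 0"
          using S[of n] unfolding f_def iter e by (simp add: sum.distrib mult.commute)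
        then have "(\<Sum>k<n. \<phi> (bwd (m * Suc k) w)) \<le> - \<epsilon> * real n" by simp
        then show ?thesis
          using matrix_prod_decay[OF \<phi>(3), of n w] by (meson exp_le_cancel_iff order_trans)
      qed
      define c where "c K = norm1 (Mprod (bwd K w) K *v I (bwd K w) 0)" for K
      have "\<forall>\<^sub>F K in sequentially. norm (c K) \<le> exp \<epsilon> * exp (- \<epsilon> / (2 * real m)) ^ K"
        using elim(2)
      proof eventually_elim
        case (elim K)
        then show ?case
          unfolding c_def \<psi>_def \<delta>_def real_norm_def abs_of_nonneg[OF norm1_nonneg]
          by (rule survival_bound[OF m \<epsilon> decay])
      qed
      moreover have "summable (\<lambda>K. exp \<epsilon> * exp (- \<epsilon> / (2 * real m)) ^ K)"
        using \<epsilon> m by (intro summable_mult summable_geometric) (simp add: divide_neg_pos)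
      ultimately have sm: "summable c" by (rule summable_comparison_test_ev)
      have fm: "finite_mean_matrix q p (bwd K w) n" for n K
        using elim(3)[THEN conjunct2, rule_format, of "int n - int K"]
        by (simp add: finite_mean_matrix_iff env_shift_def algebra_simps)
      have "zero_prob q p w \<noteq> 0"
      proof (rule zero_prob_pos_of_summable)
        fix k show "1 \<le> fam q p k (bwd k w) + ennreal (c k)"
          unfolding c_def using elim(3) by (intro one_le_fam_plus fm) auto
        show "0 \<le> c k" by (simp add: c_def norm1_nonneg)
      qed (use elim(4) sm in simp_all)
      then show False using elim(1) by simp
    qed
  qed
  then show False
    using maximal_ergodic[OF shift_measurable distr_shift fi fneg, of "- int m"] by simp
qed

end

theorem proposition4p3:
  fixes S :: "'s measure"
    and P :: "(int \<Rightarrow> 's) measure"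
    and q :: "'s \<Rightarrow> (nat^'d::finite) pmf"
    and p :: "'d \<Rightarrow> 's \<Rightarrow> (nat^'d) pmf"
  assumes P_prob: "prob_space P" and P_sets: "sets P = sets (env_space S)"
    and P_stationary: "stationary_under P (env_shift 1)"
    and P_ergodic: "ergodic_under P (env_shift 1)"
    and q_measurable: "(\<lambda>s. measure_pmf (q s)) \<in> S \<rightarrow>\<^sub>M prob_algebra (count_space UNIV)"
    and p_measurable: "\<And>i. (\<lambda>s. measure_pmf (p i s)) \<in> S \<rightarrow>\<^sub>M prob_algebra (count_space UNIV)"
    and A1: "AE \<omega> in P. finite_mean_immigration q p \<omega> 0"
            "integrable P (\<lambda>\<omega>. log_plus (norm1 (mean_immigration q p \<omega> 0)))"
    and A2: "AE \<omega> in P. finite_mean_matrix q p \<omega> 0"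
            "integrable P (\<lambda>\<omega>. log_plus (opnorm1 (mean_matrix q p \<omega> 0)))"
    and A3: "\<exists>L<0. (\<lambda>n. ereal (1 / real n) *
               ext_expectation P (\<lambda>\<omega>. ext_log (opnorm1 (mean_matrix_prod q p \<omega> n)))) \<longlonglongrightarrow> L"
    and extinction: "AE \<omega> in P.
          measure (quenched q p \<omega>) {\<xi> \<in> space (quenched q p \<omega>). Z 1 \<xi> 1 = 0} > 0"
  shows "(\<exists>!\<mu>. markov_chain_law (state_space S) (init_law S q p P) (chain_kernel S q p) \<mu>) \<and>
         (\<forall>\<mu>. markov_chain_law (state_space S) (init_law S q p P) (chain_kernel S q p) \<mu> \<longrightarrow>
              stationary_under \<mu> path_shift \<and> ergodic_under \<mu> path_shift)"
proof -
  interpret prob_space P by fact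
  interpret branching_env P S q p
    by unfold_locales fact+
  interpret positive_branching_env P S q p
    by unfold_locales (fact P_ergodic, rule positive_probability[OF A1 A2 A3 extinction])
  show ?thesis by (rule chain_stationary_ergodic)
qed

end
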